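(* Let $G=(V,E)$ be a directed graph without multiedges with $n$ nodes and $m$ edges, and $s,t\in V$. The set of minimal walk breakers of $G$ for the $s$-$t$ walks model can be computed in $O(m+n)$ time.
   Context: An $s$-$t$ bridge is an edge whose removal leaves no $s$-$t$ path; all $s$-$t$ bridges appear on every $s$-$t$ path in the same order, giving the bridge sequence $B=(b_1,\dots,b_{|B|})$. For a substring $L=(e_1,\dots,e_k)$ of $B$, a walk breaker for $L$ is a non-empty path from $\mathrm{head}(e_i)$ to $\mathrm{tail}(e_{i+1})$ for some $1\le i<k$ that uses neither $e_1$ nor $e_k$. A walk breaker is identified with (represented by) its bridge sequence, the substring of $B$ consisting of the $s$-$t$ bridges it traverses together with the appropriate boundary; if it contains no $s$-$t$ bridge and connects $b_i$ to $b_{i+1}$, its start is $b_{i+1}$ and its end is $b_i$. One walk breaker dominates another if its bridge sequence is a substring of the other's; a minimal walk breaker is one dominated only by walk breakers with the same bridge sequence. Computing the set means outputting the start and end (in $B$) of each minimal walk breaker. *)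

theory Defs
  imports "Graph_Theory.Graph_Theory"
begin

section \<open>Bridges and walk breakers\<close>

text \<open>
  Substrings of the bridge sequence are represented by their first and last position. The empty
  substring keeps its place: between positions \<open>i\<close> and \<open>i + 1\<close> it is \<open>(i + 1, i)\<close>.
\<close>
definition substring_span :: "nat \<times> nat \<Rightarrow> nat \<times> nat \<Rightarrow> bool" where
  "substring_span x y \<longleftrightarrow> fst y \<le> fst x \<and> snd x \<le> snd y"

context pre_digraph
begin

text \<open>
  The first conjunct only matters when \<open>t\<close> is unreachable from \<open>s\<close>: there are then no bridges,
  instead of every edge vacuously being one.
\<close>
definition st_bridge :: "'a \<Rightarrow> 'a \<Rightarrow> 'b \<Rightarrow> bool" where
  "st_bridge s t e \<longleftrightarrow>
     (\<exists>p. apath s p t) \<and> e \<in> arcs G \<and> \<not> (\<exists>p. pre_digraph.apath (del_arc e) s p t)"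

definition bridge_sequence :: "'a \<Rightarrow> 'a \<Rightarrow> 'b list" where
  "bridge_sequence s t =
     (THE B. distinct B \<and> set B = {e. st_bridge s t e} \<and>
             (\<forall>p. apath s p t \<longrightarrow> filter (st_bridge s t) p = B))"

text \<open>
  A path may be closed, i.e. its first and last node may coincide. For consecutive bridges with a
  common node, the non-empty paths considered below are exactly the cycles through that node.
\<close>
definition nonempty_path :: "'a \<Rightarrow> 'b list \<Rightarrow> 'a \<Rightarrow> bool" where
  "nonempty_path u p v \<longleftrightarrow> p \<noteq> [] \<and> (apath u p v \<or> (u = v \<and> awalk u p v \<and> cycle p))"

text \<open>
  List positions count from 0, so \<open>L ! k\<close> and \<open>L ! Suc k\<close> are the bridges written
  \<open>e\<^sub>i\<close> and \<open>e\<^sub>i\<^sub>+\<^sub>1\<close> for \<open>i = k + 1\<close>.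
\<close>
definition walk_breaker_for :: "'b list \<Rightarrow> nat \<Rightarrow> 'b list \<Rightarrow> bool" where
  "walk_breaker_for L k p \<longleftrightarrow>
     Suc k < length L \<and> nonempty_path (head G (L ! k)) p (tail G (L ! Suc k)) \<and>
     hd L \<notin> set p \<and> last L \<notin> set p"

text \<open>The index \<open>i\<close> is the position in the whole bridge sequence of the bridge where \<open>p\<close> begins.\<close>
definition walk_breaker :: "'a \<Rightarrow> 'a \<Rightarrow> nat \<Rightarrow> 'b list \<Rightarrow> bool" where
  "walk_breaker s t i p \<longleftrightarrow>
     (\<exists>xs L ys k. bridge_sequence s t = xs @ L @ ys \<and> i = length xs + k \<and> walk_breaker_for L k p)"

definition traversed :: "'a \<Rightarrow> 'a \<Rightarrow> 'b list \<Rightarrow> nat set" where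
  "traversed s t p = {j. j < length (bridge_sequence s t) \<and> bridge_sequence s t ! j \<in> set p}"

definition breaker_span :: "'a \<Rightarrow> 'a \<Rightarrow> nat \<Rightarrow> 'b list \<Rightarrow> nat \<times> nat" where
  "breaker_span s t i p =
     (if traversed s t p = {} then (Suc i, i) else (Min (traversed s t p), Max (traversed s t p)))"

definition minimal_walk_breaker :: "'a \<Rightarrow> 'a \<Rightarrow> nat \<Rightarrow> 'b list \<Rightarrow> bool" where
  "minimal_walk_breaker s t i p \<longleftrightarrow> walk_breaker s t i p \<and>
     (\<forall>i' p'. walk_breaker s t i' p' \<and> substring_span (breaker_span s t i' p') (breaker_span s t i p)
        \<longrightarrow> breaker_span s t i' p' = breaker_span s t i p)"

definition minimal_walk_breakers :: "'a \<Rightarrow> 'a \<Rightarrow> ('b \<times> 'b) set" where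
  "minimal_walk_breakers s t =
     {(bridge_sequence s t ! a, bridge_sequence s t ! z) | a z.
        \<exists>i p. minimal_walk_breaker s t i p \<and> breaker_span s t i p = (a, z)}"

end

section \<open>A word RAM\<close>

text \<open>
  Programs use finitely many word-sized variables and arrays, both named by numbers fixed in the
  program text; every operation takes unit time. A machine whose largest word is \<open>W\<close> has no
  execution for a program that computes a larger number, so that unit cost cannot be exploited by
  operating on huge numbers.
\<close>

datatype exp =
    Const nat
  | Var nat
  | Read nat exp
  | Add exp exp
  | Sub exp exp
  | Less exp exp
  | Eq exp exp

datatype com =
    Skip
  | Assign nat exp
  | Write nat exp exp
  | Seq com com
  | If exp com com
  | While exp com

record state =
  vars :: "nat \<Rightarrow> nat"
  arrays :: "nat \<Rightarrow> nat \<Rightarrow> nat"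

primrec eval :: "exp \<Rightarrow> state \<Rightarrow> nat" where
  "eval (Const k) \<sigma> = k"
| "eval (Var x) \<sigma> = vars \<sigma> x"
| "eval (Read a e) \<sigma> = arrays \<sigma> a (eval e \<sigma>)"
| "eval (Add e f) \<sigma> = eval e \<sigma> + eval f \<sigma>"
| "eval (Sub e f) \<sigma> = eval e \<sigma> - eval f \<sigma>"
| "eval (Less e f) \<sigma> = (if eval e \<sigma> < eval f \<sigma> then 1 else 0)"
| "eval (Eq e f) \<sigma> = (if eval e \<sigma> = eval f \<sigma> then 1 else 0)"

primrec fits :: "nat \<Rightarrow> exp \<Rightarrow> state \<Rightarrow> bool" where
  "fits W (Const k) \<sigma> \<longleftrightarrow> k \<le> W"
| "fits W (Var x) \<sigma> \<longleftrightarrow> vars \<sigma> x \<le> W"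
| "fits W (Read a e) \<sigma> \<longleftrightarrow> fits W e \<sigma> \<and> arrays \<sigma> a (eval e \<sigma>) \<le> W"
| "fits W (Add e f) \<sigma> \<longleftrightarrow> fits W e \<sigma> \<and> fits W f \<sigma> \<and> eval e \<sigma> + eval f \<sigma> \<le> W"
| "fits W (Sub e f) \<sigma> \<longleftrightarrow> fits W e \<sigma> \<and> fits W f \<sigma>"
| "fits W (Less e f) \<sigma> \<longleftrightarrow> fits W e \<sigma> \<and> fits W f \<sigma>"
| "fits W (Eq e f) \<sigma> \<longleftrightarrow> fits W e \<sigma> \<and> fits W f \<sigma>"

primrec cost :: "exp \<Rightarrow> nat" where
  "cost (Const k) = 1"
| "cost (Var x) = 1"
| "cost (Read a e) = 1 + cost e"
| "cost (Add e f) = 1 + cost e + cost f"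
| "cost (Sub e f) = 1 + cost e + cost f"
| "cost (Less e f) = 1 + cost e + cost f"
| "cost (Eq e f) = 1 + cost e + cost f"

text \<open>\<open>exec W c \<sigma> T \<tau>\<close>: from \<open>\<sigma>\<close>, program \<open>c\<close> halts after exactly \<open>T\<close> steps in \<open>\<tau>\<close>.\<close>
inductive exec :: "nat \<Rightarrow> com \<Rightarrow> state \<Rightarrow> nat \<Rightarrow> state \<Rightarrow> bool" for W :: nat where
  Skip: "exec W Skip \<sigma> 1 \<sigma>"
| Assign: "fits W e \<sigma> \<Longrightarrow>
    exec W (Assign x e) \<sigma> (1 + cost e) (\<sigma>\<lparr>vars := (vars \<sigma>)(x := eval e \<sigma>)\<rparr>)"
| Write: "fits W e \<sigma> \<Longrightarrow> fits W f \<sigma> \<Longrightarrow>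
    exec W (Write a e f) \<sigma> (1 + cost e + cost f)
      (\<sigma>\<lparr>arrays := (arrays \<sigma>)(a := (arrays \<sigma> a)(eval e \<sigma> := eval f \<sigma>))\<rparr>)"
| Seq: "exec W c \<sigma> T \<sigma>' \<Longrightarrow> exec W d \<sigma>' T' \<sigma>'' \<Longrightarrow> exec W (Seq c d) \<sigma> (T + T') \<sigma>''"
| IfTrue: "fits W e \<sigma> \<Longrightarrow> eval e \<sigma> \<noteq> 0 \<Longrightarrow> exec W c \<sigma> T \<sigma>' \<Longrightarrow>
    exec W (If e c d) \<sigma> (1 + cost e + T) \<sigma>'"
| IfFalse: "fits W e \<sigma> \<Longrightarrow> eval e \<sigma> = 0 \<Longrightarrow> exec W d \<sigma> T \<sigma>' \<Longrightarrow>
    exec W (If e c d) \<sigma> (1 + cost e + T) \<sigma>'"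
| WhileFalse: "fits W e \<sigma> \<Longrightarrow> eval e \<sigma> = 0 \<Longrightarrow> exec W (While e c) \<sigma> (1 + cost e) \<sigma>"
| WhileTrue: "fits W e \<sigma> \<Longrightarrow> eval e \<sigma> \<noteq> 0 \<Longrightarrow> exec W c \<sigma> T \<sigma>' \<Longrightarrow>
    exec W (While e c) \<sigma>' T' \<sigma>'' \<Longrightarrow> exec W (While e c) \<sigma> (1 + cost e + T + T') \<sigma>''"

text \<open>
  The nodes are \<open>0, \<dots>, n - 1\<close>; the edges come as a list in arbitrary order, their tails in
  array 0 and their heads in array 1. All other memory is zero.
\<close>
definition encodes :: "nat \<Rightarrow> (nat \<times> nat) list \<Rightarrow> nat pair_pre_digraph \<Rightarrow> bool" where
  "encodes n es G \<longleftrightarrow> pverts G = {..<n} \<and> distinct es \<and> set es = parcs G"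

definition input_state :: "nat \<Rightarrow> (nat \<times> nat) list \<Rightarrow> nat \<Rightarrow> nat \<Rightarrow> state" where
  "input_state n es s t =
     \<lparr>vars = (\<lambda>_. 0)(0 := n, 1 := length es, 2 := s, 3 := t),
      arrays = (\<lambda>_ _. 0)(0 := (\<lambda>i. if i < length es then fst (es ! i) else 0),
                         1 := (\<lambda>i. if i < length es then snd (es ! i) else 0))\<rparr>"

text \<open>
  Variable 0 holds the number of pairs of edges that are output, arrays 0 to 3 the end points of
  these edges.
\<close>
definition output_pairs :: "state \<Rightarrow> ((nat \<times> nat) \<times> (nat \<times> nat)) list" where
  "output_pairs \<sigma> =
     map (\<lambda>i. ((arrays \<sigma> 0 i, arrays \<sigma> 1 i), (arrays \<sigma> 2 i, arrays \<sigma> 3 i))) [0..<vars \<sigma> 0]"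

end

theory Submission
  imports Defs
begin

text \<open>
  The span of every walk breaker contains an interval \<open>(i + 1, j)\<close>, \<open>i \<le> j\<close>, such that some non-empty
  bridge-free walk leads from the head of the bridge \<open>b\<^sub>j\<close> to the tail of \<open>b\<^sub>i\<^sub>+\<^sub>1\<close>. Conversely, a
  minimal such interval is the span of a walk breaker, because minimality forces consecutive
  bridges in between to touch and the walk to meet them only at its ends. So it
  suffices to compute, for each \<open>j\<close>, the largest such \<open>i\<close>, and to drop the intervals that contain
  another one, which takes one scan with a running optimum.

  All the graph work is done by one search procedure that has a sequence of sources and labels each
  node with the first source that reaches it. A backward search from \<open>t\<close> yields an \<open>s\<close>-\<open>t\<close> path. A
  search from the nodes of this path that avoids its edges yields the bridges: a path edge is one
  iff no node after it is labelled by a node before it. A backward search that avoids the bridges,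
  from their tails in reverse order, labels each node with the last bridge it leads to.
\<close>

section \<open>Minimal walk breakers and bridge-free walks\<close>

lemma rtrancl_weaken: "(x, y) \<in> A\<^sup>* \<Longrightarrow> A \<subseteq> B \<Longrightarrow> (x, y) \<in> B\<^sup>*"
  using rtrancl_mono by blast

locale bridge_chain =
  fixes R :: "('a \<times> 'a) set" and s t :: 'a and B :: "('a \<times> 'a) list"
  assumes chain_arcs: "set B \<subseteq> R"
    and chain_distinct: "distinct B"
    and chain_cut: "b \<in> set B \<Longrightarrow> (s, t) \<notin> (R - {b})\<^sup>*"
    and chain_start: "i < length B \<Longrightarrow> (s, fst (B ! i)) \<in> (R - (!) B ` {i..<length B})\<^sup>*"
    and chain_end: "i < length B \<Longrightarrow> (snd (B ! i), t) \<in> (R - (!) B ` {..i})\<^sup>*"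
    and chain_link: "Suc i < length B \<Longrightarrow> (snd (B ! i), fst (B ! Suc i)) \<in> (R - set B)\<^sup>*"
begin

definition free_span :: "nat \<Rightarrow> nat \<Rightarrow> bool" where
  "free_span i j \<longleftrightarrow> i \<le> j \<and> Suc j < length B \<and> (snd (B ! j), fst (B ! Suc i)) \<in> (R - set B)\<^sup>+"

definition minimal_free_span :: "nat \<Rightarrow> nat \<Rightarrow> bool" where
  "minimal_free_span i j \<longleftrightarrow> free_span i j \<and>
     (\<forall>i' j'. free_span i' j' \<and> i \<le> i' \<and> j' \<le> j \<longrightarrow> i' = i \<and> j' = j)"

lemma start_avoids: "l < length B \<Longrightarrow> i \<le> l \<Longrightarrow> (s, fst (B ! i)) \<in> (R - {B ! l})\<^sup>*"
  by (rule rtrancl_weaken[OF chain_start[of i]]) auto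

lemma end_avoids: "l < length B \<Longrightarrow> i < length B \<Longrightarrow> l \<le> i \<Longrightarrow> (snd (B ! i), t) \<in> (R - {B ! l})\<^sup>*"
  by (rule rtrancl_weaken[OF chain_end[of i]]) auto

lemma not_avoid_to_head:
  assumes "l \<le> i" "i < length B" shows "(s, snd (B ! i)) \<notin> (R - {B ! l})\<^sup>*"
  using assms chain_cut[of "B ! l"] end_avoids[of l i] rtrancl_trans by fastforce

lemma nth_arc: "i < length B \<Longrightarrow> (fst (B ! i), snd (B ! i)) \<in> R"
  using chain_arcs nth_mem[of i B] by auto

lemma not_avoid_to_tail:
  assumes "l < i" "i < length B" shows "(s, fst (B ! i)) \<notin> (R - {B ! l})\<^sup>*"
proof
  assume "(s, fst (B ! i)) \<in> (R - {B ! l})\<^sup>*"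
  moreover have "(fst (B ! i), snd (B ! i)) \<in> R - {B ! l}"
    using assms nth_arc[of i] chain_distinct by (auto simp: nth_eq_iff_index_eq)
  ultimately have "(s, snd (B ! i)) \<in> (R - {B ! l})\<^sup>*"
    by (rule rtrancl_into_rtrancl)
  then show False
    using not_avoid_to_head[of l i] assms by simp
qed

lemma start_avoids_head:
  assumes "i < l" "l < length B" shows "(s, snd (B ! i)) \<in> (R - {B ! l})\<^sup>*"
proof -
  have "(fst (B ! i), snd (B ! i)) \<in> R - {B ! l}"
    using assms nth_arc[of i] chain_distinct by (auto simp: nth_eq_iff_index_eq)
  then show ?thesis
    using start_avoids[of l i] assms by (auto intro: rtrancl_into_rtrancl)
qed

lemma head_neq_tail: "c \<le> z \<Longrightarrow> z < length B \<Longrightarrow> snd (B ! z) \<noteq> fst (B ! c)"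
  using not_avoid_to_head[of c z] start_avoids[of c c] by auto

lemma free_walk_backwards:
  assumes "(snd (B ! j), fst (B ! Suc i)) \<in> (R - set B)\<^sup>*" "Suc i < length B" "j < length B"
  shows "i \<le> j"
proof (rule ccontr)
  assume "\<not> i \<le> j"
  then have "(s, snd (B ! j)) \<in> (R - {B ! i})\<^sup>*" "(s, fst (B ! Suc i)) \<notin> (R - {B ! i})\<^sup>*"
    using assms start_avoids_head[of j i] not_avoid_to_tail[of i "Suc i"] by auto
  moreover have "(snd (B ! j), fst (B ! Suc i)) \<in> (R - {B ! i})\<^sup>*"
    using assms by (elim rtrancl_weaken) auto
  ultimately show False
    by (blast intro: rtrancl_trans)
qed

lemma free_span_if_gap_nontrivial:
  assumes "Suc i < length B" "snd (B ! i) \<noteq> fst (B ! Suc i)" shows "free_span i i"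
  using assms chain_link[of i] by (auto simp: free_span_def rtrancl_eq_or_trancl)

lemma ex_minimal_free_span:
  assumes "free_span i j"
  shows "\<exists>i' j'. minimal_free_span i' j' \<and> i \<le> i' \<and> j' \<le> j"
  using assms
proof (induction "j - i" arbitrary: i j rule: less_induct)
  case less
  show ?case
  proof (cases "minimal_free_span i j")
    case False
    then obtain i' j' where *: "free_span i' j'" "i \<le> i'" "j' \<le> j" "i' \<noteq> i \<or> j' \<noteq> j"
      using less.prems by (auto simp: minimal_free_span_def)
    moreover have "i' \<le> j'" using * by (simp add: free_span_def)
    ultimately have "j' - i' < j - i" by linarith
    from less.hyps[OF this *(1)] * show ?thesis by (meson order_trans)
  qed blast
qed

end

lemma sorted_wrt_unique:
  assumes "sorted_wrt D xs" "sorted_wrt D ys" "set xs = set ys" "distinct xs" "distinct ys"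
    and "\<And>x y. x \<in> set xs \<Longrightarrow> y \<in> set xs \<Longrightarrow> D x y \<Longrightarrow> \<not> D y x"
  shows "xs = ys"
  using assms
proof (induction xs arbitrary: ys)
  case (Cons x xs)
  obtain y ys' where ys: "ys = y # ys'" using Cons.prems(3) by (cases ys) auto
  have "x = y"
  proof (rule ccontr)
    assume "x \<noteq> y"
    then have "y \<in> set xs" "x \<in> set ys'" using Cons.prems(3) ys by auto
    then have "D x y" "D y x" using Cons.prems(1,2) ys by simp_all
    then show False using Cons.prems(6)[of x y] \<open>y \<in> set xs\<close> by simp
  qed
  moreover have "xs = ys'"
  proof (rule Cons.IH)
    show "set xs = set ys'" using Cons.prems(3-5) ys \<open>x = y\<close> by (auto simp: insert_ident)
    show "D u v \<Longrightarrow> \<not> D v u" if "u \<in> set xs" "v \<in> set xs" for u v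
      using Cons.prems(6)[of u v] that by simp
  qed (use Cons.prems(1,2,4,5) ys in simp_all)
  ultimately show ?case using ys by simp
qed simp

context pair_wf_digraph
begin

lemma awalk_imp_rtrancl: "awalk u p v \<Longrightarrow> (u, v) \<in> (set p)\<^sup>*"
proof (induction p arbitrary: u)
  case (Cons e p)
  then have "(snd e, v) \<in> (set p)\<^sup>*" "fst e = u"
    by (auto simp: awalk_Cons_iff)
  then have "(u, snd e) \<in> set (e # p)" "(snd e, v) \<in> (set (e # p))\<^sup>*"
    using rtrancl_mono[of "set p" "set (e # p)"] by auto
  then show ?case by (rule converse_rtrancl_into_rtrancl)
qed (auto simp: awalk_Nil_iff)

lemma rtrancl_imp_awalk:
  assumes "(u, v) \<in> A\<^sup>*" "A \<subseteq> parcs G" "u \<in> pverts G"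
  shows "\<exists>p. awalk u p v \<and> set p \<subseteq> A"
  using assms
proof (induction rule: converse_rtrancl_induct)
  case base then show ?case by (intro exI[of _ "[]"]) (simp add: awalk_Nil_iff)
next
  case (step y z)
  then obtain p where "awalk z p v" "set p \<subseteq> A"
    using in_arcsD2[of y z] by auto
  with step show ?case
    by (intro exI[of _ "(y, z) # p"]) (auto simp: awalk_Cons_iff)
qed

lemma rtrancl_imp_apath:
  assumes "(u, v) \<in> A\<^sup>*" "A \<subseteq> parcs G" "u \<in> pverts G"
  shows "\<exists>p. apath u p v \<and> set p \<subseteq> A"
  using rtrancl_imp_awalk[OF assms] apath_awalk_to_apath awalk_to_apath_subset by blast

lemma ex_apath_iff: "u \<in> pverts G \<Longrightarrow> (\<exists>p. apath u p v) \<longleftrightarrow> (u, v) \<in> (parcs G)\<^sup>*"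
proof
  assume "\<exists>p. apath u p v"
  then obtain p where "awalk u p v" by (auto simp: apath_def)
  then have "(u, v) \<in> (set p)\<^sup>*" "set p \<subseteq> parcs G"
    using awalk_imp_rtrancl by (auto simp: awalk_def)
  then show "(u, v) \<in> (parcs G)\<^sup>*" using rtrancl_mono by blast
qed (use rtrancl_imp_apath in blast)

lemma st_bridge_iff:
  assumes "s \<in> pverts G"
  shows "st_bridge s t e \<longleftrightarrow>
    (s, t) \<in> (parcs G)\<^sup>* \<and> e \<in> parcs G \<and> (s, t) \<notin> (parcs G - {e})\<^sup>*"
proof -
  let ?H = "G\<lparr>parcs := parcs G - {e}\<rparr>"
  have H: "pair_wf_digraph ?H"
    using arc_fst_in_verts arc_snd_in_verts by unfold_locales auto
  have "del_arc e = with_proj ?H"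
    by (simp add: pre_digraph.del_arc_def with_proj_def)
  then have "(\<exists>p. pre_digraph.apath (del_arc e) s p t) \<longleftrightarrow> (s, t) \<in> (parcs G - {e})\<^sup>*"
    using pair_wf_digraph.ex_apath_iff[OF H, of s t] assms by (simp only:) simp
  then show ?thesis
    using assms by (simp add: st_bridge_def ex_apath_iff)
qed

lemma bridge_in_walk:
  assumes "awalk s p t" "st_bridge s t b" "s \<in> pverts G" shows "b \<in> set p"
proof (rule ccontr)
  assume "b \<notin> set p"
  then have "set p \<subseteq> parcs G - {b}" using assms by (auto simp: awalk_def)
  then show False
    using awalk_imp_rtrancl[OF assms(1)] rtrancl_mono assms st_bridge_iff by blast
qed

lemma bridges_on_path_sorted:
  assumes "apath s p t" "s \<in> pverts G"
  shows "sorted_wrt (\<lambda>b b'. (s, fst b') \<notin> (parcs G - {b})\<^sup>*) (filter (st_bridge s t) p)"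
proof -
  have dp: "distinct p" and w: "awalk s p t"
    using assms distinct_verts_imp_distinct by (auto simp: apath_def)
  have "sorted_wrt (\<lambda>b b'. st_bridge s t b \<longrightarrow> (s, fst b') \<notin> (parcs G - {b})\<^sup>*) p"
    unfolding sorted_wrt_iff_nth_less
  proof (intro allI impI notI)
    fix i j assume ij: "i < j" "j < length p" and br: "st_bridge s t (p ! i)"
      and r: "(s, fst (p ! j)) \<in> (parcs G - {p ! i})\<^sup>*"
    have "p = take j p @ drop j p" by simp
    with w have "awalk s (take j p @ drop j p) t" by simp
    then obtain u where "awalk u (drop j p) t" by (auto simp del: append_take_drop_id)
    moreover have "drop j p = p ! j # drop (Suc j) p" using ij by (simp add: Cons_nth_drop_Suc)
    ultimately have "awalk (fst (p ! j)) (drop j p) t"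
      by (auto simp: awalk_Cons_iff)
    then have "(fst (p ! j), t) \<in> (set (drop j p))\<^sup>*" "set (drop j p) \<subseteq> parcs G"
      using awalk_imp_rtrancl by (auto simp: awalk_def)
    moreover have "p ! i \<notin> set (drop j p)"
      using ij dp by (auto simp: in_set_conv_nth nth_eq_iff_index_eq)
    ultimately have "(fst (p ! j), t) \<in> (parcs G - {p ! i})\<^sup>*"
      using rtrancl_mono[of "set (drop j p)" "parcs G - {p ! i}"] by auto
    with r have "(s, t) \<in> (parcs G - {p ! i})\<^sup>*" by (rule rtrancl_trans)
    with br show False using st_bridge_iff assms by blast
  qed
  then have "sorted_wrt (\<lambda>b b'. st_bridge s t b \<longrightarrow> (s, fst b') \<notin> (parcs G - {b})\<^sup>*)
      (filter (st_bridge s t) p)"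
    by (rule sorted_wrt_filter)
  then show ?thesis
    by (rule sorted_wrt_mono_rel[rotated]) auto
qed

lemma bridge_sequence_eq:
  assumes "bridge_chain (parcs G) s t B" "set B = {e. st_bridge s t e}" "s \<in> pverts G"
  shows "bridge_sequence s t = B"
proof -
  interpret bridge_chain "parcs G" s t B by fact
  let ?D = "\<lambda>b b'. (s, fst b') \<notin> (parcs G - {b})\<^sup>*"
  have *: "filter (st_bridge s t) p = B" if "apath s p t" for p
  proof (rule sorted_wrt_unique[of ?D])
    show "sorted_wrt ?D (filter (st_bridge s t) p)"
      using bridges_on_path_sorted that assms by simp
    show "sorted_wrt ?D B"
      using not_avoid_to_tail by (auto simp: sorted_wrt_iff_nth_less)
    have "{e. st_bridge s t e} \<subseteq> set p"
      using bridge_in_walk that assms by (auto simp: apath_def)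
    then show eq: "set (filter (st_bridge s t) p) = set B"
      using assms by auto
    show "distinct (filter (st_bridge s t) p)"
      using that distinct_verts_imp_distinct by (auto simp: apath_def)
    show "distinct B" by (rule chain_distinct)
    fix x y assume "x \<in> set (filter (st_bridge s t) p)" "y \<in> set (filter (st_bridge s t) p)" "?D x y"
    then obtain i j where "i < length B" "x = B ! i" "j < length B" "y = B ! j"
      unfolding eq by (metis in_set_conv_nth)
    then show "\<not> ?D y x"
      using \<open>?D x y\<close> start_avoids[of i j] start_avoids[of j i] by (cases "j \<le> i") auto
  qed
  show ?thesis
    unfolding bridge_sequence_def
  proof (rule the_equality)
    fix B' assume B': "distinct B' \<and> set B' = {e. st_bridge s t e} \<and>
      (\<forall>p. apath s p t \<longrightarrow> filter (st_bridge s t) p = B')"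
    show "B' = B"
    proof (cases "\<exists>p. apath s p t")
      case False
      then have "set B' = {}" "set B = {}"
        using B' assms by (auto simp: st_bridge_def)
      then show ?thesis by simp
    qed (use B' * in auto)
  qed (use assms chain_distinct * in auto)
qed

lemma awalk_imp_trancl: "awalk u p v \<Longrightarrow> p \<noteq> [] \<Longrightarrow> (u, v) \<in> (set p)\<^sup>+"
proof (cases p)
  case (Cons e q)
  moreover assume "awalk u p v"
  ultimately have "fst e = u" "(snd e, v) \<in> (set p)\<^sup>*"
    using awalk_imp_rtrancl[of "snd e" q v] by (auto simp: awalk_Cons_iff intro: rtrancl_weaken)
  moreover from this Cons have "(u, snd e) \<in> set p" by auto
  ultimately show ?thesis by (intro rtrancl_into_trancl2)
qed simp

lemma trancl_imp_nonempty_path: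
  assumes "(u, v) \<in> A\<^sup>+" "A \<subseteq> parcs G"
  shows "\<exists>p. nonempty_path u p v \<and> set p \<subseteq> A"
proof -
  obtain w where w: "(u, w) \<in> A" "(w, v) \<in> A\<^sup>*" using assms tranclD by metis
  have uw: "u \<in> pverts G" "w \<in> pverts G" using w assms in_arcsD1 in_arcsD2 by auto
  show ?thesis
  proof (cases "u = v")
    case True
    obtain q where q: "apath w q v" "set q \<subseteq> A" using rtrancl_imp_apath[OF w(2) assms(2) uw(2)] by auto
    then have "awalk u ((u, w) # q) v"
      using w uw assms by (auto simp: awalk_Cons_iff apath_def)
    moreover from this q have "cycle ((u, w) # q)"
      unfolding cycle_def using True by (auto simp: apath_def)
    ultimately show ?thesis using True q w
      by (intro exI[of _ "(u, w) # q"]) (auto simp: nonempty_path_def)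
  next
    case False
    obtain q where q: "apath u q v" "set q \<subseteq> A"
      using rtrancl_imp_apath[of u v A] assms uw by (auto dest: trancl_into_rtrancl)
    then show ?thesis using False
      by (intro exI[of _ q]) (auto simp: nonempty_path_def apath_Nil_iff)
  qed
qed

lemma nonempty_path_awalk: "nonempty_path u p v \<Longrightarrow> awalk u p v \<and> p \<noteq> []"
  by (auto simp: nonempty_path_def apath_def)

lemma walk_breaker_iff:
  assumes "bridge_sequence s t = B"
  shows "walk_breaker s t i p \<longleftrightarrow>
    (\<exists>l r. l \<le> i \<and> i < r \<and> r < length B \<and> nonempty_path (snd (B ! i)) p (fst (B ! Suc i)) \<and>
       B ! l \<notin> set p \<and> B ! r \<notin> set p)" (is "?lhs \<longleftrightarrow> ?rhs")
proof
  assume ?lhs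
  then obtain xs L ys k where *: "B = xs @ L @ ys" "i = length xs + k" "walk_breaker_for L k p"
    using assms by (auto simp: walk_breaker_def)
  then have k: "Suc k < length L" by (simp add: walk_breaker_for_def)
  then have "L \<noteq> []" by auto
  with k * have "hd L = B ! length xs" "last L = B ! (length xs + (length L - 1))"
    "L ! k = B ! i" "L ! Suc k = B ! Suc i"
    by (auto simp: nth_append hd_conv_nth last_conv_nth)
  with * k show ?rhs
    by (intro exI[of _ "length xs"] exI[of _ "length xs + (length L - 1)"])
      (auto simp: walk_breaker_for_def)
next
  assume ?rhs
  then obtain l r where *: "l \<le> i" "i < r" "r < length B"
    "nonempty_path (snd (B ! i)) p (fst (B ! Suc i))" "B ! l \<notin> set p" "B ! r \<notin> set p"
    by auto
  define L where "L = take (Suc r - l) (drop l B)"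
  have len: "length L = Suc r - l" using * by (simp add: L_def)
  have nth: "L ! x = B ! (l + x)" if "x < Suc r - l" for x
    using that * by (simp add: L_def)
  have "L \<noteq> []" using len * by auto
  have "B = take l B @ L @ drop (Suc r - l) (drop l B)"
    by (simp only: L_def append_take_drop_id)
  moreover have "walk_breaker_for L (i - l) p"
    unfolding walk_breaker_for_def using * len nth[of "i - l"] nth[of "Suc (i - l)"] nth[of 0] nth[of "r - l"]
      \<open>L \<noteq> []\<close>
    by (simp add: hd_conv_nth last_conv_nth Suc_diff_le)
  ultimately show ?lhs
    unfolding walk_breaker_def assms using *
    by (intro exI[of _ "take l B"] exI[of _ L] exI[of _ "drop (Suc r - l) (drop l B)"] exI[of _ "i - l"])
      (auto simp: min_def)
qed

lemma breaker_span_contains_free_span: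
  assumes "bridge_chain (parcs G) s t B" "bridge_sequence s t = B" "walk_breaker s t i p"
  shows "\<exists>i' j'. bridge_chain.free_span (parcs G) B i' j' \<and>
    substring_span (Suc i', j') (breaker_span s t i p)"
proof -
  interpret bridge_chain "parcs G" s t B by fact
  obtain l r where lr: "l \<le> i" "i < r" "r < length B" "B ! l \<notin> set p" "B ! r \<notin> set p"
    and path: "nonempty_path (snd (B ! i)) p (fst (B ! Suc i))"
    using assms by (auto simp: walk_breaker_iff)
  from path have w: "awalk (snd (B ! i)) p (fst (B ! Suc i))" and ne: "p \<noteq> []"
    using nonempty_path_awalk by auto
  then have parcs: "set p \<subseteq> parcs G" by auto
  have avoid: "(x, y) \<in> (parcs G - {b})\<^sup>*" if "awalk x q y" "set q \<subseteq> set p" "b \<notin> set p" for x q y b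
    using that parcs by (intro rtrancl_weaken[OF awalk_imp_rtrancl[OF that(1)]]) auto
  have below: "B ! x \<in> set p" if lx: "l' \<le> x" "x \<le> i" "B ! l' \<in> set p" for l' x
  proof (rule ccontr)
    assume x: "B ! x \<notin> set p"
    obtain p1 p2 where p: "p = p1 @ B ! l' # p2" using split_list[OF lx(3)] by blast
    with w have "awalk (fst (B ! l')) (B ! l' # p2) (fst (B ! Suc i))" by (auto simp: awalk_Cons_iff)
    then have "(fst (B ! l'), fst (B ! Suc i)) \<in> (parcs G - {B ! x})\<^sup>*"
      using x p by (intro avoid) auto
    moreover have "(s, fst (B ! l')) \<in> (parcs G - {B ! x})\<^sup>*"
      using start_avoids[of x l'] lx lr by auto
    ultimately show False
      using not_avoid_to_tail[of x "Suc i"] lx lr rtrancl_trans by fastforce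
  qed
  have above: "B ! x \<in> set p" if rx: "i < x" "x \<le> r'" "r' < length B" "B ! r' \<in> set p" for r' x
  proof (rule ccontr)
    assume x: "B ! x \<notin> set p"
    obtain p1 p2 where p: "p = (p1 @ [B ! r']) @ p2" using split_list[OF rx(4)] by auto
    with w have "awalk (snd (B ! i)) (p1 @ [B ! r']) (snd (B ! r'))" by (auto simp: awalk_Cons_iff awalk_Nil_iff)
    then have "(snd (B ! i), snd (B ! r')) \<in> (parcs G - {B ! x})\<^sup>*"
      using x p by (intro avoid[of _ "p1 @ [B ! r']"]) (simp_all, blast)
    moreover have "(s, snd (B ! i)) \<in> (parcs G - {B ! x})\<^sup>*"
      using start_avoids_head[of i x] rx lr by auto
    ultimately show False
      using not_avoid_to_head[of x r'] rx lr rtrancl_trans by fastforce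
  qed
  define X where "X = traversed s t p"
  have X: "x \<in> X \<longleftrightarrow> x < length B \<and> B ! x \<in> set p" for x
    using assms(2) by (simp add: X_def traversed_def)
  have fX: "finite X" by (rule finite_subset[of _ "{..<length B}"]) (auto simp: X)
  show ?thesis
  proof (cases "X = {}")
    case True
    then have "set p \<subseteq> parcs G - set B" 
    proof -
      have "e \<notin> set p" if "e \<in> set B" for e
        using that X True by (metis empty_iff in_set_conv_nth)
      then show ?thesis using parcs by blast
    qed
    then have "free_span i i"
      using awalk_imp_trancl[OF w ne] lr trancl_mono_subset[of "set p" "parcs G - set B"]
      by (auto simp: free_span_def)
    then show ?thesis
      using True by (auto simp: breaker_span_def X_def[symmetric] substring_span_def)
  next
    case False
    let ?a = "Min X" and ?z = "Max X"
    have aX: "?a \<in> X" and zX: "?z \<in> X" using False fX by auto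
    have span: "breaker_span s t i p = (?a, ?z)" using False by (simp add: breaker_span_def X_def)
    show ?thesis
    proof (cases "snd (B ! i) = fst (B ! Suc i)")
      case False
      then have free: "free_span i i" using lr by (intro free_span_if_gap_nontrivial) auto
      have "?a \<le> Suc i \<and> i \<le> ?z"
      proof (cases "?a \<le> i")
        case True
        then have "i \<in> X" using below[of ?a i] aX lr by (simp add: X)
        then show ?thesis using True Max_ge[OF fX] by auto
      next
        case False
        then have "Suc i \<in> X" using above[of "Suc i" ?a] aX lr by (simp add: X)
        then show ?thesis using Min_le[OF fX] Max_ge[OF fX] Suc_leD by blast
      qed
      with free span show ?thesis by (auto simp: substring_span_def)
    next
      case True
      have a0: "0 < ?a"
      proof (rule ccontr)
        assume "\<not> 0 < ?a"
        then show False using below[of 0 l] aX lr by (simp add: X)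
      qed
      have z1: "Suc ?z < length B"
      proof (rule ccontr)
        assume "\<not> Suc ?z < length B"
        then show False using above[of r ?z] zX lr by (simp add: X)
      qed
      obtain p1 p2 where p: "p = p1 @ B ! ?z # p2" using zX split_list[of "B ! ?z" p] unfolding X by blast
      let ?c = "p2 @ p1 @ [B ! ?z]"
      have c: "awalk (snd (B ! ?z)) ?c (snd (B ! ?z))"
        using w p True by (auto simp: awalk_Cons_iff awalk_Nil_iff)
      have "B ! ?z \<in> set ?c" "B ! ?z \<in> set B" using zX X by auto
      then obtain ys b zs where cs: "?c = ys @ b # zs" "b \<in> set B" "\<forall>y\<in>set ys. y \<notin> set B"
        using split_list_first_prop[of ?c "\<lambda>b. b \<in> set B"] by blast
      then obtain x where x: "x < length B" "b = B ! x" by (auto simp: in_set_conv_nth)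
      have "set ?c = set p" using p by auto
      then have setc: "set p = set (ys @ b # zs)" using cs by simp
      then have "x \<in> X" using x by (auto simp: X)
      then have ax: "?a \<le> x" "x \<le> ?z" using fX by auto
      have ys: "awalk (snd (B ! ?z)) ys (fst b)" using c cs by (auto simp: awalk_Cons_iff)
      have "ys \<noteq> []"
        using ys head_neq_tail[of x ?z] ax x z1 by (auto simp: awalk_Nil_iff)
      moreover have "set ys \<subseteq> parcs G - set B" using cs setc parcs by auto
      ultimately have "(snd (B ! ?z), fst (B ! x)) \<in> (parcs G - set B)\<^sup>+"
        using awalk_imp_trancl[OF ys] x trancl_mono_subset[of "set ys" "parcs G - set B"] by blast
      then have "free_span (x - 1) ?z" using ax a0 z1 by (auto simp: free_span_def)
      then show ?thesis using span ax a0
        by (intro exI[of _ "x - 1"] exI[of _ ?z]) (auto simp: substring_span_def)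
    qed
  qed
qed

lemma awalk_tight_bridges:
  assumes "bridge_chain (parcs G) s t B" "j < length B" "i \<le> j"
    and "\<And>k. i \<le> k \<Longrightarrow> k < j \<Longrightarrow> snd (B ! k) = fst (B ! Suc k)"
  shows "awalk (fst (B ! i)) (map ((!) B) [i..<Suc j]) (snd (B ! j))"
  using assms(3,4)
proof (induction rule: inc_induct)
  case base
  then show ?case
    using assms(2) bridge_chain.nth_arc[OF assms(1), of j] in_arcsD1 in_arcsD2
    by (auto simp: awalk_Cons_iff awalk_Nil_iff)
next
  case (step k)
  have "[k..<Suc j] = k # [Suc k..<Suc j]" using step by (intro upt_conv_Cons) simp
  moreover have "B ! k \<in> parcs G"
    using step.hyps assms(2) bridge_chain.nth_arc[OF assms(1), of k] by simp
  moreover have "awalk (snd (B ! k)) (map ((!) B) [Suc k..<Suc j]) (snd (B ! j))"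
    using step.IH step.prems step.hyps by (simp del: upt_Suc)
  ultimately show ?case
    by (simp add: awalk_Cons_iff del: upt_Suc)
qed

lemma minimal_free_span_is_breaker_span:
  assumes "bridge_chain (parcs G) s t B" "bridge_sequence s t = B"
    and "bridge_chain.minimal_free_span (parcs G) B i j"
  shows "\<exists>p. walk_breaker s t i p \<and> breaker_span s t i p = (Suc i, j)"
proof -
  interpret bridge_chain "parcs G" s t B by fact
  have "free_span i j"
    and min: "\<And>i' j'. free_span i' j' \<Longrightarrow> i \<le> i' \<Longrightarrow> j' \<le> j \<Longrightarrow> i' = i \<and> j' = j"
    using assms(3) unfolding minimal_free_span_def by blast+
  then have fs: "i \<le> j" "Suc j < length B" "(snd (B ! j), fst (B ! Suc i)) \<in> (parcs G - set B)\<^sup>+"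
    by (simp_all add: free_span_def)
  show ?thesis
  proof (cases "i = j")
    case True
    obtain p where p: "nonempty_path (snd (B ! i)) p (fst (B ! Suc i))" "set p \<subseteq> parcs G - set B"
      using trancl_imp_nonempty_path[OF fs(3)] True by auto
    have free: "B ! x \<notin> set p" if "x < length B" for x using p that by auto
    have "walk_breaker s t i p"
      unfolding walk_breaker_iff[OF assms(2)] using p fs True free
      by (intro exI[of _ i] exI[of _ "Suc i"]) auto
    moreover have "traversed s t p = {}" using free assms(2) by (auto simp: traversed_def)
    ultimately show ?thesis using True by (auto simp: breaker_span_def)
  next
    case False
    then have ij: "i < j" using fs by simp
    have tight: "snd (B ! k) = fst (B ! Suc k)" if "i \<le> k" "k \<le> j" for k
      using free_span_if_gap_nontrivial[of k] min[of k k] that fs False by auto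
    obtain Q where Q: "apath (snd (B ! j)) Q (fst (B ! Suc i))" "set Q \<subseteq> parcs G - set B"
      using rtrancl_imp_apath[OF trancl_into_rtrancl[OF fs(3)]] nth_arc[of j] fs in_arcsD2 by auto
    define P where "P = map ((!) B) [Suc i..<Suc j]"
    have P: "awalk (fst (B ! Suc i)) P (snd (B ! j))"
      unfolding P_def using fs ij tight by (intro awalk_tight_bridges[OF assms(1)]) auto
    have setP: "set P = (!) B ` {Suc i..j}" by (auto simp: P_def simp del: upt_Suc)
    have Pne: "P \<noteq> []" using setP ij by auto
    have w: "awalk (fst (B ! Suc i)) (P @ Q) (fst (B ! Suc i))"
      using P Q by (auto simp: apath_def)
    have "Q \<noteq> []"
      using Q head_neq_tail[of "Suc i" j] fs ij by (auto simp: apath_Nil_iff)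
    then have Qv: "pawalk_verts (snd (B ! j)) Q = snd (B ! j) # map snd Q"
      using Q awalk_verts_conv'[of "snd (B ! j)" Q "fst (B ! Suc i)"]
      by (cases Q) (auto simp: apath_def awalk_Cons_iff)
    have "distinct (map snd (P @ Q))"
    proof -
      have "distinct (map snd Q)" "snd (B ! j) \<notin> snd ` set Q"
        using Q Qv by (auto simp: apath_def)
      moreover have "distinct (map snd P)"
      proof -
        have "inj_on (\<lambda>k. snd (B ! k)) {Suc i..<Suc j}"
        proof (rule linorder_inj_onI)
          fix k k' assume "k < k'" "k \<in> {Suc i..<Suc j}" "k' \<in> {Suc i..<Suc j}"
          then show "snd (B ! k) \<noteq> snd (B ! k')"
            using tight[of k] head_neq_tail[of "Suc k" k'] fs by auto
        qed auto
        then show ?thesis by (simp add: P_def distinct_map o_def del: upt_Suc)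
      qed
      moreover have "snd (B ! k) \<notin> snd ` set Q" if k: "Suc i \<le> k" "k < j" for k
      proof
        assume "snd (B ! k) \<in> snd ` set Q"
        then obtain e Q1 Q2 where e: "Q = Q1 @ e # Q2" "snd e = snd (B ! k)"
          by (metis imageE split_list)
        then have "awalk (snd (B ! k)) Q2 (fst (B ! Suc i))"
          using Q by (auto simp: apath_def awalk_Cons_iff)
        moreover have "Q2 \<noteq> []"
          using calculation head_neq_tail[of "Suc i" k] k fs by (auto simp: awalk_Nil_iff)
        ultimately have "(snd (B ! k), fst (B ! Suc i)) \<in> (set Q2)\<^sup>+"
          by (rule awalk_imp_trancl)
        then have "free_span i k"
          using e Q k fs trancl_mono_subset[of "set Q2" "parcs G - set B"] by (auto simp: free_span_def)
        then show False using min[of i k] k by auto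
      qed
      ultimately have "snd (B ! k) \<notin> snd ` set Q" if "Suc i \<le> k" "k \<le> j" for k
        using that by (cases "k = j") auto
      then have "snd ` set P \<inter> snd ` set Q = {}" unfolding setP by (fastforce simp: image_iff)
      then show ?thesis
        using \<open>distinct (map snd P)\<close> \<open>distinct (map snd Q)\<close> by simp
    qed
    moreover have "pawalk_verts (fst (B ! Suc i)) (P @ Q) = fst (hd P) # map snd (P @ Q)"
      using w Pne awalk_verts_conv'[of "fst (B ! Suc i)" "P @ Q" "fst (B ! Suc i)"]
      by (auto simp: awalk_def)
    ultimately have "cycle (P @ Q)"
      unfolding cycle_def using w Pne by (intro exI[of _ "fst (B ! Suc i)"]) auto
    then have np: "nonempty_path (snd (B ! i)) (P @ Q) (fst (B ! Suc i))"
      using w Pne tight[of i] ij by (simp add: nonempty_path_def)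
    have mem: "B ! x \<in> set (P @ Q) \<longleftrightarrow> x \<in> {Suc i..j}" if "x < length B" for x
    proof -
      have "B ! x \<notin> set Q" using Q that nth_mem[of x B] by blast
      then show ?thesis
        using that fs chain_distinct by (auto simp: setP nth_eq_iff_index_eq)
    qed
    have "walk_breaker s t i (P @ Q)"
      unfolding walk_breaker_iff[OF assms(2)] using np fs mem[of i] mem[of "Suc j"] ij
      by (intro exI[of _ i] exI[of _ "Suc j"]) auto
    moreover have "traversed s t (P @ Q) = {Suc i..j}"
    proof -
      have "x < length B \<and> B ! x \<in> set (P @ Q) \<longleftrightarrow> x \<in> {Suc i..j}" for x
        using mem[of x] fs by (cases "x < length B") auto
      then show ?thesis unfolding traversed_def assms(2) by blast
    qed
    moreover have "Min {Suc i..j} = Suc i" "Max {Suc i..j} = j"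
      using ij by (auto intro: Min_eqI Max_eqI)
    ultimately show ?thesis using ij
      by (intro exI[of _ "P @ Q"]) (auto simp: breaker_span_def)
  qed
qed

lemma minimal_walk_breakers_eq:
  assumes "bridge_chain (parcs G) s t B" "set B = {e. st_bridge s t e}" "s \<in> pverts G"
  shows "minimal_walk_breakers s t =
    {(B ! Suc i, B ! j) | i j. bridge_chain.minimal_free_span (parcs G) B i j}"
proof -
  interpret bridge_chain "parcs G" s t B by fact
  have B: "bridge_sequence s t = B" using bridge_sequence_eq assms by simp
  have "(\<exists>i p. minimal_walk_breaker s t i p \<and> breaker_span s t i p = (a, z)) \<longleftrightarrow>
      (\<exists>i j. minimal_free_span i j \<and> (a, z) = (Suc i, j))" (is "?lhs \<longleftrightarrow> ?rhs") for a z
  proof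
    assume ?lhs
    then obtain i p where ip: "walk_breaker s t i p" "breaker_span s t i p = (a, z)"
      and min: "\<And>i' p'. walk_breaker s t i' p' \<Longrightarrow> substring_span (breaker_span s t i' p') (a, z) \<Longrightarrow>
         breaker_span s t i' p' = (a, z)"
      by (auto simp: minimal_walk_breaker_def)
    obtain i1 j1 where "free_span i1 j1" "substring_span (Suc i1, j1) (a, z)"
      using breaker_span_contains_free_span[OF assms(1) B ip(1)] ip(2) by auto
    moreover obtain i2 j2 where 2: "minimal_free_span i2 j2" "i1 \<le> i2" "j2 \<le> j1"
      using calculation ex_minimal_free_span by blast
    moreover obtain i' p' where "walk_breaker s t i' p'" "breaker_span s t i' p' = (Suc i2, j2)"
      using minimal_free_span_is_breaker_span[OF assms(1) B 2(1)] by auto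
    ultimately have "(a, z) = (Suc i2, j2)"
      using min[of i' p'] by (auto simp: substring_span_def)
    with 2 show ?rhs by blast
  next
    assume ?rhs
    then obtain i j where ij: "minimal_free_span i j" "a = Suc i" "z = j" by auto
    obtain p where p: "walk_breaker s t i p" "breaker_span s t i p = (Suc i, j)"
      using minimal_free_span_is_breaker_span[OF assms(1) B ij(1)] by auto
    have "minimal_walk_breaker s t i p"
      unfolding minimal_walk_breaker_def
    proof (intro conjI allI impI)
      fix i' p' assume *: "walk_breaker s t i' p' \<and>
        substring_span (breaker_span s t i' p') (breaker_span s t i p)"
      then obtain i1 j1 where 1: "free_span i1 j1"
        "substring_span (Suc i1, j1) (breaker_span s t i' p')"
        using breaker_span_contains_free_span[OF assms(1) B] by blast
      with * p have "i \<le> i1" "j1 \<le> j" by (auto simp: substring_span_def)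
      with 1 ij have "i1 = i" "j1 = j" by (auto simp: minimal_free_span_def)
      with 1 * p show "breaker_span s t i' p' = breaker_span s t i p"
        by (auto simp: substring_span_def prod_eq_iff)
    qed (use p in simp)
    with p ij show ?lhs by auto
  qed
  then show ?thesis
    unfolding minimal_walk_breakers_def B by auto
qed

end

lemma chain_segment:
  assumes "i \<le> j"
  shows "(x i, x j) \<in> ((\<lambda>i. (x i, x (Suc i))) ` {i..<j})\<^sup>*"
  using assms
proof (induction j rule: dec_induct)
  case (step j)
  then have "(x i, x j) \<in> ((\<lambda>i. (x i, x (Suc i))) ` {i..<Suc j})\<^sup>*"
    by (elim rtrancl_weaken) auto
  moreover have "(x j, x (Suc j)) \<in> (\<lambda>i. (x i, x (Suc i))) ` {i..<Suc j}"
    using step by auto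
  ultimately show ?case by (rule rtrancl_into_rtrancl)
qed simp

lemma path_bridges:
  fixes x :: "nat \<Rightarrow> 'a"
  defines "E \<equiv> \<lambda>i. (x i, x (Suc i))"
  assumes R: "\<And>i. i < k \<Longrightarrow> E i \<in> R" and inj: "inj_on x {..k}"
    and br: "\<And>i. br i \<longleftrightarrow> (\<forall>j. i < j \<and> j \<le> k \<longrightarrow> \<not> (\<exists>i'\<le>i. (x i', x j) \<in> (R - E ` {..<k})\<^sup>*))"
  shows "bridge_chain R (x 0) (x k) (map E (filter br [0..<k]))"
    and "set (map E (filter br [0..<k])) = {e \<in> R. (x 0, x k) \<notin> (R - {e})\<^sup>*}"
proof -
  have injE: "E i = E j \<Longrightarrow> i = j" if "i < k" "j < k" for i j
    using inj_onD[OF inj, of i j] that by (auto simp: E_def)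
  have seg: "(x i, x j) \<in> A\<^sup>*" if "i \<le> j" "E ` {i..<j} \<subseteq> A" for i j A
    using chain_segment[OF that(1), of x] that(2) unfolding E_def by (rule rtrancl_weaken)
  have avoid: "E ` {i..<j} \<subseteq> R - {E l}" if "j \<le> k" "l < k" "l < i \<or> j \<le> l" for i j l
  proof
    fix e assume "e \<in> E ` {i..<j}"
    then obtain a where "e = E a" "i \<le> a" "a < j" by auto
    then show "e \<in> R - {E l}" using that R[of a] injE[of a l] by auto
  qed
  have not_br: "(x 0, x k) \<in> (R - {E i})\<^sup>*" if i: "i < k" "\<not> br i" for i
  proof -
    obtain i' j where ij: "i < j" "j \<le> k" "i' \<le> i" "(x i', x j) \<in> (R - E ` {..<k})\<^sup>*"
      using i(2) unfolding br by blast
    have "(x 0, x i') \<in> (R - {E i})\<^sup>*"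
      using i ij by (intro seg avoid) auto
    also have "(x i', x j) \<in> (R - {E i})\<^sup>*"
      using ij(4) i(1) by (elim rtrancl_weaken) auto
    also have "(x j, x k) \<in> (R - {E i})\<^sup>*"
      using i ij by (intro seg avoid) auto
    finally show ?thesis .
  qed
  have is_br: "(x 0, x k) \<notin> (R - {E i})\<^sup>*" if i: "i < k" "br i" for i
  proof
    have "\<exists>i'\<le>i. (x i', y) \<in> (R - E ` {..<k})\<^sup>*" if "(x 0, y) \<in> (R - {E i})\<^sup>*" for y
      using that
    proof (induction rule: rtrancl_induct)
      case base
      show ?case by (intro exI[of _ 0]) auto
    next
      case (step y z)
      then obtain i' where i': "i' \<le> i" "(x i', y) \<in> (R - E ` {..<k})\<^sup>*" by auto
      show ?case
      proof (cases "(y, z) \<in> E ` {..<k}")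
        case True
        then obtain j where j: "j < k" "y = x j" "z = x (Suc j)" by (auto simp: E_def)
        have "j \<le> i"
          using i(2)[unfolded br, rule_format, of j] i' j by (cases "j \<le> i") auto
        moreover have "j \<noteq> i" using step(2) j by (auto simp: E_def)
        ultimately show ?thesis using j by (intro exI[of _ "Suc j"]) auto
      next
        case False
        then have "(y, z) \<in> R - E ` {..<k}" using step(2) by auto
        with i'(2) have "(x i', z) \<in> (R - E ` {..<k})\<^sup>*" by (rule rtrancl_into_rtrancl)
        then show ?thesis using i'(1) by blast
      qed
    qed
    moreover assume "(x 0, x k) \<in> (R - {E i})\<^sup>*"
    ultimately show False using i unfolding br by blast
  qed
  define L where "L = filter br [0..<k]"
  have mono: "L ! a < L ! b" if "a < b" "b < length L" for a b
    using sorted_wrt_nth_less[OF sorted_wrt_filter[OF sorted_wrt_upt[of 0 k], of br], of a b] that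
    unfolding L_def by simp
  have L: "L ! a < k" "br (L ! a)" if "a < length L" for a
    using nth_mem[OF that] by (auto simp: L_def)
  have mono_le: "L ! a \<le> L ! b" if "a \<le> b" "b < length L" for a b
    using mono[of a b] that by (cases "a = b") auto
  show "set (map E (filter br [0..<k])) = {e \<in> R. (x 0, x k) \<notin> (R - {e})\<^sup>*}"
  proof (intro equalityI subsetI)
    fix e assume e: "e \<in> {e \<in> R. (x 0, x k) \<notin> (R - {e})\<^sup>*}"
    have "e \<in> E ` {0..<k}"
    proof (rule ccontr)
      assume "e \<notin> E ` {0..<k}"
      then have "E ` {0..<k} \<subseteq> R - {e}" using R by auto
      then have "(x 0, x k) \<in> (R - {e})\<^sup>*" by (intro seg) auto
      then show False using e by simp
    qed
    then obtain i where "i < k" "e = E i" by auto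
    then show "e \<in> set (map E (filter br [0..<k]))" using e not_br[of i] by auto
  qed (use is_br R in auto)
  show "bridge_chain R (x 0) (x k) (map E (filter br [0..<k]))"
    unfolding L_def[symmetric]
  proof
    show "set (map E L) \<subseteq> R" using R by (auto simp: L_def)
    show "distinct (map E L)" using injE by (auto simp: L_def distinct_map inj_on_def)
    show "(x 0, x k) \<notin> (R - {b})\<^sup>*" if "b \<in> set (map E L)" for b
      using that is_br by (auto simp: L_def)
    fix i assume i: "i < length (map E L)"
    then have Li: "L ! i < k" using L by simp
    have "E j \<notin> (!) (map E L) ` {i..<length (map E L)}" if j: "j < L ! i" for j
    proof
      assume "E j \<in> (!) (map E L) ` {i..<length (map E L)}"
      then obtain l where l: "i \<le> l" "l < length L" "E j = E (L ! l)" by auto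
      then have "j = L ! l" "L ! i \<le> L ! l" using injE[of j "L ! l"] j L(1)[of l] mono_le[of i l] Li by auto
      then show False using j by simp
    qed
    then have "E ` {0..<L ! i} \<subseteq> R - (!) (map E L) ` {i..<length (map E L)}"
      using R Li by (intro image_subsetI DiffI) simp_all
    then have "(x 0, x (L ! i)) \<in> (R - (!) (map E L) ` {i..<length (map E L)})\<^sup>*" by (intro seg) auto
    then show "(x 0, fst (map E L ! i)) \<in> (R - (!) (map E L) ` {i..<length (map E L)})\<^sup>*"
      using i by (simp add: E_def)
    have "E j \<notin> (!) (map E L) ` {..i}" if j: "L ! i < j" "j < k" for j
    proof
      assume "E j \<in> (!) (map E L) ` {..i}"
      then obtain l where "l \<le> i" "E j = map E L ! l" by auto
      then have "j = L ! l" "L ! l \<le> L ! i" using injE[of j "L ! l"] j L(1)[of l] mono_le[of l i] i by auto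
      then show False using j by simp
    qed
    then have "E ` {Suc (L ! i)..<k} \<subseteq> R - (!) (map E L) ` {..i}"
      using R by (intro image_subsetI DiffI) simp_all
    then have "(x (Suc (L ! i)), x k) \<in> (R - (!) (map E L) ` {..i})\<^sup>*" using Li by (intro seg) auto
    then show "(snd (map E L ! i), x k) \<in> (R - (!) (map E L) ` {..i})\<^sup>*"
      using i by (simp add: E_def)
  next
    fix i assume i: "Suc i < length (map E L)"
    then have Li: "L ! i < L ! Suc i" "L ! Suc i < k" using mono[of i "Suc i"] L by auto
    have "E j \<notin> set (map E L)" if j: "L ! i < j" "j < L ! Suc i" for j
    proof
      assume "E j \<in> set (map E L)"
      then obtain l where l: "l < length L" "E j = E (L ! l)" by (auto simp: in_set_conv_nth)
      then have "j = L ! l" using injE[of j "L ! l"] L(1)[of l] j Li by auto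
      then have "\<not> l \<le> i" "\<not> Suc i \<le> l"
        using j mono_le[of l i] mono_le[of "Suc i" l] l i by auto
      then show False by simp
    qed
    then have "E ` {Suc (L ! i)..<L ! Suc i} \<subseteq> R - set (map E L)"
      using R Li by (intro image_subsetI DiffI) simp_all
    then have "(x (Suc (L ! i)), x (L ! Suc i)) \<in> (R - set (map E L))\<^sup>*" using Li by (intro seg) auto
    then show "(snd (map E L ! i), fst (map E L ! Suc i)) \<in> (R - set (map E L))\<^sup>*"
      using i by (simp add: E_def)
  qed
qed

context bridge_chain
begin

text \<open>The search from the bridge tails starts at the last bridge, whence the reversal.\<close>
lemma minimal_free_spans_by_labels:
  fixes g :: "nat \<Rightarrow> nat"
  defines "q \<equiv> length B"
  assumes g: "\<And>j c. j < q \<Longrightarrow> 0 < g j \<and> g j \<le> c \<longleftrightarrow>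
      (\<exists>r<c. r < q - 1 \<and> (snd (rev B ! j), fst (rev B ! r)) \<in> (R - set B)\<^sup>+)"
    and least: "\<And>j. least j \<longleftrightarrow> 0 < g j \<and> g j < q \<and> (\<forall>j'. j < j' \<and> j' < q \<longrightarrow> g j' = 0 \<or> g j < g j')"
  shows "{(B ! Suc i, B ! j) | i j. minimal_free_span i j} =
    (\<lambda>j. (rev B ! (g j - 1), rev B ! j)) ` {j. 1 \<le> j \<and> j < q \<and> least j}"
proof -
  define D where "D j r \<longleftrightarrow> j < q \<and> r < q - 1 \<and> (snd (rev B ! j), fst (rev B ! r)) \<in> (R - set B)\<^sup>+" for j r
  have free: "free_span i j \<longleftrightarrow> D (q - 1 - j) (q - 2 - i)" if "i < q - 1" "j < q - 1" for i j
  proof -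
    have "rev B ! (q - 1 - j) = B ! j" "rev B ! (q - 2 - i) = B ! Suc i"
      using that by (auto simp: q_def rev_nth intro!: arg_cong[where f = "(!) B"])
    moreover have "i \<le> j" if "(snd (B ! j), fst (B ! Suc i)) \<in> (R - set B)\<^sup>+"
      using free_walk_backwards[of j i] that \<open>i < q - 1\<close> \<open>j < q - 1\<close> by (auto simp: q_def trancl_into_rtrancl)
    ultimately show ?thesis
      using that by (auto simp: free_span_def D_def q_def)
  qed
  have range: "i < q - 1" "j < q - 1" if "free_span i j" for i j
    using that by (auto simp: free_span_def q_def)
  have g': "0 < g j \<and> g j \<le> c \<longleftrightarrow> (\<exists>r<c. D j r)" if "j < q" for j c
    using g[OF that, of c] that by (auto simp: D_def)
  have gD: "D j (g j - 1)" if j: "j < q" "0 < g j" for j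
  proof -
    obtain r where r: "r < g j" "D j r" using g'[OF j(1), of "g j"] j(2) by auto
    then have "g j \<le> Suc r" using g'[OF j(1), of "Suc r"] by auto
    with r have "r = g j - 1" by simp
    with r show ?thesis by simp
  qed
  have D_range: "r < q - 1" "j < q" if "D j r" for j r using that by (auto simp: D_def)
  have "minimal_free_span i j \<longleftrightarrow> j < q - 1 \<and> least (q - 1 - j) \<and> i = q - 1 - g (q - 1 - j)"
    (is "?lhs \<longleftrightarrow> ?rhs") for i j
  proof
    assume min: ?lhs
    then have fs: "free_span i j"
      and minD: "\<And>i' j'. free_span i' j' \<Longrightarrow> i \<le> i' \<Longrightarrow> j' \<le> j \<Longrightarrow> i' = i \<and> j' = j"
      unfolding minimal_free_span_def by blast+
    note rg = range[OF fs]
    define J where "J = q - 1 - j"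
    define r where "r = q - 2 - i"
    have Jr: "J < q" "0 < J" "r < q - 1" "q - 2 - r = i" "q - 1 - J = j" using rg by (auto simp: J_def r_def)
    have DJ: "D J r" using fs free[OF rg] by (simp add: J_def r_def)
    then have gJ: "0 < g J" "g J \<le> Suc r" using g'[OF Jr(1), of "Suc r"] by auto
    have gq: "g J \<le> q - 1" using gJ(2) Jr(3) by simp
    have spanned: "free_span (q - 1 - g j') (q - 1 - j')"
      if j': "J \<le> j'" "j' < q" "0 < g j'" "g j' \<le> g J" for j'
    proof -
      have "D j' (g j' - 1)" using gD j' by simp
      moreover have "q - 1 - (q - 1 - j') = j'" using j'(2) by arith
      moreover have "q - 2 - (q - 1 - g j') = g j' - 1" using j'(3,4) gq by arith
      moreover have "q - 1 - g j' < q - 1" "q - 1 - j' < q - 1" using j'(1,3) Jr(2,3) by simp_all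
      ultimately show ?thesis using free[of "q - 1 - g j'" "q - 1 - j'"] by simp
    qed
    have above: "i \<le> q - 1 - g j'" if "0 < g j'" "g j' \<le> g J" for j'
    proof -
      have "q - 1 - Suc r = i" using Jr(4) by simp
      then show ?thesis using that(2) gJ(2) diff_le_mono2[of "g j'" "Suc r" "q - 1"] by simp
    qed
    have i: "i = q - 1 - g J"
      using minD[of "q - 1 - g J" j] spanned[of J] above[of J] gJ Jr by simp
    have "least J"
      unfolding least
    proof (intro conjI allI impI)
      show "0 < g J" "g J < q" using gJ Jr by auto
      fix j' assume j': "J < j' \<and> j' < q"
      show "g j' = 0 \<or> g J < g j'"
      proof (rule ccontr)
        assume "\<not> ?thesis"
        then have "free_span (q - 1 - g j') (q - 1 - j')" "i \<le> q - 1 - g j'"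
          using spanned[of j'] above[of j'] j' by auto
        moreover have "q - 1 - j' < j" using j' Jr(5) by arith
        ultimately show False using minD[of "q - 1 - g j'" "q - 1 - j'"] by simp
      qed
    qed
    with i rg show ?rhs by (simp add: J_def)
  next
    assume rhs: ?rhs
    define J where "J = q - 1 - j"
    have J: "j < q - 1" "J < q" "0 < J" "q - 1 - J = j" "0 < g J" "g J < q" "i = q - 1 - g J"
      and J': "\<And>j'. J < j' \<Longrightarrow> j' < q \<Longrightarrow> g j' = 0 \<or> g J < g j'"
      using rhs unfolding least J_def by auto
    have r: "q - 2 - i = g J - 1" "i < q - 1" using J(5-7) by arith+
    have "free_span i j" using free[of i j] gD[of J] J r by (simp add: J_def)
    moreover have "i' = i \<and> j' = j" if f: "free_span i' j'" "i \<le> i'" "j' \<le> j" for i' j'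
    proof -
      note rg = range[OF f(1)]
      define K where "K = q - 1 - j'"
      define r' where "r' = q - 2 - i'"
      have K: "K < q" "J \<le> K" "Suc r' \<le> g J" "j' = q - 1 - K" "i' = q - 2 - r'"
      proof -
        have "r' \<le> q - 2 - i" using f(2) unfolding r'_def by (rule diff_le_mono2)
        then show "Suc r' \<le> g J" using r(1) J(5) by simp
        show "J \<le> K" using f(3) unfolding K_def J_def by (rule diff_le_mono2)
        show "K < q" using J(1) unfolding K_def by arith
        show "j' = q - 1 - K" using rg(2) unfolding K_def by arith
        show "i' = q - 2 - r'" using rg(1) unfolding r'_def by arith
      qed
      have "D K r'" using f(1) free[OF rg] by (simp add: K_def r'_def)
      then have g2: "0 < g K" "g K \<le> Suc r'"
        using g'[OF K(1), of "Suc r'"] by auto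
      have "\<not> J < K"
      proof
        assume "J < K"
        then have "g J < g K" using J'[of K] g2(1) K(1) by auto
        then show False using g2(2) K(3) by simp
      qed
      then have "K = J" using K(2) by linarith
      with g2(2) K(3) have "g J = Suc r'" by simp
      then show ?thesis using \<open>K = J\<close> K(4,5) J(4,7) by simp
    qed
    ultimately show ?lhs unfolding minimal_free_span_def by blast
  qed
  note min_iff = this
  show ?thesis
  proof (intro equalityI subsetI)
    fix z assume "z \<in> {(B ! Suc i, B ! j) | i j. minimal_free_span i j}"
    then obtain i j where z: "z = (B ! Suc i, B ! j)" and ij: "minimal_free_span i j" by blast
    let ?J = "q - 1 - j"
    have J: "j < q - 1" "least ?J" "i = q - 1 - g ?J" using ij min_iff by auto
    then have "0 < g ?J" "g ?J < q" unfolding least by auto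
    then have "rev B ! (g ?J - 1) = B ! Suc i" "rev B ! ?J = B ! j"
      using J by (auto simp: q_def rev_nth intro!: arg_cong[where f = "(!) B"])
    then show "z \<in> (\<lambda>j. (rev B ! (g j - 1), rev B ! j)) ` {j. 1 \<le> j \<and> j < q \<and> least j}"
      using z J by (intro image_eqI[of _ _ ?J]) auto
  next
    fix z assume "z \<in> (\<lambda>j. (rev B ! (g j - 1), rev B ! j)) ` {j. 1 \<le> j \<and> j < q \<and> least j}"
    then obtain J where J: "z = (rev B ! (g J - 1), rev B ! J)" "1 \<le> J" "J < q" "least J" by blast
    let ?j = "q - 1 - J" and ?i = "q - 1 - g J"
    have gJ: "0 < g J" "g J < q" using J(4) unfolding least by auto
    have "q - 1 - ?j = J" using J by linarith
    then have "minimal_free_span ?i ?j" using min_iff[of ?i ?j] J by simp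
    moreover have "rev B ! (g J - 1) = B ! Suc ?i" "rev B ! J = B ! ?j"
      using J gJ by (auto simp: q_def rev_nth intro!: arg_cong[where f = "(!) B"])
    ultimately show "z \<in> {(B ! Suc i, B ! j) | i j. minimal_free_span i j}" using J(1) by auto
  qed
qed

end

section \<open>Program verification\<close>

primrec straight :: "com \<Rightarrow> bool" where
  "straight Skip \<longleftrightarrow> True"
| "straight (Assign x e) \<longleftrightarrow> True"
| "straight (Write a e f) \<longleftrightarrow> True"
| "straight (Seq c d) \<longleftrightarrow> straight c \<and> straight d"
| "straight (If e c d) \<longleftrightarrow> straight c \<and> straight d"
| "straight (While e c) \<longleftrightarrow> False"

primrec run :: "com \<Rightarrow> state \<Rightarrow> state" where
  "run Skip \<sigma> = \<sigma>"
| "run (Assign x e) \<sigma> = \<sigma>\<lparr>vars := (vars \<sigma>)(x := eval e \<sigma>)\<rparr>"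
| "run (Write a e f) \<sigma> = \<sigma>\<lparr>arrays := (arrays \<sigma>)(a := (arrays \<sigma> a)(eval e \<sigma> := eval f \<sigma>))\<rparr>"
| "run (Seq c d) \<sigma> = run d (run c \<sigma>)"
| "run (If e c d) \<sigma> = (if eval e \<sigma> \<noteq> 0 then run c \<sigma> else run d \<sigma>)"
| "run (While e c) \<sigma> = \<sigma>"

primrec run_time :: "com \<Rightarrow> nat" where
  "run_time Skip = 1"
| "run_time (Assign x e) = 1 + cost e"
| "run_time (Write a e f) = 1 + cost e + cost f"
| "run_time (Seq c d) = run_time c + run_time d"
| "run_time (If e c d) = 1 + cost e + run_time c + run_time d"
| "run_time (While e c) = 0"

primrec written_vars :: "com \<Rightarrow> nat set" where
  "written_vars Skip = {}"
| "written_vars (Assign x e) = {x}"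
| "written_vars (Write a e f) = {}"
| "written_vars (Seq c d) = written_vars c \<union> written_vars d"
| "written_vars (If e c d) = written_vars c \<union> written_vars d"
| "written_vars (While e c) = written_vars c"

primrec written_arrays :: "com \<Rightarrow> nat set" where
  "written_arrays Skip = {}"
| "written_arrays (Assign x e) = {}"
| "written_arrays (Write a e f) = {a}"
| "written_arrays (Seq c d) = written_arrays c \<union> written_arrays d"
| "written_arrays (If e c d) = written_arrays c \<union> written_arrays d"
| "written_arrays (While e c) = written_arrays c"

definition framed :: "com \<Rightarrow> state \<Rightarrow> state \<Rightarrow> bool" where
  "framed c \<sigma> \<tau> \<longleftrightarrow> (\<forall>x. x \<notin> written_vars c \<longrightarrow> vars \<tau> x = vars \<sigma> x) \<and>
     (\<forall>a. a \<notin> written_arrays c \<longrightarrow> arrays \<tau> a = arrays \<sigma> a)"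

lemma framed_vars: "framed c \<sigma> \<tau> \<Longrightarrow> x \<notin> written_vars c \<Longrightarrow> vars \<tau> x = vars \<sigma> x"
  and framed_arrays: "framed c \<sigma> \<tau> \<Longrightarrow> a \<notin> written_arrays c \<Longrightarrow> arrays \<tau> a = arrays \<sigma> a"
  by (simp_all add: framed_def)

lemma framed_run: "framed c \<sigma> (run c \<sigma>)"
  by (induction c arbitrary: \<sigma>) (auto simp: framed_def)

lemma framed_exec: "exec W c \<sigma> T \<tau> \<Longrightarrow> framed c \<sigma> \<tau>"
  by (induction rule: exec.induct) (auto simp: framed_def)

lemma framed_trans: "framed c \<sigma> \<sigma>' \<Longrightarrow> framed c \<sigma>' \<sigma>'' \<Longrightarrow> framed c \<sigma> \<sigma>''"
  by (auto simp: framed_def)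

lemma fits_mono: "fits W e \<sigma> \<Longrightarrow> W \<le> W' \<Longrightarrow> fits W' e \<sigma>"
  by (induction e) auto

lemma exec_mono: "exec W c \<sigma> T \<tau> \<Longrightarrow> W \<le> W' \<Longrightarrow> exec W' c \<sigma> T \<tau>"
  by (induction rule: exec.induct) (blast intro: exec.intros fits_mono)+

lemma ex_fits: "\<exists>W. fits W e \<sigma>"
proof (induction e)
  case (Read a e)
  then obtain W where "fits W e \<sigma>" by blast
  then have "fits (max W (arrays \<sigma> a (eval e \<sigma>))) (Read a e) \<sigma>" by (auto intro: fits_mono)
  then show ?case ..
next
  case (Add e f)
  then obtain W W' where "fits W e \<sigma>" "fits W' f \<sigma>" by blast
  then have "fits (W + W' + eval e \<sigma> + eval f \<sigma>) (Add e f) \<sigma>" by (auto intro: fits_mono)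
  then show ?case ..
next
  case (Sub e f)
  then obtain W W' where "fits W e \<sigma>" "fits W' f \<sigma>" by blast
  then have "fits (W + W') (Sub e f) \<sigma>" by (auto intro: fits_mono)
  then show ?case ..
next
  case (Less e f)
  then obtain W W' where "fits W e \<sigma>" "fits W' f \<sigma>" by blast
  then have "fits (W + W') (Less e f) \<sigma>" by (auto intro: fits_mono)
  then show ?case ..
next
  case (Eq e f)
  then obtain W W' where "fits W e \<sigma>" "fits W' f \<sigma>" by blast
  then have "fits (W + W') (Eq e f) \<sigma>" by (auto intro: fits_mono)
  then show ?case ..
qed auto

text \<open>
  The word size is left open here: programs that only ever increment numbers cannot produce
  large ones in few steps, so it is settled by the running time in the end.
\<close>
definition wp :: "nat \<Rightarrow> com \<Rightarrow> (state \<Rightarrow> bool) \<Rightarrow> state \<Rightarrow> bool" where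
  "wp T c Q \<sigma> \<longleftrightarrow> (\<exists>W T' \<tau>. exec W c \<sigma> T' \<tau> \<and> T' \<le> T \<and> Q \<tau>)"

lemma wp_run: "straight c \<Longrightarrow> Q (run c \<sigma>) \<Longrightarrow> wp (run_time c) c Q \<sigma>"
proof -
  have "straight c \<Longrightarrow> \<exists>W T. exec W c \<sigma> T (run c \<sigma>) \<and> T \<le> run_time c"
  proof (induction c arbitrary: \<sigma>)
    case Skip
    then show ?case using exec.Skip by fastforce
  next
    case (Assign x e)
    obtain W where "fits W e \<sigma>" using ex_fits by blast
    from exec.Assign[OF this] show ?case by fastforce
  next
    case (Write a e f)
    obtain W W' where "fits W e \<sigma>" "fits W' f \<sigma>" using ex_fits by blast
    then have "fits (W + W') e \<sigma>" "fits (W + W') f \<sigma>" by (auto intro: fits_mono)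
    from exec.Write[OF this] show ?case by fastforce
  next
    case (Seq c d)
    obtain W T where 1: "exec W c \<sigma> T (run c \<sigma>)" "T \<le> run_time c" using Seq by fastforce
    obtain W' T' where 2: "exec W' d (run c \<sigma>) T' (run d (run c \<sigma>))" "T' \<le> run_time d"
      using Seq by fastforce
    have "exec (W + W') (Seq c d) \<sigma> (T + T') (run d (run c \<sigma>))"
      by (rule exec.Seq[OF exec_mono[OF 1(1)] exec_mono[OF 2(1)]]) auto
    with 1 2 show ?case by (metis add_mono run.simps(4) run_time.simps(4))
  next
    case (If e c d)
    obtain W0 where 0: "fits W0 e \<sigma>" using ex_fits by blast
    show ?case
    proof (cases "eval e \<sigma> = 0")
      case True
      obtain W T where 1: "exec W d \<sigma> T (run d \<sigma>)" "T \<le> run_time d" using If by fastforce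
      have "exec (W0 + W) (If e c d) \<sigma> (1 + cost e + T) (run d \<sigma>)"
        using exec_mono[OF 1(1)] fits_mono[OF 0] True by (intro exec.IfFalse) auto
      moreover have "1 + cost e + T \<le> run_time (If e c d)" using 1 by simp
      ultimately show ?thesis using True by (metis run.simps(5))
    next
      case False
      obtain W T where 1: "exec W c \<sigma> T (run c \<sigma>)" "T \<le> run_time c" using If by fastforce
      have "exec (W0 + W) (If e c d) \<sigma> (1 + cost e + T) (run c \<sigma>)"
        using exec_mono[OF 1(1)] fits_mono[OF 0] False by (intro exec.IfTrue) auto
      moreover have "1 + cost e + T \<le> run_time (If e c d)" using 1 by simp
      ultimately show ?thesis using False by (metis run.simps(5))
    qed
  qed simp
  then show "straight c \<Longrightarrow> Q (run c \<sigma>) \<Longrightarrow> wp (run_time c) c Q \<sigma>"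
    by (auto simp: wp_def)
qed

lemma wp_mono:
  assumes "wp T c P \<sigma>" "T \<le> T'" "\<And>\<tau>. P \<tau> \<Longrightarrow> framed c \<sigma> \<tau> \<Longrightarrow> Q \<tau>"
  shows "wp T' c Q \<sigma>"
  using assms framed_exec unfolding wp_def by (meson order_trans)

lemma wp_Seq:
  assumes "wp T c P \<sigma>" "\<And>\<tau>. P \<tau> \<Longrightarrow> framed c \<sigma> \<tau> \<Longrightarrow> wp T' d Q \<tau>"
  shows "wp (T + T') (Seq c d) Q \<sigma>"
proof -
  obtain W S \<tau> where 1: "exec W c \<sigma> S \<tau>" "S \<le> T" "P \<tau>" using assms(1) by (auto simp: wp_def)
  then obtain W' S' \<rho> where 2: "exec W' d \<tau> S' \<rho>" "S' \<le> T'" "Q \<rho>"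
    using assms(2)[OF _ framed_exec[OF 1(1)]] by (auto simp: wp_def)
  have "exec (W + W') (Seq c d) \<sigma> (S + S') \<rho>"
    by (rule exec.Seq[OF exec_mono[OF 1(1)] exec_mono[OF 2(1)]]) auto
  with 1 2 show ?thesis unfolding wp_def by (meson add_mono)
qed

lemma wp_Seq_run:
  assumes "straight c" "run_time c \<le> K" "wp T d Q (run c \<sigma>)"
  shows "wp (K + T) (Seq c d) Q \<sigma>"
proof -
  have "wp K c (\<lambda>\<tau>. \<tau> = run c \<sigma>) \<sigma>"
    by (rule wp_mono[OF wp_run[of c "\<lambda>\<tau>. \<tau> = run c \<sigma>"]]) (use assms in auto)
  then show ?thesis using assms(3) by (auto intro: wp_Seq)
qed

lemma wp_While:
  assumes c: "straight c" and "I \<sigma>\<^sub>0" "\<mu> \<sigma>\<^sub>0 \<le> M"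
    and step: "\<And>\<sigma>. I \<sigma> \<Longrightarrow> framed c \<sigma>\<^sub>0 \<sigma> \<Longrightarrow> eval b \<sigma> \<noteq> 0 \<Longrightarrow> I (run c \<sigma>) \<and> \<mu> (run c \<sigma>) < \<mu> \<sigma>"
    and exit: "\<And>\<sigma>. I \<sigma> \<Longrightarrow> framed c \<sigma>\<^sub>0 \<sigma> \<Longrightarrow> eval b \<sigma> = 0 \<Longrightarrow> Q \<sigma>"
    and time: "1 + cost b + run_time c \<le> K"
  shows "wp (K * Suc M) (While b c) Q \<sigma>\<^sub>0"
proof -
  let ?K = "1 + cost b + run_time c"
  have "wp (?K * Suc M) (While b c) Q \<sigma>" if "I \<sigma>" "framed c \<sigma>\<^sub>0 \<sigma>" "\<mu> \<sigma> \<le> M" for \<sigma> M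
    using that
  proof (induction M arbitrary: \<sigma> rule: less_induct)
    case (less M)
    obtain W0 where fits: "fits W0 b \<sigma>" using ex_fits by blast
    show ?case
    proof (cases "eval b \<sigma> = 0")
      case True
      then have "exec W0 (While b c) \<sigma> (1 + cost b) \<sigma>" using fits by (intro exec.WhileFalse)
      moreover have "1 + cost b \<le> ?K * Suc M" by simp
      ultimately show ?thesis using exit[OF less.prems(1,2) True] unfolding wp_def by blast
    next
      case False
      let ?\<sigma> = "run c \<sigma>"
      have 1: "I ?\<sigma>" "\<mu> ?\<sigma> < \<mu> \<sigma>" using step[OF less.prems(1,2) False] by auto
      have "framed c \<sigma>\<^sub>0 ?\<sigma>" using less.prems framed_run framed_trans by blast
      moreover have "M - 1 < M" "\<mu> ?\<sigma> \<le> M - 1" using 1 less.prems by auto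
      ultimately have "wp (?K * Suc (M - 1)) (While b c) Q ?\<sigma>" using less.IH 1 by blast
      then obtain W T \<tau> where 2: "exec W (While b c) ?\<sigma> T \<tau>" "T \<le> ?K * M" "Q \<tau>"
        using \<open>M - 1 < M\<close> by (auto simp: wp_def)
      obtain W' T' where 3: "exec W' c \<sigma> T' ?\<sigma>" "T' \<le> run_time c"
        using wp_run[OF c, of "\<lambda>\<tau>. \<tau> = ?\<sigma>" \<sigma>] by (auto simp: wp_def)
      have "exec (W0 + W + W') (While b c) \<sigma> (1 + cost b + T' + T) \<tau>"
        by (rule exec.WhileTrue[OF fits_mono[OF fits] False exec_mono[OF 3(1)] exec_mono[OF 2(1)]]) auto
      moreover have "1 + cost b + T' + T \<le> ?K * Suc M" using 2 3 by simp
      ultimately show ?thesis using 2 unfolding wp_def by blast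
    qed
  qed
  then have "wp (?K * Suc M) (While b c) Q \<sigma>\<^sub>0" using assms(2,3) by (simp add: framed_def)
  moreover have "?K * Suc M \<le> K * Suc M" using time by (rule mult_le_mono1)
  ultimately show ?thesis by (rule wp_mono)
qed

primrec increments_exp :: "exp \<Rightarrow> bool" where
  "increments_exp (Const k) \<longleftrightarrow> k \<le> 1"
| "increments_exp (Var x) \<longleftrightarrow> True"
| "increments_exp (Read a e) \<longleftrightarrow> increments_exp e"
| "increments_exp (Add e f) \<longleftrightarrow> increments_exp e \<and> f = Const 1"
| "increments_exp (Sub e f) \<longleftrightarrow> increments_exp e \<and> increments_exp f"
| "increments_exp (Less e f) \<longleftrightarrow> increments_exp e \<and> increments_exp f"
| "increments_exp (Eq e f) \<longleftrightarrow> increments_exp e \<and> increments_exp f"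

primrec increments :: "com \<Rightarrow> bool" where
  "increments Skip \<longleftrightarrow> True"
| "increments (Assign x e) \<longleftrightarrow> increments_exp e"
| "increments (Write a e f) \<longleftrightarrow> increments_exp e \<and> increments_exp f"
| "increments (Seq c d) \<longleftrightarrow> increments c \<and> increments d"
| "increments (If e c d) \<longleftrightarrow> increments_exp e \<and> increments c \<and> increments d"
| "increments (While e c) \<longleftrightarrow> increments_exp e \<and> increments c"

definition bounded :: "nat \<Rightarrow> state \<Rightarrow> bool" where
  "bounded N \<sigma> \<longleftrightarrow> (\<forall>x. vars \<sigma> x \<le> N) \<and> (\<forall>a i. arrays \<sigma> a i \<le> N)"

lemma increments_eval:
  assumes "increments_exp e" "bounded N \<sigma>"
  shows "eval e \<sigma> \<le> N + cost e \<and> fits (N + cost e) e \<sigma>"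
  using assms
proof (induction e)
  case (Read a e)
  moreover from this have "arrays \<sigma> a (eval e \<sigma>) \<le> N" by (simp add: bounded_def)
  ultimately show ?case by (auto intro: fits_mono)
next
  case (Add e f)
  then show ?case by (auto intro: fits_mono)
next
  case (Sub e f)
  then show ?case by (auto intro: fits_mono)
next
  case (Less e f)
  then show ?case by (auto intro: fits_mono)
next
  case (Eq e f)
  then show ?case by (auto intro: fits_mono)
qed (auto simp: bounded_def intro: le_SucI)

lemma bounded_mono: "bounded N \<sigma> \<Longrightarrow> N \<le> N' \<Longrightarrow> bounded N' \<sigma>"
  by (auto simp: bounded_def intro: order_trans)

lemma exec_increments:
  assumes "exec W c \<sigma> T \<tau>" "increments c" "bounded N \<sigma>"
  shows "exec (N + T) c \<sigma> T \<tau> \<and> bounded (N + T) \<tau>"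
  using assms
proof (induction arbitrary: N rule: exec.induct)
  case (Skip \<sigma>)
  then show ?case by (blast intro: exec.Skip bounded_mono le_add1)
next
  case (Assign e \<sigma> x)
  then have e: "eval e \<sigma> \<le> N + cost e" "fits (N + cost e) e \<sigma>" using increments_eval by auto
  then have "fits (N + (1 + cost e)) e \<sigma>" by (auto intro: fits_mono)
  then show ?case
    using e bounded_mono[OF Assign.prems(2), of "N + (1 + cost e)"]
    by (intro conjI exec.Assign) (auto simp: bounded_def)
next
  case (Write e \<sigma> f a)
  then have e: "eval e \<sigma> \<le> N + cost e" "fits (N + cost e) e \<sigma>"
      "eval f \<sigma> \<le> N + cost f" "fits (N + cost f) f \<sigma>"
    using increments_eval by auto
  then have "fits (N + (1 + cost e + cost f)) e \<sigma>" "fits (N + (1 + cost e + cost f)) f \<sigma>"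
    by (auto intro: fits_mono)
  then show ?case
    using e bounded_mono[OF Write.prems(2), of "N + (1 + cost e + cost f)"]
    by (intro conjI exec.Write) (auto simp: bounded_def)
next
  case (Seq c \<sigma> T \<sigma>' d T' \<sigma>'')
  then have "exec (N + T) c \<sigma> T \<sigma>'" "bounded (N + T) \<sigma>'" by auto
  moreover from this Seq have "exec (N + T + T') d \<sigma>' T' \<sigma>''" "bounded (N + T + T') \<sigma>''" by auto
  ultimately show ?case
    using exec.Seq[OF exec_mono[of "N + T" c \<sigma> T \<sigma>' "N + T + T'"]] by (simp add: add.assoc)
next
  case (IfTrue e \<sigma> c T \<sigma>' d)
  then have 1: "exec (N + T) c \<sigma> T \<sigma>'" "bounded (N + T) \<sigma>'" "fits (N + cost e) e \<sigma>"
    using increments_eval by auto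
  show ?case
    using exec.IfTrue[OF fits_mono[OF 1(3)] IfTrue.hyps(2) exec_mono[OF 1(1)]] bounded_mono[OF 1(2)]
    by simp
next
  case (IfFalse e \<sigma> d T \<sigma>' c)
  then have 1: "exec (N + T) d \<sigma> T \<sigma>'" "bounded (N + T) \<sigma>'" "fits (N + cost e) e \<sigma>"
    using increments_eval by auto
  show ?case
    using exec.IfFalse[OF fits_mono[OF 1(3)] IfFalse.hyps(2) exec_mono[OF 1(1)]] bounded_mono[OF 1(2)]
    by simp
next
  case (WhileFalse e \<sigma> c)
  then have "fits (N + cost e) e \<sigma>"
    using increments_eval by auto
  then show ?case
    using WhileFalse by (intro conjI exec.WhileFalse) (auto intro: fits_mono bounded_mono)
next
  case (WhileTrue e \<sigma> c T \<sigma>' T' \<sigma>'')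
  then have 1: "exec (N + T) c \<sigma> T \<sigma>'" "bounded (N + T) \<sigma>'" "fits (N + cost e) e \<sigma>"
    using increments_eval by auto
  then have 2: "exec (N + T + T') (While e c) \<sigma>' T' \<sigma>''" "bounded (N + T + T') \<sigma>''"
    using WhileTrue by auto
  let ?W = "N + (1 + cost e + T + T')"
  have "exec ?W (While e c) \<sigma> (1 + cost e + T + T') \<sigma>''"
    by (rule exec.WhileTrue[OF fits_mono[OF 1(3)] WhileTrue.hyps(2) exec_mono[OF 1(1)] exec_mono[OF 2(1)]])
      auto
  moreover have "bounded ?W \<sigma>''" using 2 by (auto intro: bounded_mono)
  ultimately show ?case by simp
qed

section \<open>Graph search with several sources\<close>

text \<open>
  Edge lists of nodes are linked in decreasing order, so that the part of the list of \<open>v\<close> that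
  lies ahead of a pointer \<open>b\<close> consists of all \<open>e < b\<close> with tail \<open>v\<close>. Pointers are shifted by one,
  with 0 for the end of the list.
\<close>
primrec last_edge :: "(nat \<Rightarrow> nat) \<Rightarrow> nat \<Rightarrow> nat \<Rightarrow> nat" where
  "last_edge tails v 0 = 0"
| "last_edge tails v (Suc b) = (if tails b = v then Suc b else last_edge tails v b)"

lemma last_edge_le: "last_edge tails v b \<le> b"
  by (induction b) auto

lemma last_edge_tail: "last_edge tails v b = Suc e \<Longrightarrow> tails e = v"
  by (induction b) (auto split: if_splits)

lemma last_edge_skip: "last_edge tails v b \<le> e \<Longrightarrow> e < b \<Longrightarrow> tails e \<noteq> v"
  by (induction b) (auto simp: less_Suc_eq split: if_splits)

definition link_edges :: "nat \<Rightarrow> nat \<Rightarrow> com" where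
  "link_edges T b = While (Less (Var b) (Var 1))
     (Seq (Write (b + 1) (Var b) (Read b (Read T (Var b))))
     (Seq (Write b (Read T (Var b)) (Add (Var b) (Const 1)))
          (Assign b (Add (Var b) (Const 1)))))"

lemma link_edges_correct:
  assumes "vars \<sigma> b = 0" "arrays \<sigma> b = (\<lambda>_. 0)" "vars \<sigma> 1 = m" "T \<noteq> b" "T \<noteq> b + 1" "b > 3"
  shows "wp (40 * Suc m) (link_edges T b)
    (\<lambda>\<tau>. (\<forall>v. arrays \<tau> b v = last_edge (arrays \<sigma> T) v m) \<and>
         (\<forall>e<m. arrays \<tau> (b + 1) e = last_edge (arrays \<sigma> T) (arrays \<sigma> T e) e)) \<sigma>"
  unfolding link_edges_def
proof (rule wp_While[where I = "\<lambda>\<tau>. vars \<tau> b \<le> m \<and>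
      (\<forall>v. arrays \<tau> b v = last_edge (arrays \<sigma> T) v (vars \<tau> b)) \<and>
      (\<forall>e<vars \<tau> b. arrays \<tau> (b + 1) e = last_edge (arrays \<sigma> T) (arrays \<sigma> T e) e)"
      and \<mu> = "\<lambda>\<tau>. m - vars \<tau> b" and M = m], goal_cases)
  case (4 \<tau>)
  have "arrays \<tau> T = arrays \<sigma> T" "vars \<tau> 1 = m"
    using framed_arrays[OF 4(2), of T] framed_vars[OF 4(2), of 1] assms by auto
  with 4 assms show ?case by (auto simp: less_Suc_eq split: if_splits)
next
  case (5 \<tau>)
  have "vars \<tau> 1 = m"
    using framed_vars[OF 5(2), of 1] assms by auto
  with 5 have "vars \<tau> b = m" by (auto split: if_splits)
  with 5 show ?case by simp
qed (use assms in auto)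

definition edges :: "nat \<Rightarrow> (nat \<Rightarrow> nat) \<Rightarrow> (nat \<Rightarrow> nat) \<Rightarrow> (nat \<Rightarrow> bool) \<Rightarrow> (nat \<times> nat) set" where
  "edges m tails heads ok = {(tails e, heads e) | e. e < m \<and> ok e}"

lemma push_inj:
  fixes q :: "nat \<Rightarrow> nat"
  assumes "inj_on q {..<i}" "v \<notin> q ` {..<i}"
  shows "inj_on (q(i := v)) {..<Suc i}"
  using assms inj_on_fun_updI[OF assms, of i] by (simp add: lessThan_Suc)

lemma push_ex: "i \<le> qt \<Longrightarrow> (\<exists>j<i. (q(qt := v)) j = y) \<longleftrightarrow> (\<exists>j<i. q j = y)"
  for q :: "nat \<Rightarrow> nat" and i qt :: nat
  by (metis fun_upd_other leD)

definition labels_found :: "nat \<Rightarrow> nat \<Rightarrow> (nat \<Rightarrow> nat) \<Rightarrow> (nat \<Rightarrow> nat) \<Rightarrow> (nat \<Rightarrow> nat) \<Rightarrow>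
    (nat \<Rightarrow> bool) \<Rightarrow> (nat \<Rightarrow> nat) \<Rightarrow> bool" where
  "labels_found m k tails heads src ok lab \<longleftrightarrow> (\<forall>v. lab v \<le> k) \<and>
     (\<forall>r\<le>k. \<forall>v. 0 < lab v \<and> lab v \<le> r \<longleftrightarrow> (\<exists>r'<r. (src r', v) \<in> (edges m tails heads ok)\<^sup>*))"

text \<open>The ranking \<open>pos\<close> makes sure that following parent edges leads back to a source.\<close>
definition parents_found :: "nat \<Rightarrow> nat \<Rightarrow> nat \<Rightarrow> (nat \<Rightarrow> nat) \<Rightarrow> (nat \<Rightarrow> nat) \<Rightarrow> (nat \<Rightarrow> nat) \<Rightarrow>
    (nat \<Rightarrow> nat) \<Rightarrow> (nat \<Rightarrow> nat) \<Rightarrow> bool" where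
  "parents_found n m k tails heads src lab par \<longleftrightarrow>
     (\<exists>pos :: nat \<Rightarrow> nat. \<forall>v. lab v \<noteq> 0 \<longrightarrow> pos v < n \<and> ((\<exists>r<k. v = src r) \<or>
        par v < m \<and> heads (par v) = v \<and> lab (tails (par v)) \<noteq> 0 \<and> pos (tails (par v)) < pos v))"

locale search =
  fixes n m k :: nat and tails heads src :: "nat \<Rightarrow> nat" and ok :: "nat \<Rightarrow> bool"
  assumes tails_less: "e < m \<Longrightarrow> tails e < n" and heads_less: "e < m \<Longrightarrow> heads e < n"
    and src_less: "r < k \<Longrightarrow> src r < n"
begin

text \<open>
  Here \<open>q\<close> is the queue of all nodes found so far, the first \<open>qh\<close> of which have been taken out, and
  \<open>cur\<close> points to the next edge of the node taken out last. The label \<open>Suc r\<close> says that a node was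
  found from the \<open>r\<close>th source, label 0 that it was not found.
\<close>
definition inv :: "(nat \<Rightarrow> nat) \<Rightarrow> (nat \<Rightarrow> nat) \<Rightarrow> (nat \<Rightarrow> nat) \<Rightarrow> nat \<Rightarrow> nat \<Rightarrow> nat \<Rightarrow> nat \<Rightarrow> bool" where
  "inv lab par q qh qt cur si \<longleftrightarrow>
     inj_on q {..<qt} \<and> (\<forall>v. lab v \<noteq> 0 \<longleftrightarrow> v \<in> q ` {..<qt}) \<and> q ` {..<qt} \<subseteq> {..<n} \<and>
     qh \<le> qt \<and> si \<le> k \<and> (\<forall>v. lab v \<le> si) \<and>
     (\<forall>v. lab v \<noteq> 0 \<longrightarrow> (src (lab v - 1), v) \<in> (edges m tails heads ok)\<^sup>*) \<and>
     (\<forall>r<si. lab (src r) \<noteq> 0 \<and> lab (src r) \<le> Suc r) \<and>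
     (\<forall>i<qt. qh \<le> i \<or> Suc i = qh \<and> cur \<noteq> 0 \<longrightarrow> lab (q i) = si) \<and>
     (cur \<noteq> 0 \<longrightarrow> 0 < qh \<and> cur \<le> m \<and> tails (cur - 1) = q (qh - 1)) \<and>
     (\<forall>i<qh. \<forall>e<m. ok e \<and> tails e = q i \<and> \<not> (Suc i = qh \<and> e < cur) \<longrightarrow>
        lab (heads e) \<noteq> 0 \<and> lab (heads e) \<le> lab (q i)) \<and>
     (\<forall>i<qt. (\<exists>r<k. q i = src r) \<or>
        par (q i) < m \<and> ok (par (q i)) \<and> heads (par (q i)) = q i \<and> (\<exists>i'<i. q i' = tails (par (q i))))"

lemma invD:
  assumes "inv lab par q qh qt cur si"
  shows inv_inj: "inj_on q {..<qt}"
    and inv_lab[rule_format]: "\<forall>v. lab v \<noteq> 0 \<longleftrightarrow> v \<in> q ` {..<qt}"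
    and inv_less: "q ` {..<qt} \<subseteq> {..<n}"
    and inv_qh: "qh \<le> qt"
    and inv_si: "si \<le> k"
    and inv_lab_le[rule_format]: "\<forall>v. lab v \<le> si"
    and inv_reach[rule_format]: "\<forall>v. lab v \<noteq> 0 \<longrightarrow> (src (lab v - 1), v) \<in> (edges m tails heads ok)\<^sup>*"
    and inv_src[rule_format]: "\<forall>r<si. lab (src r) \<noteq> 0 \<and> lab (src r) \<le> Suc r"
    and inv_active[rule_format]: "\<forall>i<qt. qh \<le> i \<or> Suc i = qh \<and> cur \<noteq> 0 \<longrightarrow> lab (q i) = si"
    and inv_cur[rule_format]: "cur \<noteq> 0 \<longrightarrow> 0 < qh \<and> cur \<le> m \<and> tails (cur - 1) = q (qh - 1)"
    and inv_done[rule_format]: "\<forall>i<qh. \<forall>e<m. ok e \<and> tails e = q i \<and> \<not> (Suc i = qh \<and> e < cur) \<longrightarrow>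
        lab (heads e) \<noteq> 0 \<and> lab (heads e) \<le> lab (q i)"
    and inv_par[rule_format]: "\<forall>i<qt. (\<exists>r<k. q i = src r) \<or>
        par (q i) < m \<and> ok (par (q i)) \<and> heads (par (q i)) = q i \<and> (\<exists>i'<i. q i' = tails (par (q i)))"
  using assms unfolding inv_def by - (elim conjE, assumption)+

lemma inv_newD:
  assumes "inv lab par q qh qt cur si" "lab v = 0"
  shows "v \<notin> q ` {..<qt}" "i < qt \<Longrightarrow> q i \<noteq> v"
  using inv_lab[OF assms(1), of v] assms(2) by auto

definition effort :: "(nat \<Rightarrow> nat) \<Rightarrow> nat \<Rightarrow> nat \<Rightarrow> nat \<Rightarrow> nat" where
  "effort q qh cur si = card {e. e < m \<and> (tails e \<notin> q ` {..<qh} \<or> 0 < qh \<and> e < cur \<and> tails e = q (qh - 1))} +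
     (n - qh) + (k - si)"

lemma queue_le: "inv lab par q qh qt cur si \<Longrightarrow> qt \<le> n"
  using card_mono[of "{..<n}" "q ` {..<qt}"] by (simp add: inv_def card_image)

lemma inv_init: "inv (\<lambda>_. 0) par q 0 0 0 0"
  by (simp add: inv_def)

lemma effort_edge:
  assumes "inv lab par q qh qt (Suc e) si" "\<And>i. i < qh \<Longrightarrow> q' i = q i"
  shows "effort q' qh (last_edge tails (tails e) e) si < effort q qh (Suc e) si"
proof -
  let ?A = "\<lambda>q cur. {e. e < m \<and> (tails e \<notin> q ` {..<qh} \<or> 0 < qh \<and> e < cur \<and> tails e = q (qh - 1))}"
  have e: "0 < qh" "e < m" "tails e = q (qh - 1)" using inv_cur[OF assms(1)] by auto
  have im: "q' ` {..<qh} = q ` {..<qh}" using assms by (intro image_cong) auto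
  have "?A q' (last_edge tails (tails e) e) \<subset> ?A q (Suc e)"
  proof
    show "?A q' (last_edge tails (tails e) e) \<subseteq> ?A q (Suc e)"
      using last_edge_le[of tails "tails e" e] e(1) assms(2)[of "qh - 1"] unfolding im by auto
    have "e \<in> ?A q (Suc e)" using e by auto
    moreover have "e \<notin> ?A q' (last_edge tails (tails e) e)"
      using e last_edge_le[of tails "tails e" e] unfolding im by auto
    ultimately show "?A q' (last_edge tails (tails e) e) \<noteq> ?A q (Suc e)" by blast
  qed
  then have "card (?A q' (last_edge tails (tails e) e)) < card (?A q (Suc e))"
    by (rule psubset_card_mono[rotated]) simp
  then show ?thesis by (simp add: effort_def)
qed

lemma effort_pop:
  assumes "inv lab par q qh qt 0 si" "qh < qt"
  shows "effort q (Suc qh) cur si < effort q qh 0 si"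
proof -
  have "q i \<noteq> q qh" if "i < qh" for i
    using inj_onD[OF inv_inj[OF assms(1)], of i qh] assms(2) that by fastforce
  then have "card {e. e < m \<and> (tails e \<notin> q ` {..<Suc qh} \<or> 0 < Suc qh \<and> e < cur \<and> tails e = q (Suc qh - 1))}
      \<le> card {e. e < m \<and> (tails e \<notin> q ` {..<qh} \<or> 0 < qh \<and> e < 0 \<and> tails e = q (qh - 1))}"
    by (intro card_mono) (auto simp: lessThan_Suc)
  moreover have "n - Suc qh < n - qh"
    using queue_le[OF assms(1)] assms(2) by simp
  ultimately show ?thesis unfolding effort_def by linarith
qed

lemma effort_source:
  assumes "si < k" "\<And>i. i < qh \<Longrightarrow> q' i = q i"
  shows "effort q' qh 0 (Suc si) < effort q qh 0 si"
proof -
  have "q' ` {..<qh} = q ` {..<qh}" using assms by (intro image_cong) auto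
  then show ?thesis using assms by (simp add: effort_def)
qed

lemma inv_edge_skip:
  assumes "inv lab par q qh qt (Suc e) si" "\<not> ok e \<or> lab (heads e) \<noteq> 0"
  shows "inv lab par q qh qt (last_edge tails (tails e) e) si"
proof -
  let ?c = "last_edge tails (tails e) e"
  have e: "0 < qh" "e < m" "tails e = q (qh - 1)" and c: "?c \<le> e" "?c \<noteq> 0 \<Longrightarrow> tails (?c - 1) = q (qh - 1)"
    using inv_cur[OF assms(1)] last_edge_le[of tails "tails e" e]
      last_edge_tail[of tails "tails e" e "?c - 1"]
    by auto
  have lab: "lab (q (qh - 1)) = si" "lab (heads e) \<le> si"
    using inv_active[OF assms(1), of "qh - 1"] inv_lab_le[OF assms(1)] e(1) inv_qh[OF assms(1)] by auto
  have "lab (heads e') \<noteq> 0 \<and> lab (heads e') \<le> lab (q i)"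
    if "i < qh" "e' < m" "ok e'" "tails e' = q i" "\<not> (Suc i = qh \<and> e' < ?c)" for i e'
  proof (cases "Suc i = qh \<and> e' < Suc e")
    case True
    then have "e' = e"
      using that last_edge_skip[of tails "tails e" e e'] e by (cases "e' = e") auto
    then show ?thesis using assms(2) True that lab e by auto
  next
    case False
    then show ?thesis using that inv_done[OF assms(1)] by blast
  qed
  moreover have "lab (q i) = si" if "i < qt" "qh \<le> i \<or> Suc i = qh \<and> ?c \<noteq> 0" for i
    using inv_active[OF assms(1) that(1)] that(2) by blast
  moreover have "?c \<le> m" using c e by simp
  ultimately show ?thesis
    unfolding inv_def using c(2) e(1)
    by (intro conjI allI impI inv_inj[OF assms(1)] inv_lab[OF assms(1)] inv_less[OF assms(1)]
        inv_qh[OF assms(1)] inv_si[OF assms(1)] inv_lab_le[OF assms(1)] inv_reach[OF assms(1)]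
        inv_par[OF assms(1)])
      (simp_all add: inv_src[OF assms(1)])
qed

lemma inv_edge_push:
  assumes "inv lab par q qh qt (Suc e) si" "ok e" "lab (heads e) = 0"
  shows "inv (lab(heads e := si)) (par(heads e := e)) (q(qt := heads e)) qh (Suc qt) (last_edge tails (tails e) e) si"
proof -
  have e: "0 < qh" "e < m" "tails e = q (qh - 1)" "qh \<le> qt"
    using inv_cur[OF assms(1)] inv_qh[OF assms(1)] by auto
  have lab: "lab (q (qh - 1)) = si"
    using inv_active[OF assms(1), of "qh - 1"] e by auto
  have "lab (q (qh - 1)) \<noteq> 0" using inv_lab[OF assms(1), of "q (qh - 1)"] e by auto
  then have si: "si \<noteq> 0" using lab by simp
  note new = inv_newD(1)[OF assms(1,3)] and ne = inv_newD(2)[OF assms(1,3)]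
  have "(src (si - 1), q (qh - 1)) \<in> (edges m tails heads ok)\<^sup>*"
    using inv_reach[OF assms(1)] lab \<open>lab (q (qh - 1)) \<noteq> 0\<close> by auto
  moreover have "(q (qh - 1), heads e) \<in> edges m tails heads ok" using e assms(2) unfolding edges_def by (intro CollectI exI[of _ e]) simp
  ultimately have reach: "(src (si - 1), heads e) \<in> (edges m tails heads ok)\<^sup>*" by (rule rtrancl_into_rtrancl)
  have "inv (lab(heads e := si)) (par(heads e := e)) (q(qt := heads e)) qh (Suc qt) (Suc e) si"
    unfolding inv_def
  proof (intro conjI)
    show "inj_on (q(qt := heads e)) {..<Suc qt}"
      using push_inj[OF inv_inj[OF assms(1)] new] .
    show "\<forall>v. (lab(heads e := si)) v \<noteq> 0 \<longleftrightarrow> v \<in> (q(qt := heads e)) ` {..<Suc qt}"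
      using inv_lab[OF assms(1)] si by (auto simp: lessThan_Suc)
    show "(q(qt := heads e)) ` {..<Suc qt} \<subseteq> {..<n}"
      using inv_less[OF assms(1)] heads_less[OF e(2)] by (auto simp: lessThan_Suc)
    show "qh \<le> Suc qt" "si \<le> k" "\<forall>v. (lab(heads e := si)) v \<le> si"
      using invD(4-6)[OF assms(1)] by auto
    show "\<forall>v. (lab(heads e := si)) v \<noteq> 0 \<longrightarrow>
      (src ((lab(heads e := si)) v - 1), v) \<in> (edges m tails heads ok)\<^sup>*"
      using inv_reach[OF assms(1)] reach by auto
    show "\<forall>r<si. (lab(heads e := si)) (src r) \<noteq> 0 \<and> (lab(heads e := si)) (src r) \<le> Suc r"
      using inv_src[OF assms(1)] assms(3) by fastforce
    show "\<forall>i<Suc qt. qh \<le> i \<or> Suc i = qh \<and> Suc e \<noteq> 0 \<longrightarrow>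
      (lab(heads e := si)) ((q(qt := heads e)) i) = si"
      using inv_active[OF assms(1)] by (auto simp: less_Suc_eq)
    show "Suc e \<noteq> 0 \<longrightarrow> 0 < qh \<and> Suc e \<le> m \<and> tails (Suc e - 1) = (q(qt := heads e)) (qh - 1)"
      using e by auto
    show "\<forall>i<qh. \<forall>e'<m. ok e' \<and> tails e' = (q(qt := heads e)) i \<and> \<not> (Suc i = qh \<and> e' < Suc e) \<longrightarrow>
        (lab(heads e := si)) (heads e') \<noteq> 0 \<and> (lab(heads e := si)) (heads e') \<le> (lab(heads e := si)) ((q(qt := heads e)) i)"
    proof (intro allI impI)
      fix i e' assume i: "i < qh" and e': "e' < m"
        and a: "ok e' \<and> tails e' = (q(qt := heads e)) i \<and> \<not> (Suc i = qh \<and> e' < Suc e)"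
      then have "lab (heads e') \<noteq> 0 \<and> lab (heads e') \<le> lab (q i)"
        using inv_done[OF assms(1) i e'] e by auto
      then show "(lab(heads e := si)) (heads e') \<noteq> 0 \<and>
          (lab(heads e := si)) (heads e') \<le> (lab(heads e := si)) ((q(qt := heads e)) i)"
        using assms(3) ne[of i] i e by auto
    qed
    show "\<forall>i<Suc qt. (\<exists>r<k. (q(qt := heads e)) i = src r) \<or>
       (par(heads e := e)) ((q(qt := heads e)) i) < m \<and> ok ((par(heads e := e)) ((q(qt := heads e)) i)) \<and>
       heads ((par(heads e := e)) ((q(qt := heads e)) i)) = (q(qt := heads e)) i \<and>
       (\<exists>i'<i. (q(qt := heads e)) i' = tails ((par(heads e := e)) ((q(qt := heads e)) i)))"
    proof (intro allI impI)
      fix i assume "i < Suc qt"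
      show "(\<exists>r<k. (q(qt := heads e)) i = src r) \<or>
       (par(heads e := e)) ((q(qt := heads e)) i) < m \<and> ok ((par(heads e := e)) ((q(qt := heads e)) i)) \<and>
       heads ((par(heads e := e)) ((q(qt := heads e)) i)) = (q(qt := heads e)) i \<and>
       (\<exists>i'<i. (q(qt := heads e)) i' = tails ((par(heads e := e)) ((q(qt := heads e)) i)))"
      proof (cases "i = qt")
        case True
        have "qh - 1 < qt" using e by simp
        then show ?thesis using True e assms by (auto intro!: exI[of _ "qh - 1"])
      next
        case False
        with \<open>i < Suc qt\<close> have "i < qt" by simp
        then have "(\<exists>r<k. q i = src r) \<or>
          par (q i) < m \<and> ok (par (q i)) \<and> heads (par (q i)) = q i \<and> (\<exists>i'<i. q i' = tails (par (q i)))"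
          using inv_par[OF assms(1)] by blast
        then show ?thesis
          using \<open>i < qt\<close> ne[of i] by (simp add: push_ex[OF less_imp_le] del: fun_upd_apply) (simp add: fun_upd_def)
      qed
    qed
  qed
  then show ?thesis using si by (intro inv_edge_skip) auto
qed

lemma inv_pop:
  assumes "inv lab par q qh qt 0 si" "qh < qt"
  shows "inv lab par q (Suc qh) qt (last_edge tails (q qh) m) si"
proof -
  let ?c = "last_edge tails (q qh) m"
  have c: "?c \<le> m" "?c \<noteq> 0 \<Longrightarrow> tails (?c - 1) = q qh"
    using last_edge_le[of tails "q qh" m] last_edge_tail[of tails "q qh" m "?c - 1"] by auto
  have "lab (heads e) \<noteq> 0 \<and> lab (heads e) \<le> lab (q i)"
    if "i < Suc qh" "e < m" "ok e" "tails e = q i" "\<not> (Suc i = Suc qh \<and> e < ?c)" for i e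
  proof (cases "i = qh")
    case True
    then show ?thesis using that last_edge_skip[of tails "q qh" m e] by auto
  next
    case False
    then have "i < qh" using that by simp
    then show ?thesis using that inv_done[OF assms(1)] by blast
  qed
  moreover have "lab (q i) = si" if "i < qt" "Suc qh \<le> i \<or> Suc i = Suc qh \<and> ?c \<noteq> 0" for i
    using inv_active[OF assms(1) that(1)] that(2) by auto
  moreover have "?c \<noteq> 0 \<longrightarrow> 0 < Suc qh \<and> ?c \<le> m \<and> tails (?c - 1) = q (Suc qh - 1)" using c by simp
  ultimately show ?thesis
    unfolding inv_def using assms(2)
    by (intro conjI allI impI inv_inj[OF assms(1)] inv_lab[OF assms(1)] inv_less[OF assms(1)]
        inv_si[OF assms(1)] inv_lab_le[OF assms(1)] inv_reach[OF assms(1)] inv_par[OF assms(1)])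
      (simp_all add: inv_src[OF assms(1)])
qed

lemma inv_source_skip:
  assumes "inv lab par q qt qt 0 si" "si < k" "lab (src si) \<noteq> 0"
  shows "inv lab par q qt qt 0 (Suc si)"
proof -
  have "lab (src r) \<noteq> 0 \<and> lab (src r) \<le> Suc r" if "r < Suc si" for r
    using inv_src[OF assms(1), of r] inv_lab_le[OF assms(1), of "src r"] assms(3) that
    by (cases "r = si") auto
  moreover have "lab v \<le> Suc si" for v
    using inv_lab_le[OF assms(1), of v] by simp
  moreover have "lab (q i) = Suc si" if "i < qt" "qt \<le> i \<or> Suc i = qt \<and> 0 \<noteq> (0 :: nat)" for i
    using that by simp
  ultimately show ?thesis
    unfolding inv_def using Suc_leI[OF assms(2)]
    by (intro conjI allI impI inv_inj[OF assms(1)] inv_lab[OF assms(1)] inv_less[OF assms(1)]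
        inv_reach[OF assms(1)] inv_par[OF assms(1)])
      (use inv_done[OF assms(1)] in simp_all)
qed

lemma inv_source_push:
  assumes "inv lab par q qt qt 0 si" "si < k" "lab (src si) = 0"
  shows "inv (lab(src si := Suc si)) par (q(qt := src si)) qt (Suc qt) 0 (Suc si)"
proof -
  note new = inv_newD(1)[OF assms(1,3)] and ne = inv_newD(2)[OF assms(1,3)]
  show ?thesis
    unfolding inv_def
  proof (intro conjI)
    show "inj_on (q(qt := src si)) {..<Suc qt}"
      using push_inj[OF inv_inj[OF assms(1)] new] .
    show "\<forall>v. (lab(src si := Suc si)) v \<noteq> 0 \<longleftrightarrow> v \<in> (q(qt := src si)) ` {..<Suc qt}"
      using inv_lab[OF assms(1)] by (auto simp: lessThan_Suc)
    show "(q(qt := src si)) ` {..<Suc qt} \<subseteq> {..<n}"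
      using inv_less[OF assms(1)] src_less[OF assms(2)] by (auto simp: lessThan_Suc)
    show "qt \<le> Suc qt" "Suc si \<le> k" using assms by auto
    show "\<forall>v. (lab(src si := Suc si)) v \<le> Suc si"
      using inv_lab_le[OF assms(1)] by (auto intro: le_SucI)
    show "\<forall>v. (lab(src si := Suc si)) v \<noteq> 0 \<longrightarrow>
      (src ((lab(src si := Suc si)) v - 1), v) \<in> (edges m tails heads ok)\<^sup>*"
      using inv_reach[OF assms(1)] by auto
    show "\<forall>r<Suc si. (lab(src si := Suc si)) (src r) \<noteq> 0 \<and> (lab(src si := Suc si)) (src r) \<le> Suc r"
    proof (intro allI impI)
      fix r assume "r < Suc si"
      then show "(lab(src si := Suc si)) (src r) \<noteq> 0 \<and> (lab(src si := Suc si)) (src r) \<le> Suc r"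
        using inv_src[OF assms(1), of r] assms(3) by (cases "r = si") auto
    qed
    show "\<forall>i<Suc qt. qt \<le> i \<or> Suc i = qt \<and> (0 :: nat) \<noteq> 0 \<longrightarrow>
      (lab(src si := Suc si)) ((q(qt := src si)) i) = Suc si"
      by auto
    show "\<forall>i<qt. \<forall>e<m. ok e \<and> tails e = (q(qt := src si)) i \<and> \<not> (Suc i = qt \<and> e < 0) \<longrightarrow>
        (lab(src si := Suc si)) (heads e) \<noteq> 0 \<and>
        (lab(src si := Suc si)) (heads e) \<le> (lab(src si := Suc si)) ((q(qt := src si)) i)"
    proof (intro allI impI)
      fix i e assume i: "i < qt" and e: "e < m"
        and a: "ok e \<and> tails e = (q(qt := src si)) i \<and> \<not> (Suc i = qt \<and> e < 0)"
      then have "lab (heads e) \<noteq> 0 \<and> lab (heads e) \<le> lab (q i)"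
        using inv_done[OF assms(1) i e] by auto
      then show "(lab(src si := Suc si)) (heads e) \<noteq> 0 \<and>
        (lab(src si := Suc si)) (heads e) \<le> (lab(src si := Suc si)) ((q(qt := src si)) i)"
        using assms(3) ne[of i] i by auto
    qed
    show "\<forall>i<Suc qt. (\<exists>r<k. (q(qt := src si)) i = src r) \<or>
       par ((q(qt := src si)) i) < m \<and> ok (par ((q(qt := src si)) i)) \<and>
       heads (par ((q(qt := src si)) i)) = (q(qt := src si)) i \<and>
       (\<exists>i'<i. (q(qt := src si)) i' = tails (par ((q(qt := src si)) i)))"
    proof (intro allI impI)
      fix i assume "i < Suc qt"
      show "(\<exists>r<k. (q(qt := src si)) i = src r) \<or>
       par ((q(qt := src si)) i) < m \<and> ok (par ((q(qt := src si)) i)) \<and>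
       heads (par ((q(qt := src si)) i)) = (q(qt := src si)) i \<and>
       (\<exists>i'<i. (q(qt := src si)) i' = tails (par ((q(qt := src si)) i)))"
      proof (cases "i = qt")
        case True
        then show ?thesis using assms(2) by auto
      next
        case False
        with \<open>i < Suc qt\<close> have "i < qt" by simp
        then have "(\<exists>r<k. q i = src r) \<or>
          par (q i) < m \<and> ok (par (q i)) \<and> heads (par (q i)) = q i \<and> (\<exists>i'<i. q i' = tails (par (q i)))"
          using inv_par[OF assms(1)] by blast
        then show ?thesis
          using \<open>i < qt\<close> by (simp add: push_ex[OF less_imp_le] del: fun_upd_apply) (simp add: fun_upd_def)
      qed
    qed
  qed simp
qed

lemma inv_final:
  assumes "inv lab par q qt qt 0 k"
  shows "labels_found m k tails heads src ok lab" "parents_found n m k tails heads src lab par"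
proof -
  let ?A = "edges m tails heads ok"
  have "0 < lab v \<and> lab v \<le> r \<longleftrightarrow> (\<exists>r'<r. (src r', v) \<in> ?A\<^sup>*)" if r: "r \<le> k" for r v
  proof
    assume v: "0 < lab v \<and> lab v \<le> r"
    then have "(src (lab v - 1), v) \<in> ?A\<^sup>*" using inv_reach[OF assms] by auto
    moreover have "lab v - 1 < r" using v by linarith
    ultimately show "\<exists>r'<r. (src r', v) \<in> ?A\<^sup>*" by blast
  next
    assume "\<exists>r'<r. (src r', v) \<in> ?A\<^sup>*"
    then obtain r' where r': "r' < r" "(src r', v) \<in> ?A\<^sup>*" by blast
    from r'(2) show "0 < lab v \<and> lab v \<le> r"
    proof (induction rule: rtrancl_induct)
      case base
      have "lab (src r') \<noteq> 0 \<and> lab (src r') \<le> Suc r'"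
        using inv_src[OF assms] r' r by auto
      then show ?case using r' by auto
    next
      case (step y z)
      then obtain e where e: "e < m" "ok e" "tails e = y" "heads e = z" by (auto simp: edges_def)
      have "lab y \<noteq> 0" using step by simp
      then obtain i where "i < qt" "y = q i" using inv_lab[OF assms] by auto
      then have "lab z \<noteq> 0 \<and> lab z \<le> lab y" using inv_done[OF assms, of i e] e by auto
      then show ?case using step by auto
    qed
  qed
  then show "labels_found m k tails heads src ok lab" using inv_lab_le[OF assms] by (simp add: labels_found_def)
  note inj = inv_inj[OF assms] and img = inv_lab[OF assms] and par = inv_par[OF assms]
  let ?pos = "the_inv_into {..<qt} q"
  have pos: "?pos (q i) = i" if "i < qt" for i
    using the_inv_into_f_f[OF inj] that by simp
  show "parents_found n m k tails heads src lab par"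
    unfolding parents_found_def
  proof (intro exI[of _ ?pos] allI impI)
    fix v assume "lab v \<noteq> 0"
    then obtain i where i: "i < qt" "v = q i" using img by auto
    have "(\<exists>r<k. q i = src r) \<or> par (q i) < m \<and> heads (par (q i)) = q i \<and>
        lab (tails (par (q i))) \<noteq> 0 \<and> ?pos (tails (par (q i))) < i"
      using par[OF i(1)]
    proof
      assume "par (q i) < m \<and> ok (par (q i)) \<and> heads (par (q i)) = q i \<and> (\<exists>i'<i. q i' = tails (par (q i)))"
      then obtain i' where i': "i' < i" "q i' = tails (par (q i))" "par (q i) < m" "heads (par (q i)) = q i"
        by blast
      then have "i' < qt" using i by simp
      then show ?thesis using i' pos[of i'] img[of "q i'"] imageI[of i' "{..<qt}" q] by simp
    qed simp
    then show "?pos v < n \<and> ((\<exists>r<k. v = src r) \<or> par v < m \<and> heads (par v) = v \<and>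
        lab (tails (par v)) \<noteq> 0 \<and> ?pos (tails (par v)) < ?pos v)"
      using i pos[of i] queue_le[OF assms] by auto
  qed
qed

end

definition search_body :: "nat \<Rightarrow> nat \<Rightarrow> nat \<Rightarrow> nat \<Rightarrow> com" where
  "search_body H F S b =
     (let e = Sub (Var (b + 3)) (Const 1); w = Read H e; u = Read S (Sub (Var (b + 4)) (Const 1)) in
      If (Var (b + 3))
        (Seq (If (Read F e) Skip
               (If (Read (b + 2) w) Skip
                 (Seq (Write (b + 2) w (Var (b + 4)))
                 (Seq (Write (b + 3) w e)
                 (Seq (Write (b + 4) (Var (b + 2)) w)
                      (Assign (b + 2) (Add (Var (b + 2)) (Const 1))))))))
             (Assign (b + 3) (Read (b + 1) e)))
        (If (Less (Var (b + 1)) (Var (b + 2)))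
          (Seq (Assign (b + 3) (Read b (Read (b + 4) (Var (b + 1)))))
               (Assign (b + 1) (Add (Var (b + 1)) (Const 1))))
          (Seq (Assign (b + 4) (Add (Var (b + 4)) (Const 1)))
               (If (Read (b + 2) u) Skip
                 (Seq (Write (b + 2) u (Var (b + 4)))
                 (Seq (Write (b + 4) (Var (b + 2)) u)
                      (Assign (b + 2) (Add (Var (b + 2)) (Const 1)))))))))"

text \<open>The guard says that \<open>cur \<noteq> 0\<close>, \<open>qh < qt\<close> or \<open>si < k\<close>.\<close>
definition search_loop :: "nat \<Rightarrow> nat \<Rightarrow> nat \<Rightarrow> nat \<Rightarrow> nat \<Rightarrow> com" where
  "search_loop H F S K b =
     While (Sub (Const 1) (Sub (Sub (Eq (Var (b + 3)) (Const 0)) (Less (Var (b + 1)) (Var (b + 2))))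
         (Less (Var (b + 4)) (Var K))))
       (search_body H F S b)"

text \<open>
  Searches the graph with tails in array \<open>T\<close> and heads in array \<open>H\<close>, ignoring the edges marked in
  array \<open>F\<close>, from the sources in array \<open>S\<close>, whose number is in variable \<open>K\<close>. Labels end up in array
  \<open>b + 2\<close> and the edges by which nodes were found in array \<open>b + 3\<close>.
\<close>
definition search_from :: "nat \<Rightarrow> nat \<Rightarrow> nat \<Rightarrow> nat \<Rightarrow> nat \<Rightarrow> nat \<Rightarrow> com" where
  "search_from T H F S K b = Seq (link_edges T b) (search_loop H F S K b)"

lemma search_body_straight: "straight (search_body H F S b)"
  by (simp add: search_body_def Let_def)

lemma search_body_written:
  "written_vars (search_body H F S b) = {b + 1, b + 2, b + 3, b + 4}"
  "written_arrays (search_body H F S b) = {b + 2, b + 3, b + 4}"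
  by (auto simp: search_body_def Let_def)

lemma search_from_written:
  "written_vars (search_from T H F S K b) = {b, b + 1, b + 2, b + 3, b + 4}"
  "written_arrays (search_from T H F S K b) = {b, b + 1, b + 2, b + 3, b + 4}"
  by (auto simp: search_from_def link_edges_def search_loop_def search_body_written)

lemma search_loop_correct:
  assumes "search n m k (arrays \<sigma> T) (arrays \<sigma> H) (arrays \<sigma> S)"
    and links: "\<And>v. arrays \<sigma> b v = last_edge (arrays \<sigma> T) v m"
      "\<And>e. e < m \<Longrightarrow> arrays \<sigma> (b + 1) e = last_edge (arrays \<sigma> T) (arrays \<sigma> T e) e"
    and "vars \<sigma> K = k"
    and zero: "\<And>i. i \<in> {1..4} \<Longrightarrow> vars \<sigma> (b + i) = 0" "arrays \<sigma> (b + 2) = (\<lambda>_. 0)"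
    and fresh: "K \<notin> {b + 1..b + 4}" "{H, F, S} \<inter> {b + 2..b + 4} = {}"
  shows "wp (100 * Suc (m + n + k)) (search_loop H F S K b)
    (\<lambda>\<tau>. labels_found m k (arrays \<sigma> T) (arrays \<sigma> H) (arrays \<sigma> S) (\<lambda>e. arrays \<sigma> F e = 0)
            (arrays \<tau> (b + 2)) \<and>
         parents_found n m k (arrays \<sigma> T) (arrays \<sigma> H) (arrays \<sigma> S)
            (arrays \<tau> (b + 2)) (arrays \<tau> (b + 3))) \<sigma>"
proof -
  interpret search n m k "arrays \<sigma> T" "arrays \<sigma> H" "arrays \<sigma> S" "\<lambda>e. arrays \<sigma> F e = 0"
    by fact
  let ?I = "\<lambda>\<tau>. inv (arrays \<tau> (b + 2)) (arrays \<tau> (b + 3)) (arrays \<tau> (b + 4))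
      (vars \<tau> (b + 1)) (vars \<tau> (b + 2)) (vars \<tau> (b + 3)) (vars \<tau> (b + 4))"
  let ?\<mu> = "\<lambda>\<tau>. effort (arrays \<tau> (b + 4)) (vars \<tau> (b + 1)) (vars \<tau> (b + 3)) (vars \<tau> (b + 4))"
  have frame: "arrays \<tau> H = arrays \<sigma> H" "arrays \<tau> F = arrays \<sigma> F" "arrays \<tau> S = arrays \<sigma> S"
      "arrays \<tau> b = arrays \<sigma> b" "arrays \<tau> (b + 1) = arrays \<sigma> (b + 1)" "vars \<tau> K = k"
    if "framed (search_body H F S b) \<sigma> \<tau>" for \<tau>
    using that fresh assms(4) by (auto simp: framed_def search_body_written)
  have ne: "H \<noteq> b + 2" "H \<noteq> b + 3" "H \<noteq> b + 4" "S \<noteq> b + 2" "S \<noteq> b + 4"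
    using fresh by auto
  show ?thesis
    unfolding search_loop_def
  proof (rule wp_While[where I = ?I and \<mu> = ?\<mu> and M = "m + n + k"], goal_cases)
    case 1
    show ?case by (rule search_body_straight)
  next
    case 2
    then show ?case using inv_init zero(1)[of 1] zero(1)[of 2] zero(1)[of 3] zero(1)[of 4] zero(2) by simp
  next
    case 3
    have "card {e. e < m} \<le> m" by simp
    moreover have "card {e. e < m \<and> P e} \<le> card {e. e < m}" for P by (intro card_mono) auto
    ultimately have "card {e. e < m \<and> P e} \<le> m" for P using order_trans by blast
    then show ?case unfolding effort_def by (intro add_mono) auto
  next
    case (4 \<tau>)
    note fr = frame[OF 4(2)] and I = 4(1)
    define lab par q qh qt cur si where d: "lab = arrays \<tau> (b + 2)" "par = arrays \<tau> (b + 3)"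
      "q = arrays \<tau> (b + 4)" "qh = vars \<tau> (b + 1)" "qt = vars \<tau> (b + 2)" "cur = vars \<tau> (b + 3)"
      "si = vars \<tau> (b + 4)"
    note d' = d[symmetric] d[symmetric, simplified]
    have I: "inv lab par q qh qt cur si" using I by (simp add: d)
    have qh: "qh \<le> qt" by (rule inv_qh[OF I])
    show ?case
    proof (cases cur)
      case (Suc e)
      with I have I': "inv lab par q qh qt (Suc e) si" by simp
      have e: "e < m" "arrays \<sigma> (b + 1) e = last_edge (arrays \<sigma> T) (arrays \<sigma> T e) e"
        using inv_cur[OF I'] links(2) by auto
      show ?thesis
      proof (cases "arrays \<sigma> F e = 0 \<and> lab (arrays \<sigma> H e) = 0")
        case True
        then show ?thesis
          using inv_edge_push[OF I'] effort_edge[OF I', of "q(qt := arrays \<sigma> H e)"] qh e Suc fr ne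
          by (simp add: search_body_def Let_def d')
      next
        case False
        then show ?thesis
          using inv_edge_skip[OF I'] effort_edge[OF I', of q] e Suc fr ne
          by (auto simp add: search_body_def Let_def d')
      qed
    next
      case 0
      with I have I': "inv lab par q qh qt 0 si" by simp
      show ?thesis
      proof (cases "qh < qt")
        case True
        then show ?thesis
          using inv_pop[OF I'] effort_pop[OF I'] 0 fr links(1)
          by (simp add: search_body_def Let_def d')
      next
        case False
        then have qt: "qh = qt" using qh by simp
        then have si: "si < k" using 4(3) 0 fr False by (auto simp: d' split: if_splits)
        with I' qt have I'': "inv lab par q qt qt 0 si" by simp
        show ?thesis
        proof (cases "lab (arrays \<sigma> S si) = 0")
          case True
          then show ?thesis
            using inv_source_push[OF I'' si] effort_source[OF si, of qt "q(qt := arrays \<sigma> S si)" q] 0 fr ne qt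
            by (simp add: search_body_def Let_def d')
        next
          case False
          then show ?thesis
            using inv_source_skip[OF I'' si] effort_source[OF si, of qt q q] 0 fr ne qt
            by (simp add: search_body_def Let_def d')
        qed
      qed
    qed
  next
    case (5 \<tau>)
    note fr = frame[OF 5(2)]
    have "vars \<tau> (b + 3) = 0" "vars \<tau> (b + 1) = vars \<tau> (b + 2)" "vars \<tau> (b + 4) = k"
      using 5(3) fr inv_qh[OF 5(1)] inv_si[OF 5(1)] by (auto split: if_splits)
    then show ?case using inv_final 5(1) by auto
  next
    case 6
    show ?case by (simp add: search_body_def Let_def)
  qed
qed

lemma search_from_correct:
  assumes "search n m k (arrays \<sigma> T) (arrays \<sigma> H) (arrays \<sigma> S)"
    and "vars \<sigma> 1 = m" "vars \<sigma> K = k" "b > 3"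
    and zero: "\<And>i. i \<in> {b..b + 4} \<Longrightarrow> vars \<sigma> i = 0" "\<And>i. i \<in> {b..b + 4} \<Longrightarrow> arrays \<sigma> i = (\<lambda>_. 0)"
    and fresh: "K \<notin> {b..b + 4}" "{T, H, F, S} \<inter> {b..b + 4} = {}"
  shows "wp (140 * Suc (m + n + k)) (search_from T H F S K b)
    (\<lambda>\<tau>. labels_found m k (arrays \<sigma> T) (arrays \<sigma> H) (arrays \<sigma> S) (\<lambda>e. arrays \<sigma> F e = 0)
            (arrays \<tau> (b + 2)) \<and>
         parents_found n m k (arrays \<sigma> T) (arrays \<sigma> H) (arrays \<sigma> S)
            (arrays \<tau> (b + 2)) (arrays \<tau> (b + 3))) \<sigma>"
proof -
  have "wp (40 * Suc m + 100 * Suc (m + n + k)) (search_from T H F S K b)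
    (\<lambda>\<tau>. labels_found m k (arrays \<sigma> T) (arrays \<sigma> H) (arrays \<sigma> S) (\<lambda>e. arrays \<sigma> F e = 0)
            (arrays \<tau> (b + 2)) \<and>
         parents_found n m k (arrays \<sigma> T) (arrays \<sigma> H) (arrays \<sigma> S)
            (arrays \<tau> (b + 2)) (arrays \<tau> (b + 3))) \<sigma>"
    unfolding search_from_def
  proof (rule wp_Seq[OF link_edges_correct], goal_cases)
    case (7 \<tau>)
    have "arrays \<tau> T = arrays \<sigma> T" "arrays \<tau> H = arrays \<sigma> H" "arrays \<tau> F = arrays \<sigma> F"
      "arrays \<tau> S = arrays \<sigma> S" "arrays \<tau> (b + 2) = (\<lambda>_. 0)" "vars \<tau> K = k"
      "\<And>i. i \<in> {1..4} \<Longrightarrow> vars \<tau> (b + i) = 0"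
      using framed_arrays[OF 7(2)] framed_vars[OF 7(2)] fresh zero assms(3)
      by (auto simp: link_edges_def)
    then show ?case
      using search_loop_correct[of n m k \<tau> T H S b K F] assms(1) 7(1) fresh by auto
  qed (use assms in auto)
  then show ?thesis by (rule wp_mono) auto
qed

definition copy_edges :: com where
  "copy_edges = While (Less (Var 4) (Var 1))
     (Seq (Write 4 (Var 4) (Read 0 (Var 4)))
     (Seq (Write 5 (Var 4) (Read 1 (Var 4)))
          (Assign 4 (Add (Var 4) (Const 1)))))"

lemma copy_edges_correct:
  assumes "vars \<sigma> 4 = 0" "vars \<sigma> 1 = m"
  shows "wp (40 * Suc m) copy_edges
    (\<lambda>\<tau>. \<forall>e<m. arrays \<tau> 4 e = arrays \<sigma> 0 e \<and> arrays \<tau> 5 e = arrays \<sigma> 1 e) \<sigma>"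
  unfolding copy_edges_def
proof (rule wp_While[where I = "\<lambda>\<tau>. vars \<tau> 4 \<le> m \<and>
      (\<forall>e<vars \<tau> 4. arrays \<tau> 4 e = arrays \<sigma> 0 e \<and> arrays \<tau> 5 e = arrays \<sigma> 1 e)"
      and \<mu> = "\<lambda>\<tau>. m - vars \<tau> 4" and M = m], goal_cases)
  case (4 \<tau>)
  have "arrays \<tau> 0 = arrays \<sigma> 0" "arrays \<tau> 1 = arrays \<sigma> 1" "vars \<tau> 1 = m"
    using framed_arrays[OF 4(2)] framed_vars[OF 4(2), of 1] assms by auto
  with 4 show ?case by (auto simp: less_Suc_eq split: if_splits)
next
  case (5 \<tau>)
  have "vars \<tau> 1 = m" using framed_vars[OF 5(2), of 1] assms by auto
  with 5 show ?case by (auto split: if_splits)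
qed (use assms in auto)

section \<open>The algorithm\<close>

lemma decreasing_chain:
  fixes p :: "nat \<Rightarrow> nat"
  assumes "\<And>i. i < k \<Longrightarrow> p (Suc i) < p i" "i < j" "j \<le> k"
  shows "p j < p i"
  using assms(2,3)
proof (induction j)
  case (Suc j)
  then show ?case using assms(1)[of j] by (cases "i = j") auto
qed simp

definition trace_path :: com where
  "trace_path = Seq (Write 9 (Const 0) (Var 2))
     (While (Sub (Read 22 (Read 9 (Var 8))) (Eq (Read 9 (Var 8)) (Var 3)))
       (Seq (Assign 7 (Read 23 (Read 9 (Var 8))))
       (Seq (Write 8 (Var 8) (Var 7))
       (Seq (Write 10 (Var 7) (Const 1))
       (Seq (Assign 8 (Add (Var 8) (Const 1)))
            (Write 9 (Var 8) (Read 5 (Var 7))))))))"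

lemma trace_path_correct:
  fixes pos :: "nat \<Rightarrow> nat"
  assumes \<sigma>: "vars \<sigma> 2 = s" "vars \<sigma> 3 = t" "vars \<sigma> 8 = 0" "arrays \<sigma> 10 = (\<lambda>_. 0)"
      "arrays \<sigma> 22 = lab" "arrays \<sigma> 23 = par" "arrays \<sigma> 4 = tails" "arrays \<sigma> 5 = heads"
    and lab: "\<And>v. lab v \<le> 1"
    and pos: "\<And>v. lab v \<noteq> 0 \<Longrightarrow> pos v < n"
    and par: "\<And>v. lab v \<noteq> 0 \<Longrightarrow> v \<noteq> t \<Longrightarrow> par v < m \<and> tails (par v) = v \<and>
      lab (heads (par v)) \<noteq> 0 \<and> pos (heads (par v)) < pos v"
  shows "wp (50 * Suc n) trace_path (\<lambda>\<tau>. arrays \<tau> 9 0 = s \<and>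
    (\<forall>i<vars \<tau> 8. arrays \<tau> 8 i < m \<and> tails (arrays \<tau> 8 i) = arrays \<tau> 9 i \<and>
       heads (arrays \<tau> 8 i) = arrays \<tau> 9 (Suc i)) \<and>
    inj_on (arrays \<tau> 9) {..vars \<tau> 8} \<and>
    (if lab s = 0 then vars \<tau> 8 = 0 else arrays \<tau> 9 (vars \<tau> 8) = t) \<and>
    (\<forall>e. arrays \<tau> 10 e \<noteq> 0 \<longleftrightarrow> e \<in> arrays \<tau> 8 ` {..<vars \<tau> 8})) \<sigma>" (is "wp _ _ ?Q _")
proof -
  define I :: "state \<Rightarrow> bool" where "I = (\<lambda>\<tau>. arrays \<tau> 9 0 = s \<and>
    (\<forall>i<vars \<tau> 8. arrays \<tau> 8 i < m \<and> tails (arrays \<tau> 8 i) = arrays \<tau> 9 i \<and>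
       heads (arrays \<tau> 8 i) = arrays \<tau> 9 (Suc i) \<and> pos (arrays \<tau> 9 (Suc i)) < pos (arrays \<tau> 9 i)) \<and>
    (if lab s = 0 then vars \<tau> 8 = 0 else lab (arrays \<tau> 9 (vars \<tau> 8)) \<noteq> 0) \<and>
    (\<forall>e. arrays \<tau> 10 e \<noteq> 0 \<longleftrightarrow> e \<in> arrays \<tau> 8 ` {..<vars \<tau> 8}))"
  define \<mu> :: "state \<Rightarrow> nat" where "\<mu> = (\<lambda>\<tau>. if lab s = 0 then 0 else pos (arrays \<tau> 9 (vars \<tau> 8)))"
  have "wp (3 + 40 * Suc n) trace_path ?Q \<sigma>"
    unfolding trace_path_def
  proof (rule wp_Seq_run, goal_cases)
    case 3
    define \<tau> where "\<tau> = run (Write 9 (Const 0) (Var 2)) \<sigma>"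
    have \<tau>: "vars \<tau> 8 = 0" "arrays \<tau> 9 0 = s" "vars \<tau> 3 = t" "arrays \<tau> 10 = (\<lambda>_. 0)"
      "arrays \<tau> 22 = lab" "arrays \<tau> 23 = par" "arrays \<tau> 4 = tails" "arrays \<tau> 5 = heads"
      using \<sigma> by (simp_all add: \<tau>_def)
    show ?case
      unfolding \<tau>_def[symmetric]
    proof (rule wp_While[where I = I and \<mu> = \<mu> and M = n], goal_cases)
      case 2
      show ?case using \<tau> by (simp add: I_def)
    next
      case 3
      show ?case using pos[of s] \<tau> by (auto simp: \<mu>_def intro: less_imp_le)
    next
      case (4 \<rho>)
      let ?v = "arrays \<rho> 9 (vars \<rho> 8)"
      have fr: "vars \<rho> 3 = t" "arrays \<rho> 22 = lab" "arrays \<rho> 23 = par" "arrays \<rho> 5 = heads"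
        using framed_vars[OF 4(2), of 3] framed_arrays[OF 4(2)] \<tau> by auto
      have v: "lab ?v \<noteq> 0" "?v \<noteq> t"
        using 4(3) fr lab[of ?v] by (auto split: if_splits)
      have s: "lab s \<noteq> 0" using 4(1) v by (auto simp: I_def split: if_splits)
      note p = par[OF v]
      show ?case
      proof
        show "I (run (Seq (Assign 7 (Read 23 (Read 9 (Var 8)))) (Seq (Write 8 (Var 8) (Var 7))
            (Seq (Write 10 (Var 7) (Const 1)) (Seq (Assign 8 (Add (Var 8) (Const 1)))
            (Write 9 (Var 8) (Read 5 (Var 7))))))) \<rho>)"
          using 4(1) p s fr unfolding I_def by (auto simp: less_Suc_eq lessThan_Suc)
      qed (use p s fr in \<open>simp add: \<mu>_def\<close>)
    next
      case (5 \<rho>)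
      let ?k = "vars \<rho> 8" and ?x = "arrays \<rho> 9"
      have fr: "vars \<rho> 3 = t" "arrays \<rho> 22 = lab"
        using framed_vars[OF 5(2), of 3] framed_arrays[OF 5(2)] \<tau> by auto
      have "pos (?x (Suc i)) < pos (?x i)" if "i < ?k" for i
        using 5(1) that by (simp add: I_def)
      then have "pos (?x j) < pos (?x i)" if "i < j" "j \<le> ?k" for i j
        using decreasing_chain[of ?k "\<lambda>i. pos (?x i)"] that by blast
      then have "inj_on ?x {..?k}"
        by (intro linorder_inj_onI) fastforce+
      moreover have "?x ?k = t" if "lab s \<noteq> 0"
        using 5(1,3) fr lab[of "?x ?k"] that by (auto simp: I_def split: if_splits)
      ultimately show ?case using 5(1) unfolding I_def by auto
    qed auto
  qed auto
  then show ?thesis by (rule wp_mono) auto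
qed

definition find_bridges :: com where
  "find_bridges =
     Seq (Assign 9 (Var 8))
    (Seq (Assign 10 (Read 32 (Var 3)))
    (Seq (If (Var 10) Skip (Assign 10 (Add (Var 8) (Const 1))))
    (Seq (While (Var 9)
           (Seq (Assign 9 (Sub (Var 9) (Const 1)))
           (Seq (If (Less (Add (Var 9) (Const 1)) (Var 10))
                  (Seq (Assign 12 (Read 8 (Var 9)))
                  (Seq (Write 11 (Var 11) (Var 12))
                  (Seq (Write 12 (Var 12) (Const 1))
                  (Seq (Write 13 (Var 11) (Read 4 (Var 12)))
                       (Assign 11 (Add (Var 11) (Const 1)))))))
                  Skip)
                (If (Less (Read 32 (Read 9 (Var 9))) (Var 10))
                  (Assign 10 (Read 32 (Read 9 (Var 9))))
                  Skip))))
         (Assign 13 (Sub (Var 11) (Const 1))))))"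

lemma find_bridges_correct:
  assumes \<sigma>: "vars \<sigma> 8 = k" "vars \<sigma> 3 = t" "vars \<sigma> 11 = 0" "arrays \<sigma> 12 = (\<lambda>_. 0)"
      "arrays \<sigma> 9 = x" "arrays \<sigma> 8 = pe" "arrays \<sigma> 32 = lab" "arrays \<sigma> 4 = tails"
    and x: "k \<noteq> 0 \<Longrightarrow> x k = t"
    and lab: "\<And>i. i < k \<Longrightarrow> lab (x i) \<noteq> 0"
    and br: "\<And>i. br i \<longleftrightarrow> (\<forall>j. i < j \<and> j \<le> k \<longrightarrow> lab (x j) = 0 \<or> Suc i < lab (x j))"
  shows "wp (100 * Suc k) find_bridges (\<lambda>\<tau>.
    map (arrays \<tau> 11) [0..<vars \<tau> 11] = map pe (rev (filter br [0..<k])) \<and>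
    (\<forall>r<vars \<tau> 11. arrays \<tau> 13 r = tails (arrays \<tau> 11 r)) \<and>
    (\<forall>e. arrays \<tau> 12 e \<noteq> 0 \<longleftrightarrow> e \<in> arrays \<tau> 11 ` {..<vars \<tau> 11}) \<and>
    vars \<tau> 13 = vars \<tau> 11 - 1) \<sigma>" (is "wp _ _ ?Q _")
proof -
  define body where "body = Seq (Assign 9 (Sub (Var 9) (Const 1)))
           (Seq (If (Less (Add (Var 9) (Const 1)) (Var 10))
                  (Seq (Assign 12 (Read 8 (Var 9)))
                  (Seq (Write 11 (Var 11) (Var 12))
                  (Seq (Write 12 (Var 12) (Const 1))
                  (Seq (Write 13 (Var 11) (Read 4 (Var 12)))
                       (Assign 11 (Add (Var 11) (Const 1)))))))
                  Skip)
                (If (Less (Read 32 (Read 9 (Var 9))) (Var 10))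
                  (Assign 10 (Read 32 (Read 9 (Var 9))))
                  Skip))"
  define I :: "state \<Rightarrow> bool" where "I = (\<lambda>\<tau>. vars \<tau> 9 \<le> k \<and>
    (k \<noteq> 0 \<longrightarrow> (\<forall>c\<le>k. c < vars \<tau> 10 \<longleftrightarrow> (\<forall>j. vars \<tau> 9 \<le> j \<and> j \<le> k \<longrightarrow> lab (x j) = 0 \<or> c < lab (x j)))) \<and>
    map (arrays \<tau> 11) [0..<vars \<tau> 11] = map pe (rev (filter br [vars \<tau> 9..<k])) \<and>
    (\<forall>r<vars \<tau> 11. arrays \<tau> 13 r = tails (arrays \<tau> 11 r)) \<and>
    (\<forall>e. arrays \<tau> 12 e \<noteq> 0 \<longleftrightarrow> e \<in> arrays \<tau> 11 ` {..<vars \<tau> 11}))"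
  have loop: "wp (60 * Suc k) (While (Var 9) body) (\<lambda>\<tau>. I \<tau> \<and> vars \<tau> 9 = 0) \<tau>\<^sub>0"
    if \<tau>\<^sub>0: "I \<tau>\<^sub>0" "arrays \<tau>\<^sub>0 9 = x" "arrays \<tau>\<^sub>0 8 = pe" "arrays \<tau>\<^sub>0 32 = lab" "arrays \<tau>\<^sub>0 4 = tails" for \<tau>\<^sub>0
  proof (rule wp_While[where I = I and \<mu> = "\<lambda>\<tau>. vars \<tau> 9" and M = k], goal_cases)
    case (4 \<tau>)
    have fr: "arrays \<tau> 9 = x" "arrays \<tau> 8 = pe" "arrays \<tau> 32 = lab" "arrays \<tau> 4 = tails"
      using framed_arrays[OF 4(2)] \<tau>\<^sub>0 by (auto simp: body_def)
    obtain i where i: "vars \<tau> 9 = Suc i" using 4(3) by (cases "vars \<tau> 9") auto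
    have ik: "i < k" using 4(1) i by (auto simp: I_def)
    define M where "M = vars \<tau> 10"
    have M: "c < M \<longleftrightarrow> (\<forall>j. Suc i \<le> j \<and> j \<le> k \<longrightarrow> lab (x j) = 0 \<or> c < lab (x j))" if "c \<le> k" for c
      using 4(1) i ik that unfolding I_def M_def by auto
    have bri: "Suc i < M \<longleftrightarrow> br i"
      using M[of "Suc i"] ik by (simp add: br Suc_le_eq)
    let ?M = "if lab (x i) < M then lab (x i) else M"
    have M': "c < ?M \<longleftrightarrow> (\<forall>j. i \<le> j \<and> j \<le> k \<longrightarrow> lab (x j) = 0 \<or> c < lab (x j))" if "c \<le> k" for c
    proof -
      have "c < ?M \<longleftrightarrow> c < M \<and> c < lab (x i)" by auto
      also have "\<dots> \<longleftrightarrow> (\<forall>j. i \<le> j \<and> j \<le> k \<longrightarrow> lab (x j) = 0 \<or> c < lab (x j))"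
      proof -
        have "i \<le> j \<longleftrightarrow> j = i \<or> Suc i \<le> j" for j by auto
        then show ?thesis
          unfolding M[OF that] using lab[OF ik] less_imp_le[OF ik] by metis
      qed
      finally show ?thesis .
    qed
    have upt: "[i..<k] = i # [Suc i..<k]" using ik by (rule upt_conv_Cons)
    have list: "map (arrays \<tau> 11) [0..<vars \<tau> 11] = map pe (rev (filter br [Suc i..<k]))"
      and srcs: "\<forall>r<vars \<tau> 11. arrays \<tau> 13 r = tails (arrays \<tau> 11 r)"
      and marks: "\<forall>e. arrays \<tau> 12 e \<noteq> 0 \<longleftrightarrow> e \<in> arrays \<tau> 11 ` {..<vars \<tau> 11}"
      using 4(1) unfolding I_def i by - (elim conjE, assumption)+
    show ?case
    proof
      have v: "vars (run body \<tau>) 9 = i" "vars (run body \<tau>) 10 = ?M"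
        using i fr by (auto simp: body_def M_def)
      show "I (run body \<tau>)"
      proof (cases "br i")
        case True
        then have r: "vars (run body \<tau>) 11 = Suc (vars \<tau> 11)"
          "arrays (run body \<tau>) 11 = (arrays \<tau> 11)(vars \<tau> 11 := pe i)"
          "arrays (run body \<tau>) 12 = (arrays \<tau> 12)(pe i := 1)"
          "arrays (run body \<tau>) 13 = (arrays \<tau> 13)(vars \<tau> 11 := tails (pe i))"
          using bri i fr by (auto simp: body_def M_def)
        show ?thesis
          unfolding I_def v r
        proof (intro conjI)
          show "\<forall>e. ((arrays \<tau> 12)(pe i := 1)) e \<noteq> 0 \<longleftrightarrow>
              e \<in> ((arrays \<tau> 11)(vars \<tau> 11 := pe i)) ` {..<Suc (vars \<tau> 11)}"
            using marks by (auto simp: lessThan_Suc fun_upd_image)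
          show "\<forall>r<Suc (vars \<tau> 11). ((arrays \<tau> 13)(vars \<tau> 11 := tails (pe i))) r =
              tails (((arrays \<tau> 11)(vars \<tau> 11 := pe i)) r)"
            using srcs by (auto simp: less_Suc_eq)
        qed (use M' ik True list in \<open>simp_all add: upt\<close>)
      next
        case False
        then have r: "vars (run body \<tau>) 11 = vars \<tau> 11"
          "arrays (run body \<tau>) 11 = arrays \<tau> 11" "arrays (run body \<tau>) 12 = arrays \<tau> 12"
          "arrays (run body \<tau>) 13 = arrays \<tau> 13"
          using bri i fr by (auto simp: body_def M_def)
        show ?thesis
          unfolding I_def v r
          using M' ik False list srcs marks by (intro conjI) (simp_all add: upt)
      qed
      show "vars (run body \<tau>) 9 < vars \<tau> 9" using v i by simp
    qed
  qed (use \<tau>\<^sub>0 in \<open>auto simp: body_def I_def\<close>)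
  have "wp (2 + (3 + (8 + (60 * Suc k + 4)))) find_bridges ?Q \<sigma>"
    unfolding find_bridges_def body_def[symmetric]
  proof (rule wp_Seq_run[OF _ _ wp_Seq_run[OF _ _ wp_Seq_run]], goal_cases)
    case 7
    define \<tau> where "\<tau> = run (If (Var 10) Skip (Assign 10 (Add (Var 8) (Const 1))))
      (run (Assign 10 (Read 32 (Var 3))) (run (Assign 9 (Var 8)) \<sigma>))"
    have \<tau>: "vars \<tau> 9 = k" "vars \<tau> 10 = (if lab t = 0 then Suc k else lab t)" "vars \<tau> 11 = 0"
      "arrays \<tau> = arrays \<sigma>"
      using \<sigma> by (auto simp: \<tau>_def)
    have "(\<forall>j. k \<le> j \<and> j \<le> k \<longrightarrow> P j) \<longleftrightarrow> P k" for P
      by (auto dest: le_antisym)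
    then have "I \<tau>"
      unfolding I_def \<tau> using \<sigma> x by auto
    then have w: "wp (60 * Suc k) (While (Var 9) body) (\<lambda>\<tau>. I \<tau> \<and> vars \<tau> 9 = 0) \<tau>"
      using \<sigma> \<tau> by (intro loop) auto
    show ?case
      unfolding \<tau>_def[symmetric]
    proof (rule wp_Seq[OF w], goal_cases)
      case (1 \<rho>)
      show ?case
        using 1(1) by (intro wp_mono[OF wp_run[of _ ?Q]]) (auto simp: I_def)
    qed
  qed auto
  then show ?thesis by (rule wp_mono) auto
qed

definition min_labels :: com where
  "min_labels = While (Less (Var 14) (Var 1))
     (Seq (If (Read 12 (Var 14)) Skip
          (If (Read 42 (Read 5 (Var 14)))
            (If (Read 14 (Read 4 (Var 14)))
              (If (Less (Read 42 (Read 5 (Var 14))) (Read 14 (Read 4 (Var 14))))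
                (Write 14 (Read 4 (Var 14)) (Read 42 (Read 5 (Var 14))))
                Skip)
              (Write 14 (Read 4 (Var 14)) (Read 42 (Read 5 (Var 14)))))
            Skip))
          (Assign 14 (Add (Var 14) (Const 1))))"

lemma min_labels_correct:
  assumes \<sigma>: "vars \<sigma> 1 = m" "vars \<sigma> 14 = 0" "arrays \<sigma> 14 = (\<lambda>_. 0)"
      "arrays \<sigma> 42 = lab" "arrays \<sigma> 4 = tails" "arrays \<sigma> 5 = heads" "arrays \<sigma> 12 = forb"
  shows "wp (100 * Suc m) min_labels (\<lambda>\<tau>. \<forall>v c. 0 < arrays \<tau> 14 v \<and> arrays \<tau> 14 v \<le> c \<longleftrightarrow>
    (\<exists>e<m. forb e = 0 \<and> tails e = v \<and> 0 < lab (heads e) \<and> lab (heads e) \<le> c)) \<sigma>"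
  unfolding min_labels_def
proof (rule wp_While[where I = "\<lambda>\<tau>. vars \<tau> 14 \<le> m \<and> (\<forall>v c. 0 < arrays \<tau> 14 v \<and> arrays \<tau> 14 v \<le> c \<longleftrightarrow>
    (\<exists>e<vars \<tau> 14. forb e = 0 \<and> tails e = v \<and> 0 < lab (heads e) \<and> lab (heads e) \<le> c))"
    and \<mu> = "\<lambda>\<tau>. m - vars \<tau> 14" and M = m], goal_cases)
  case (4 \<tau>)
  have fr: "arrays \<tau> 42 = lab" "arrays \<tau> 4 = tails" "arrays \<tau> 5 = heads" "arrays \<tau> 12 = forb" "vars \<tau> 1 = m"
    using framed_arrays[OF 4(2)] framed_vars[OF 4(2), of 1] \<sigma> by auto
  define e f where ef: "e = vars \<tau> 14" "f = arrays \<tau> 14"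
  have e: "e < m" using 4(3) fr ef by (auto split: if_splits)
  have f: "0 < f v \<and> f v \<le> c \<longleftrightarrow>
    (\<exists>e'<e. forb e' = 0 \<and> tails e' = v \<and> 0 < lab (heads e') \<and> lab (heads e') \<le> c)" for v c
    using 4(1) ef by blast
  have ex: "(\<exists>e'<Suc e. P e') \<longleftrightarrow> (\<exists>e'<e. P e') \<or> P e" for P
    by (auto simp: less_Suc_eq)
  define f' where "f' = (if forb e = 0 \<and> 0 < lab (heads e) \<and> (f (tails e) = 0 \<or> lab (heads e) < f (tails e))
    then f(tails e := lab (heads e)) else f)"
  have f': "0 < f' v \<and> f' v \<le> c \<longleftrightarrow>
    (\<exists>e'<Suc e. forb e' = 0 \<and> tails e' = v \<and> 0 < lab (heads e') \<and> lab (heads e') \<le> c)" for v c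
    unfolding ex f[symmetric] f'_def by auto
  let ?\<rho> = "run (Seq (If (Read 12 (Var 14)) Skip
          (If (Read 42 (Read 5 (Var 14)))
            (If (Read 14 (Read 4 (Var 14)))
              (If (Less (Read 42 (Read 5 (Var 14))) (Read 14 (Read 4 (Var 14))))
                (Write 14 (Read 4 (Var 14)) (Read 42 (Read 5 (Var 14))))
                Skip)
              (Write 14 (Read 4 (Var 14)) (Read 42 (Read 5 (Var 14)))))
            Skip))
          (Assign 14 (Add (Var 14) (Const 1)))) \<tau>"
  have "arrays ?\<rho> 14 = f'" "vars ?\<rho> 14 = Suc e"
    by (simp_all add: f'_def fr ef)
  then show ?case
    using e f' by (simp add: ef(1)[symmetric] del: run.simps)
next
  case (5 \<tau>)
  have "vars \<tau> 1 = m" using framed_vars[OF 5(2), of 1] \<sigma> by auto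
  with 5 have "vars \<tau> 14 = m" by (auto split: if_splits)
  with 5 show ?case by simp
qed (use \<sigma> in auto)

definition output_spans :: com where
  "output_spans =
     Seq (Seq (Assign 15 (Var 11)) (Seq (Assign 16 (Var 13)) (Assign 0 (Const 0))))
    (While (Var 16)
      (Seq (Assign 17 (Read 14 (Read 5 (Read 11 (Var 16)))))
      (Seq (If (Var 17)
             (If (Less (Var 17) (Var 15))
               (Seq (Write 0 (Var 0) (Read 4 (Read 11 (Sub (Var 17) (Const 1)))))
               (Seq (Write 1 (Var 0) (Read 5 (Read 11 (Sub (Var 17) (Const 1)))))
               (Seq (Write 2 (Var 0) (Read 4 (Read 11 (Var 16))))
               (Seq (Write 3 (Var 0) (Read 5 (Read 11 (Var 16))))
               (Seq (Assign 15 (Var 17))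
                    (Assign 0 (Add (Var 0) (Const 1))))))))
               Skip)
             Skip)
           (Assign 16 (Sub (Var 16) (Const 1))))))"

lemma output_pairs_push:
  assumes "vars \<tau> 0 = Suc (vars \<sigma> 0)" "arrays \<tau> 0 = (arrays \<sigma> 0)(vars \<sigma> 0 := a)"
    "arrays \<tau> 1 = (arrays \<sigma> 1)(vars \<sigma> 0 := b)" "arrays \<tau> 2 = (arrays \<sigma> 2)(vars \<sigma> 0 := c)"
    "arrays \<tau> 3 = (arrays \<sigma> 3)(vars \<sigma> 0 := d)"
  shows "output_pairs \<tau> = output_pairs \<sigma> @ [((a, b), (c, d))]"
  unfolding output_pairs_def assms by simp

lemma output_spans_correct:
  assumes \<sigma>: "vars \<sigma> 11 = q" "vars \<sigma> 13 = q - 1"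
      "arrays \<sigma> 14 = f" "arrays \<sigma> 4 = tails" "arrays \<sigma> 5 = heads" "arrays \<sigma> 11 = bs"
    and g: "\<And>j. g j = f (heads (bs j))"
    and least: "\<And>j. least j \<longleftrightarrow> 0 < g j \<and> g j < q \<and> (\<forall>j'. j < j' \<and> j' < q \<longrightarrow> g j' = 0 \<or> g j < g j')"
  shows "wp (100 * Suc q) output_spans (\<lambda>\<tau>. output_pairs \<tau> =
    map (\<lambda>j. ((tails (bs (g j - 1)), heads (bs (g j - 1))), (tails (bs j), heads (bs j))))
      (filter least (rev [1..<q]))) \<sigma>"
proof -
  let ?out = "\<lambda>j. ((tails (bs (g j - 1)), heads (bs (g j - 1))), (tails (bs j), heads (bs j)))"
  let ?init = "Seq (Assign 15 (Var 11)) (Seq (Assign 16 (Var 13)) (Assign 0 (Const 0)))"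
  define I :: "state \<Rightarrow> bool" where "I = (\<lambda>\<tau>. vars \<tau> 16 \<le> q - 1 \<and>
    (\<forall>c. c < vars \<tau> 15 \<longleftrightarrow> c < q \<and> (\<forall>j'. vars \<tau> 16 < j' \<and> j' < q \<longrightarrow> g j' = 0 \<or> c < g j')) \<and>
    output_pairs \<tau> = map ?out (filter least (rev [Suc (vars \<tau> 16)..<q])))"
  have "wp (6 + 80 * Suc q) output_spans (\<lambda>\<tau>. output_pairs \<tau> = map ?out (filter least (rev [1..<q]))) \<sigma>"
    unfolding output_spans_def
  proof (rule wp_Seq_run, goal_cases)
    case 3
    define \<tau> where "\<tau> = run ?init \<sigma>"
    have \<tau>: "vars \<tau> 15 = q" "vars \<tau> 16 = q - 1" "vars \<tau> 0 = 0" "arrays \<tau> = arrays \<sigma>"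
      using \<sigma> by (auto simp: \<tau>_def)
    show ?case
      unfolding \<tau>_def[symmetric]
    proof (rule wp_While[where I = I and \<mu> = "\<lambda>\<tau>. vars \<tau> 16" and M = q], goal_cases)
      case 2
      show ?case using \<tau>
        by (auto simp: I_def output_pairs_def)
    next
      case (4 \<rho>)
      have fr: "arrays \<rho> 14 = f" "arrays \<rho> 4 = tails" "arrays \<rho> 5 = heads" "arrays \<rho> 11 = bs"
        using framed_arrays[OF 4(2)] \<tau> \<sigma> by auto
      obtain i where i: "vars \<rho> 16 = Suc i" using 4(3) by (cases "vars \<rho> 16") auto
      define R where "R = vars \<rho> 15"
      have iq: "Suc i < q" using 4(1) unfolding I_def i by - (elim conjE, linarith)
      have R: "c < R \<longleftrightarrow> c < q \<and> (\<forall>j'. Suc i < j' \<and> j' < q \<longrightarrow> g j' = 0 \<or> c < g j')" for c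
        using 4(1) unfolding I_def R_def i by blast
      have out: "output_pairs \<rho> = map ?out (filter least (rev [Suc (Suc i)..<q]))"
        using 4(1) unfolding I_def i by - (elim conjE, assumption)
      have li: "least (Suc i) \<longleftrightarrow> 0 < g (Suc i) \<and> g (Suc i) < R"
        unfolding least R by blast
      have upt: "rev [Suc i..<q] = rev [Suc (Suc i)..<q] @ [Suc i]"
        using iq by (simp add: upt_conv_Cons)
      have all: "(\<forall>j'. i < j' \<and> j' < q \<longrightarrow> P j') \<longleftrightarrow> P (Suc i) \<and> (\<forall>j'. Suc i < j' \<and> j' < q \<longrightarrow> P j')" for P
        using iq by (metis Suc_lessD Suc_lessI lessI)
      let ?c = "Seq (Assign 17 (Read 14 (Read 5 (Read 11 (Var 16)))))
        (Seq (If (Var 17)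
           (If (Less (Var 17) (Var 15))
             (Seq (Write 0 (Var 0) (Read 4 (Read 11 (Sub (Var 17) (Const 1)))))
             (Seq (Write 1 (Var 0) (Read 5 (Read 11 (Sub (Var 17) (Const 1)))))
             (Seq (Write 2 (Var 0) (Read 4 (Read 11 (Var 16))))
             (Seq (Write 3 (Var 0) (Read 5 (Read 11 (Var 16))))
             (Seq (Assign 15 (Var 17))
                  (Assign 0 (Add (Var 0) (Const 1))))))))
             Skip)
           Skip)
         (Assign 16 (Sub (Var 16) (Const 1))))"
      show ?case
      proof (cases "least (Suc i)")
        case True
        then have gi: "0 < g (Suc i)" "g (Suc i) < R" using li by auto
        have "c < g (Suc i) \<longleftrightarrow>
            c < q \<and> (\<forall>j'. i < j' \<and> j' < q \<longrightarrow> g j' = 0 \<or> c < g j')" for c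
        proof -
          have "c < g (Suc i) \<Longrightarrow> c < R" "g (Suc i) \<noteq> 0" using gi by auto
          then show ?thesis unfolding all using R[of c] by blast
        qed
        note R' = this
        have "output_pairs (run ?c \<rho>) = output_pairs \<rho> @ [?out (Suc i)]"
          using gi by (intro output_pairs_push) (simp_all add: i fr g[symmetric] R_def[symmetric])
        moreover have "vars (run ?c \<rho>) 16 = i" "vars (run ?c \<rho>) 15 = g (Suc i)"
          using gi by (simp_all add: i fr g[symmetric] R_def[symmetric])
        ultimately show ?thesis
          using R' out True iq i unfolding I_def by (simp add: upt less_imp_le Suc_le_eq del: run.simps)
      next
        case False
        then have F: "g (Suc i) = 0 \<or> \<not> g (Suc i) < R" using li by auto
        have "c < R \<longleftrightarrow>
            c < q \<and> (\<forall>j'. i < j' \<and> j' < q \<longrightarrow> g j' = 0 \<or> c < g j')" for c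
        proof -
          have "c < R \<Longrightarrow> g (Suc i) = 0 \<or> c < g (Suc i)" using F by linarith
          then show ?thesis unfolding all using R[of c] by blast
        qed
        note R' = this
        have "output_pairs (run ?c \<rho>) = output_pairs \<rho>"
          using F by (auto simp: i fr g[symmetric] R_def[symmetric] output_pairs_def)
        moreover have "vars (run ?c \<rho>) 16 = i" "vars (run ?c \<rho>) 15 = R"
          using F by (auto simp: i fr g[symmetric] R_def[symmetric])
        ultimately show ?thesis
          using R' out False iq i unfolding I_def by (simp add: upt less_imp_le Suc_le_eq del: run.simps)
      qed
    next
      case (5 \<rho>)
      then show ?case by (simp add: I_def)
    next
      case 3
      show ?case using \<tau> by simp
    qed auto
  qed auto
  then show ?thesis by (rule wp_mono) auto
qed

lemma edges_unmarked:
  assumes "inj_on (\<lambda>e. (tails e, heads e)) {..<m}" "\<And>e. forb e \<noteq> (0 :: nat) \<Longrightarrow> e < m"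
  shows "edges m tails heads (\<lambda>e. forb e = 0) =
    edges m tails heads (\<lambda>_. True) - (\<lambda>e. (tails e, heads e)) ` {e. forb e \<noteq> 0}"
proof (intro equalityI subsetI DiffI notI)
  fix z assume "z \<in> edges m tails heads (\<lambda>e. forb e = 0)"
  then obtain e where e: "e < m" "forb e = 0" "z = (tails e, heads e)" by (auto simp: edges_def)
  then show "z \<in> edges m tails heads (\<lambda>_. True)" by (auto simp: edges_def)
  assume "z \<in> (\<lambda>e. (tails e, heads e)) ` {e. forb e \<noteq> 0}"
  then obtain e' where e': "forb e' \<noteq> 0" "z = (tails e', heads e')" by auto
  then have "e = e'" using e assms(2)[of e'] inj_onD[OF assms(1), of e e'] by simp
  then show False using e e' by simp
next
  fix z assume "z \<in> edges m tails heads (\<lambda>_. True) - (\<lambda>e. (tails e, heads e)) ` {e. forb e \<noteq> 0}"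
  then show "z \<in> edges m tails heads (\<lambda>e. forb e = 0)" by (auto simp: edges_def)
qed

lemma edges_converse: "edges m heads tails ok = (edges m tails heads ok)\<inverse>"
  by (auto simp: edges_def)

definition program :: com where
  "program =
     Seq copy_edges
    (Seq (Seq (Write 7 (Const 0) (Var 3)) (Assign 5 (Const 1)))
    (Seq (search_from 5 4 6 7 5 20)
    (Seq trace_path
    (Seq (search_from 4 5 10 9 8 30)
    (Seq find_bridges
    (Seq (search_from 5 4 12 13 13 40)
    (Seq min_labels output_spans)))))))"

lemma program_increments: "increments program"
  by (simp add: program_def copy_edges_def search_from_def link_edges_def search_loop_def
      search_body_def Let_def trace_path_def find_bridges_def min_labels_def output_spans_def)

lemma bridges_found:
  fixes tails heads x pe lab bs :: "nat \<Rightarrow> nat" and m :: nat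
  defines "A \<equiv> edges m tails heads (\<lambda>_. True)"
  assumes inj: "inj_on (\<lambda>e. (tails e, heads e)) {..<m}"
    and path: "\<And>i. i < k \<Longrightarrow> pe i < m \<and> tails (pe i) = x i \<and> heads (pe i) = x (Suc i)"
      "inj_on x {..k}" "if (x 0, t) \<in> A\<^sup>* then x k = t else k = 0"
    and marked: "\<And>e. forb e \<noteq> 0 \<longleftrightarrow> e \<in> pe ` {..<k}"
    and lab: "labels_found m k tails heads x (\<lambda>e. forb e = (0 :: nat)) lab"
    and bs: "map bs [0..<q] = map pe (rev (filter
      (\<lambda>i. \<forall>j. i < j \<and> j \<le> k \<longrightarrow> lab (x j) = 0 \<or> Suc i < lab (x j)) [0..<k]))"
  obtains B where "length B = q" "q \<le> k" "\<And>r. r < q \<Longrightarrow> bs r < m"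
    "\<And>r. r < q \<Longrightarrow> (tails (bs r), heads (bs r)) = rev B ! r"
    "bridge_chain A (x 0) t B"
    "set B = {e \<in> A. (x 0, t) \<in> A\<^sup>* \<and> (x 0, t) \<notin> (A - {e})\<^sup>*}"
proof -
  let ?E = "\<lambda>i. (x i, x (Suc i))" and ?br = "\<lambda>i. \<forall>j. i < j \<and> j \<le> k \<longrightarrow> lab (x j) = 0 \<or> Suc i < lab (x j)"
  define B where "B = map ?E (filter ?br [0..<k])"
  have len: "q = length (filter ?br [0..<k])" using arg_cong[OF bs, of length] by simp
  then have q: "length B = q" "q \<le> k" using length_filter_le[of ?br "[0..<k]"] by (simp_all add: B_def)
  have bs_nth: "bs r = pe (rev (filter ?br [0..<k]) ! r)" if "r < q" for r
    using arg_cong[OF bs, of "\<lambda>xs. xs ! r"] that len by simp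
  have sel: "rev (filter ?br [0..<k]) ! r < k" if "r < q" for r
  proof -
    have "rev (filter ?br [0..<k]) ! r \<in> set (rev (filter ?br [0..<k]))"
      using that len by (intro nth_mem) simp
    then show ?thesis by simp
  qed
  have "bs r < m" if "r < q" for r
    using bs_nth[OF that] path(1)[OF sel[OF that]] by simp
  moreover have "(tails (bs r), heads (bs r)) = rev B ! r" if "r < q" for r
  proof -
    have "rev B = map ?E (rev (filter ?br [0..<k]))" by (simp add: B_def rev_map)
    then have "rev B ! r = ?E (rev (filter ?br [0..<k]) ! r)" using that len by (simp add: nth_map)
    then show ?thesis using bs_nth[OF that] path(1)[OF sel[OF that]] by simp
  qed
  moreover have "bridge_chain A (x 0) t B \<and>
    set B = {e \<in> A. (x 0, t) \<in> A\<^sup>* \<and> (x 0, t) \<notin> (A - {e})\<^sup>*}"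
  proof (cases "(x 0, t) \<in> A\<^sup>*")
    case True
    then have t: "x k = t" using path(3) by simp
    have E: "?E i \<in> A" if "i < k" for i
      using path(1)[OF that] unfolding A_def edges_def by force
    have "(\<lambda>e. (tails e, heads e)) ` {e. forb e \<noteq> 0} = ?E ` {..<k}"
      using marked path(1) by (force simp: image_iff)
    moreover have "e < m" if "forb e \<noteq> 0" for e using marked that path(1) by auto
    ultimately have edges: "edges m tails heads (\<lambda>e. forb e = 0) = A - ?E ` {..<k}"
      using edges_unmarked[OF inj, of forb] by (simp add: A_def)
    have lab': "0 < lab v \<and> lab v \<le> r \<longleftrightarrow> (\<exists>r'<r. (x r', v) \<in> (A - ?E ` {..<k})\<^sup>*)" if "r \<le> k" for r v
      using lab that unfolding edges[symmetric] labels_found_def by blast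
    have br: "?br i \<longleftrightarrow> (\<forall>j. i < j \<and> j \<le> k \<longrightarrow> \<not> (\<exists>i'\<le>i. (x i', x j) \<in> (A - ?E ` {..<k})\<^sup>*))" for i
    proof (cases "Suc i \<le> k")
      case True
      have "lab (x j) = 0 \<or> Suc i < lab (x j) \<longleftrightarrow> \<not> (\<exists>i'\<le>i. (x i', x j) \<in> (A - ?E ` {..<k})\<^sup>*)" for j
      proof -
        have "lab (x j) = 0 \<or> Suc i < lab (x j) \<longleftrightarrow> \<not> (0 < lab (x j) \<and> lab (x j) \<le> Suc i)" by auto
        then show ?thesis unfolding lab'[OF True] less_Suc_eq_le .
      qed
      then show ?thesis by simp
    next
      case False
      then show ?thesis by auto
    qed
    show ?thesis
      using path_bridges[OF E path(2) br] True t unfolding B_def by auto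
  next
    case False
    then have "B = []" using path(3) by (simp add: B_def)
    then show ?thesis using False by (auto simp: bridge_chain_def)
  qed
  ultimately show thesis using that[of B] q by blast
qed

lemma labels_of_bridge_heads:
  fixes tails heads bs f lab :: "nat \<Rightarrow> nat" and m :: nat
  defines "A \<equiv> edges m tails heads (\<lambda>_. True)"
  assumes inj: "inj_on (\<lambda>e. (tails e, heads e)) {..<m}"
    and B: "length B = q" "\<And>r. r < q \<Longrightarrow> bs r < m"
      "\<And>r. r < q \<Longrightarrow> (tails (bs r), heads (bs r)) = rev B ! r"
    and marked: "\<And>e. forb e \<noteq> 0 \<longleftrightarrow> e \<in> bs ` {..<q}"
    and src: "\<And>r. r < q \<Longrightarrow> src r = tails (bs r)"
    and lab: "labels_found m (q - 1) heads tails src (\<lambda>e. forb e = (0 :: nat)) lab"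
    and f: "\<And>v c. 0 < f v \<and> f v \<le> c \<longleftrightarrow>
      (\<exists>e<m. forb e = 0 \<and> tails e = v \<and> 0 < lab (heads e) \<and> lab (heads e) \<le> c)"
    and j: "j < q"
  shows "0 < f (heads (bs j)) \<and> f (heads (bs j)) \<le> c \<longleftrightarrow>
    (\<exists>r<c. r < q - 1 \<and> (snd (rev B ! j), fst (rev B ! r)) \<in> (A - set B)\<^sup>+)"
proof -
  have "set B = set (rev B)" by simp
  also have "\<dots> = (!) (rev B) ` {..<q}" using B(1) by (simp only: set_conv_nth length_rev) auto
  also have "\<dots> = (\<lambda>e. (tails e, heads e)) ` {e. forb e \<noteq> 0}"
    using B(3) marked by (force simp: image_iff)
  finally have set_B: "(\<lambda>e. (tails e, heads e)) ` {e. forb e \<noteq> 0} = set B" by simp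
  have "e < m" if "forb e \<noteq> 0" for e using marked that B(2) by auto
  then have edges: "edges m tails heads (\<lambda>e. forb e = 0) = A - set B"
    using edges_unmarked[OF inj, of forb] set_B by (simp add: A_def)
  have tail: "src r = fst (rev B ! r)" if "r < q" for r
    using src[OF that] B(3)[OF that] by (metis fst_conv)
  have head: "heads (bs j) = snd (rev B ! j)" using B(3)[OF j] by (metis snd_conv)
  have lab': "0 < lab v \<and> lab v \<le> c \<longleftrightarrow> (\<exists>r<c. r < q - 1 \<and> (v, fst (rev B ! r)) \<in> (A - set B)\<^sup>*)" for v c
  proof -
    let ?c = "min c (q - 1)"
    have "lab v \<le> q - 1" using lab unfolding labels_found_def by blast
    moreover have "0 < lab v \<and> lab v \<le> ?c \<longleftrightarrow> (\<exists>r<?c. (src r, v) \<in> ((A - set B)\<inverse>)\<^sup>*)"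
      using lab min.cobounded2[of c "q - 1"]
      unfolding edges_converse[of m heads tails] edges labels_found_def by blast
    ultimately have "0 < lab v \<and> lab v \<le> c \<longleftrightarrow> (\<exists>r<?c. (v, src r) \<in> (A - set B)\<^sup>*)"
      by (simp add: rtrancl_converse)
    also have "\<dots> \<longleftrightarrow> (\<exists>r<c. r < q - 1 \<and> (v, fst (rev B ! r)) \<in> (A - set B)\<^sup>*)"
      using tail by auto
    finally show ?thesis .
  qed
  have trancl: "(v, w) \<in> (A - set B)\<^sup>+ \<longleftrightarrow>
      (\<exists>e<m. forb e = 0 \<and> tails e = v \<and> (heads e, w) \<in> (A - set B)\<^sup>*)" for v w
  proof
    assume "(v, w) \<in> (A - set B)\<^sup>+"
    then obtain u where u: "(v, u) \<in> edges m tails heads (\<lambda>e. forb e = 0)" "(u, w) \<in> (A - set B)\<^sup>*"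
      unfolding edges using tranclD by metis
    then show "\<exists>e<m. forb e = 0 \<and> tails e = v \<and> (heads e, w) \<in> (A - set B)\<^sup>*"
      by (auto simp: edges_def)
  next
    assume "\<exists>e<m. forb e = 0 \<and> tails e = v \<and> (heads e, w) \<in> (A - set B)\<^sup>*"
    then obtain e where e: "e < m" "forb e = 0" "tails e = v" "(heads e, w) \<in> (A - set B)\<^sup>*" by blast
    then have "(v, heads e) \<in> A - set B" unfolding edges[symmetric] by (auto simp: edges_def)
    then show "(v, w) \<in> (A - set B)\<^sup>+" using e(4) by (rule rtrancl_into_trancl2)
  qed
  show ?thesis unfolding f lab' trancl head by blast
qed

lemma program_correct:
  assumes G: "pair_fin_digraph G" "s \<in> pverts G" "t \<in> pverts G" "encodes n es G"
    and m: "m = length es"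
  shows "wp (3000 * (m + n)) program
    (\<lambda>\<tau>. distinct (output_pairs \<tau>) \<and>
      set (output_pairs \<tau>) = pre_digraph.minimal_walk_breakers (with_proj G) s t)
    (input_state n es s t)"
proof -
  interpret pair_fin_digraph G by fact
  have st: "s < n" "t < n" and es: "distinct es" "set es = parcs G"
    using G by (auto simp: encodes_def)
  have es_less: "fst (es ! e) < n" "snd (es ! e) < n" if "e < m" for e
    using that m es G(4) nth_mem[of e es] arc_fst_in_verts[of "es ! e"] arc_snd_in_verts[of "es ! e"]
    by (auto simp: encodes_def)
  let ?\<sigma> = "input_state n es s t"
  have input: "vars ?\<sigma> 1 = m" "vars ?\<sigma> 2 = s" "vars ?\<sigma> 3 = t" "\<And>x. 4 \<le> x \<Longrightarrow> vars ?\<sigma> x = 0"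
    "\<And>e. e < m \<Longrightarrow> arrays ?\<sigma> 0 e = fst (es ! e)" "\<And>e. e < m \<Longrightarrow> arrays ?\<sigma> 1 e = snd (es ! e)"
    "\<And>a. 4 \<le> a \<Longrightarrow> arrays ?\<sigma> a = (\<lambda>_. 0)"
    by (auto simp: input_state_def m)
  let ?Q = "\<lambda>\<tau>. distinct (output_pairs \<tau>) \<and> set (output_pairs \<tau>) = minimal_walk_breakers s t"
  have "wp (40 * Suc m + (10 + (140 * Suc (m + n + 1) + (50 * Suc n + (140 * Suc (m + n + n) +
      (100 * Suc n + (140 * Suc (m + n + n) + (100 * Suc m + 100 * Suc n)))))))) program ?Q ?\<sigma>"
    unfolding program_def
  proof (rule wp_Seq[OF copy_edges_correct[where m = m]], goal_cases)
    case (3 \<tau>0)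
    define tails heads where th: "tails = arrays \<tau>0 4" "heads = arrays \<tau>0 5"
    define A where "A = edges m tails heads (\<lambda>_. True)"
    have th_es: "tails e = fst (es ! e)" "heads e = snd (es ! e)" if "e < m" for e
      using 3(1) that input by (auto simp: th)
    have th_less: "tails e < n" "heads e < n" if "e < m" for e
      using th_es es_less that by auto
    have inj: "inj_on (\<lambda>e. (tails e, heads e)) {..<m}"
    proof (rule inj_onI)
      fix e e' assume "e \<in> {..<m}" "e' \<in> {..<m}" "(tails e, heads e) = (tails e', heads e')"
      then have "es ! e = es ! e'" using th_es[of e] th_es[of e'] by (simp add: prod_eq_iff)
      then show "e = e'" using \<open>e \<in> {..<m}\<close> \<open>e' \<in> {..<m}\<close> es(1) m by (simp add: nth_eq_iff_index_eq)
    qed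
    have A: "A = parcs G"
    proof -
      have "(tails e, heads e) = es ! e" if "e < m" for e using th_es[OF that] by simp
      then have "A = {es ! e | e. e < m}" unfolding A_def edges_def by metis
      then show ?thesis using es(2) m by (simp add: set_conv_nth)
    qed
    have v0: "vars \<tau>0 1 = m" "vars \<tau>0 2 = s" "vars \<tau>0 3 = t" "\<And>x. 5 \<le> x \<Longrightarrow> vars \<tau>0 x = 0"
      using framed_vars[OF 3(2)] input by (auto simp: copy_edges_def)
    have a0: "\<And>a. 6 \<le> a \<Longrightarrow> arrays \<tau>0 a = (\<lambda>_. 0)"
      using framed_arrays[OF 3(2)] input by (auto simp: copy_edges_def)
    let ?init = "Seq (Write 7 (Const 0) (Var 3)) (Assign 5 (Const 1))"
    define \<tau>1 where "\<tau>1 = run ?init \<tau>0"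
    have v1: "vars \<tau>1 1 = m" "vars \<tau>1 2 = s" "vars \<tau>1 3 = t" "vars \<tau>1 5 = 1"
        "\<And>x. 6 \<le> x \<Longrightarrow> vars \<tau>1 x = 0"
      and a1: "arrays \<tau>1 4 = tails" "arrays \<tau>1 5 = heads" "arrays \<tau>1 6 = (\<lambda>_. 0)" "arrays \<tau>1 7 0 = t"
        "\<And>a. 8 \<le> a \<Longrightarrow> arrays \<tau>1 a = (\<lambda>_. 0)"
      using v0 a0 by (auto simp: \<tau>1_def th)
    show ?case
    proof (rule wp_Seq_run, goal_cases)
      case 3
      have s1: "search n m 1 (arrays \<tau>1 5) (arrays \<tau>1 4) (arrays \<tau>1 7)"
        using th_less st a1 by (auto simp: search_def)
      show ?case
        unfolding \<tau>1_def[symmetric]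
      proof (rule wp_Seq[OF search_from_correct[OF s1 v1(1,4)]], goal_cases)
        case (6 \<tau>2)
        note f2 = framed_vars[OF 6(2), unfolded search_from_written] framed_arrays[OF 6(2), unfolded search_from_written]
        have v2: "vars \<tau>2 1 = m" "vars \<tau>2 2 = s" "vars \<tau>2 3 = t"
            "\<And>x. 6 \<le> x \<Longrightarrow> x \<notin> {20..24} \<Longrightarrow> vars \<tau>2 x = 0"
          and a2: "arrays \<tau>2 4 = tails" "arrays \<tau>2 5 = heads"
            "\<And>a. 8 \<le> a \<Longrightarrow> a \<notin> {20..24} \<Longrightarrow> arrays \<tau>2 a = (\<lambda>_. 0)"
          using f2 v1 a1 by auto
        define lab1 par1 where d1: "lab1 = arrays \<tau>2 22" "par1 = arrays \<tau>2 23"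
        have l1: "labels_found m 1 heads tails (arrays \<tau>1 7) (\<lambda>_. True) lab1"
          and p1: "parents_found n m 1 heads tails (arrays \<tau>1 7) lab1 par1"
          using 6(1) a1 by (simp_all add: d1)
        have lab1_le: "lab1 v \<le> 1" for v using l1 by (simp add: labels_found_def)
        have lab1: "lab1 v \<noteq> 0 \<longleftrightarrow> (v, t) \<in> A\<^sup>*" for v
        proof -
          have "0 < lab1 v \<and> lab1 v \<le> 1 \<longleftrightarrow> (\<exists>r'<1. (arrays \<tau>1 7 r', v) \<in> (edges m heads tails (\<lambda>_. True))\<^sup>*)"
            using l1 unfolding labels_found_def by blast
          then show ?thesis
            using lab1_le[of v] a1(4)
            by (simp add: edges_converse[of m heads tails] A_def[symmetric] rtrancl_converse)
        qed
        obtain pos :: "nat \<Rightarrow> nat" where pos: "\<And>v. lab1 v \<noteq> 0 \<Longrightarrow> pos v < n"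
          "\<And>v. lab1 v \<noteq> 0 \<Longrightarrow> v \<noteq> t \<Longrightarrow> par1 v < m \<and> tails (par1 v) = v \<and>
             lab1 (heads (par1 v)) \<noteq> 0 \<and> pos (heads (par1 v)) < pos v"
          using p1 a1(4) unfolding parents_found_def by auto
        show ?case
        proof (rule wp_Seq[OF trace_path_correct[OF v2(2,3) _ _ d1[symmetric] a2(1,2) lab1_le pos]], goal_cases)
          case (6 \<tau>3)
          define k x pe forb where d3: "k = vars \<tau>3 8" "x = arrays \<tau>3 9" "pe = arrays \<tau>3 8" "forb = arrays \<tau>3 10"
          have x0: "x 0 = s"
            and path: "\<And>i. i < k \<Longrightarrow> pe i < m \<and> tails (pe i) = x i \<and> heads (pe i) = x (Suc i)"
            and inj_x: "inj_on x {..k}" and xk: "if lab1 s = 0 then k = 0 else x k = t"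
            and marked: "\<And>e. forb e \<noteq> 0 \<longleftrightarrow> e \<in> pe ` {..<k}"
            using 6(1) unfolding d3[symmetric] by blast+
          have x_less: "x i < n" if "i \<le> k" for i
            using that x0 st path th_less by (cases i) (auto, metis Suc_le_eq)
          have kn: "k < n"
          proof -
            have "x ` {..k} \<subseteq> {..<n}" using x_less by auto
            then have "card {..k} \<le> card {..<n}" by (intro card_inj_on_le[OF inj_x]) auto
            then show ?thesis by simp
          qed
          note f3 = framed_vars[OF 6(2)] framed_arrays[OF 6(2)]
          have v3: "vars \<tau>3 1 = m" "vars \<tau>3 3 = t" "vars \<tau>3 8 = k"
              "\<And>x. 9 \<le> x \<Longrightarrow> x \<notin> {20..24} \<Longrightarrow> vars \<tau>3 x = 0"
            and a3: "arrays \<tau>3 4 = tails" "arrays \<tau>3 5 = heads"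
              "\<And>a. 11 \<le> a \<Longrightarrow> a \<notin> {20..24} \<Longrightarrow> arrays \<tau>3 a = (\<lambda>_. 0)"
            using f3 v2 a2 by (auto simp: trace_path_def d3)
          have s3: "search n m k (arrays \<tau>3 4) (arrays \<tau>3 5) (arrays \<tau>3 9)"
            using th_less x_less by (auto simp: search_def a3 d3(2)[symmetric])
          show ?case
          proof (rule wp_Seq[OF wp_mono[OF search_from_correct[OF s3 v3(1,3)]], where P = "\<lambda>\<tau>.
              labels_found m k tails heads x (\<lambda>e. forb e = 0) (arrays \<tau> 32)"], goal_cases)
            case (8 \<tau>4)
            note f4 = framed_vars[OF 8(2), unfolded search_from_written] framed_arrays[OF 8(2), unfolded search_from_written]
            have v4: "vars \<tau>4 1 = m" "vars \<tau>4 3 = t" "vars \<tau>4 8 = k"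
                "\<And>x. 9 \<le> x \<Longrightarrow> x \<notin> {20..24} \<Longrightarrow> x \<notin> {30..34} \<Longrightarrow> vars \<tau>4 x = 0"
              and a4: "arrays \<tau>4 4 = tails" "arrays \<tau>4 5 = heads" "arrays \<tau>4 8 = pe" "arrays \<tau>4 9 = x"
                "\<And>a. 11 \<le> a \<Longrightarrow> a \<notin> {20..24} \<Longrightarrow> a \<notin> {30..34} \<Longrightarrow> arrays \<tau>4 a = (\<lambda>_. 0)"
              using f4 v3 a3 d3 by auto
            define lab2 where "lab2 = arrays \<tau>4 32"
            have l2: "labels_found m k tails heads x (\<lambda>e. forb e = 0) lab2"
              using 8(1) by (simp add: lab2_def)
            have lab2: "lab2 (x i) \<noteq> 0" if "i < k" for i
              using l2 that unfolding labels_found_def by (metis gr0_conv_Suc nat.distinct(1) order_refl rtrancl.rtrancl_refl)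
            define br where "br = (\<lambda>i. \<forall>j. i < j \<and> j \<le> k \<longrightarrow> lab2 (x j) = 0 \<or> Suc i < lab2 (x j))"
            show ?case
            proof (rule wp_Seq[OF wp_mono[OF find_bridges_correct[where br = br, OF v4(3,2) _ _ a4(4,3)
                  lab2_def[symmetric] a4(1)]], where P = "\<lambda>\<tau>.
                map (arrays \<tau> 11) [0..<vars \<tau> 11] = map pe (rev (filter br [0..<k])) \<and>
                (\<forall>r<vars \<tau> 11. arrays \<tau> 13 r = tails (arrays \<tau> 11 r)) \<and>
                (\<forall>e. arrays \<tau> 12 e \<noteq> 0 \<longleftrightarrow> e \<in> arrays \<tau> 11 ` {..<vars \<tau> 11}) \<and>
                vars \<tau> 13 = vars \<tau> 11 - 1"], goal_cases)
              case (8 \<tau>5)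
              define q bs src forb' where d5: "q = vars \<tau>5 11" "bs = arrays \<tau>5 11" "src = arrays \<tau>5 13"
                "forb' = arrays \<tau>5 12"
              have bs: "map bs [0..<q] = map pe (rev (filter br [0..<k]))"
                and src: "\<And>r. r < q \<Longrightarrow> src r = tails (bs r)"
                and marked': "\<And>e. forb' e \<noteq> 0 \<longleftrightarrow> e \<in> bs ` {..<q}"
                and v5': "vars \<tau>5 13 = q - 1"
                using 8(1) unfolding d5[symmetric] by blast+
              note f5 = framed_vars[OF 8(2)] framed_arrays[OF 8(2)]
              have v5: "vars \<tau>5 1 = m" "\<And>x. 14 \<le> x \<Longrightarrow> x \<notin> {20..24} \<Longrightarrow> x \<notin> {30..34} \<Longrightarrow> vars \<tau>5 x = 0"
                and a5: "arrays \<tau>5 4 = tails" "arrays \<tau>5 5 = heads"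
                  "\<And>a. 14 \<le> a \<Longrightarrow> a \<notin> {20..24} \<Longrightarrow> a \<notin> {30..34} \<Longrightarrow> arrays \<tau>5 a = (\<lambda>_. 0)"
                using f5 v4 a4 by (auto simp: find_bridges_def)
              have xt: "if (x 0, t) \<in> A\<^sup>* then x k = t else k = 0"
                using xk lab1[of s] x0 by auto
              obtain B where B: "length B = q" "q \<le> k" "\<And>r. r < q \<Longrightarrow> bs r < m"
                "\<And>r. r < q \<Longrightarrow> (tails (bs r), heads (bs r)) = rev B ! r"
                "bridge_chain A (x 0) t B"
                "set B = {e \<in> A. (x 0, t) \<in> A\<^sup>* \<and> (x 0, t) \<notin> (A - {e})\<^sup>*}"
                using bridges_found[OF inj path inj_x xt[unfolded A_def] marked l2 bs[unfolded br_def]]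
                unfolding A_def by blast
              have s5: "search n m (q - 1) (arrays \<tau>5 5) (arrays \<tau>5 4) (arrays \<tau>5 13)"
                using th_less B(3) src by (auto simp: search_def a5 d5(3)[symmetric])
              show ?case
              proof (rule wp_Seq[OF wp_mono[OF search_from_correct[OF s5 v5(1) v5']], where P = "\<lambda>\<tau>.
                  labels_found m (q - 1) heads tails src (\<lambda>e. forb' e = 0) (arrays \<tau> 42)"], goal_cases)
                case (8 \<tau>6)
                note f6 = framed_vars[OF 8(2), unfolded search_from_written] framed_arrays[OF 8(2), unfolded search_from_written]
                have v6: "vars \<tau>6 1 = m" "vars \<tau>6 11 = q" "vars \<tau>6 13 = q - 1" "vars \<tau>6 14 = 0"
                  and a6: "arrays \<tau>6 4 = tails" "arrays \<tau>6 5 = heads" "arrays \<tau>6 11 = bs" "arrays \<tau>6 12 = forb'"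
                    "arrays \<tau>6 14 = (\<lambda>_. 0)"
                  using f6 v5 v5' a5 d5 by auto
                define lab3 where "lab3 = arrays \<tau>6 42"
                have l3: "labels_found m (q - 1) heads tails src (\<lambda>e. forb' e = 0) lab3"
                  using 8(1) by (simp add: lab3_def)
                show ?case
                proof (rule wp_Seq[OF min_labels_correct[OF v6(1,4) a6(5) lab3_def[symmetric] a6(1,2,4)]], goal_cases)
                  case (1 \<tau>7)
                  define f where "f = arrays \<tau>7 14"
                  have f: "0 < f v \<and> f v \<le> c \<longleftrightarrow>
                    (\<exists>e<m. forb' e = 0 \<and> tails e = v \<and> 0 < lab3 (heads e) \<and> lab3 (heads e) \<le> c)" for v c
                    using 1(1) unfolding f_def by blast
                  note f7 = framed_vars[OF 1(2)] framed_arrays[OF 1(2)]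
                  have v7: "vars \<tau>7 11 = q" "vars \<tau>7 13 = q - 1"
                    and a7: "arrays \<tau>7 4 = tails" "arrays \<tau>7 5 = heads" "arrays \<tau>7 11 = bs"
                    using f7 v6 a6 by (auto simp: min_labels_def)
                  define g where "g = (\<lambda>j. f (heads (bs j)))"
                  define least where "least = (\<lambda>j. 0 < g j \<and> g j < q \<and>
                    (\<forall>j'. j < j' \<and> j' < q \<longrightarrow> g j' = 0 \<or> g j < g j'))"
                  have g: "0 < g j \<and> g j \<le> c \<longleftrightarrow>
                    (\<exists>r<c. r < q - 1 \<and> (snd (rev B ! j), fst (rev B ! r)) \<in> (A - set B)\<^sup>+)" if "j < q" for j c
                    unfolding g_def A_def
                    by (rule labels_of_bridge_heads[OF inj B(1,3,4) marked' src l3 f that])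
                  have set_B: "set B = {e. st_bridge s t e}"
                    using B(6) G(2) by (auto simp: st_bridge_iff A x0)
                  have result: "minimal_walk_breakers s t =
                    (\<lambda>j. (rev B ! (g j - 1), rev B ! j)) ` {j. 1 \<le> j \<and> j < q \<and> least j}"
                    using minimal_walk_breakers_eq[OF B(5)[unfolded A x0] set_B G(2)]
                      bridge_chain.minimal_free_spans_by_labels[OF B(5)[unfolded A x0], where g = g and least = least] g
                    unfolding A B(1) least_def by simp
                  have "distinct (rev B)" using bridge_chain.chain_distinct[OF B(5)] by simp
                  show ?case
                  proof (rule wp_mono[OF output_spans_correct[where g = g and least = least, OF v7 f_def[symmetric] a7]], goal_cases)
                    case (4 \<tau>8)
                    have out: "output_pairs \<tau>8 = map (\<lambda>j. (rev B ! (g j - 1), rev B ! j)) (filter least (rev [1..<q]))"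
                      unfolding 4(1)
                    proof (rule map_cong[OF refl])
                      fix j assume "j \<in> set (filter least (rev [1..<q]))"
                      then have "j < q" "g j - 1 < q" by (auto simp: least_def)
                      then show "((tails (bs (g j - 1)), heads (bs (g j - 1))), tails (bs j), heads (bs j)) =
                          (rev B ! (g j - 1), rev B ! j)"
                        using B(4) by simp
                    qed
                    have "inj_on (\<lambda>j. rev B ! j) {1..<q}"
                      using \<open>distinct (rev B)\<close> B(1) by (auto simp: inj_on_def nth_eq_iff_index_eq simp del: distinct_rev)
                    then have "distinct (output_pairs \<tau>8)"
                      unfolding out by (auto simp: distinct_map inj_on_def)
                    moreover have "set (output_pairs \<tau>8) = minimal_walk_breakers s t"
                      unfolding out result by (auto simp: image_iff)
                    ultimately show ?case by simp
                  qed (use B(2) kn in \<open>auto simp: g_def least_def\<close>)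
                qed
              next
                case (2 i)
                then show ?case using v5(2)[of i] by simp
              next
                case (3 i)
                then show ?case using a5(3)[of i] by simp
              next
                case 6
                show ?case using B(2) kn by simp
              next
                case (7 \<tau>)
                then show ?case by (simp add: a5 d5)
              qed simp_all
            next
              case 3
              then show ?case using xk by (simp split: if_splits)
            next
              case (4 i)
              then show ?case by (rule lab2)
            next
              case (5 i)
              show ?case by (simp add: br_def)
            next
              case (7 \<tau>)
              then show ?case by simp
            qed (use kn in \<open>simp_all add: v4 a4\<close>)
          next
            case (2 i)
            then show ?case using v3(4)[of i] by simp
          next
            case (3 i)
            then show ?case using a3(3)[of i] by simp
          next
            case 6
            show ?case using kn by simp
          next
            case (7 \<tau>)
            then show ?case by (simp add: a3 d3)
          qed simp_all
        qed (simp_all add: v2 a2)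
      next
        case (2 i)
        then show ?case using v1(5)[of i] by simp
      next
        case (3 i)
        then show ?case using a1(5)[of i] by simp
      qed simp_all
    qed auto
  qed (use input in auto)
  moreover have "1 \<le> n" using st by simp
  ultimately show ?thesis by (elim wp_mono) auto
qed

lemma bounded_input_state:
  assumes "s < n" "t < n" "\<And>e. e \<in> set es \<Longrightarrow> fst e < n \<and> snd e < n"
  shows "bounded (length es + n) (input_state n es s t)"
proof -
  have "fst (es ! e) \<le> length es + n" "snd (es ! e) \<le> length es + n" if "e < length es" for e
    using assms(3)[of "es ! e"] that by auto
  then show ?thesis using assms(1,2) by (simp add: bounded_def input_state_def)
qed

theorem theorem13:
  shows "\<exists>(prog :: com) (c :: nat). \<forall>(G :: nat pair_pre_digraph) (n :: nat) (m :: nat) es s t.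
    pair_fin_digraph G \<and> n = card (pverts G) \<and> m = card (parcs G) \<and>
    s \<in> pverts G \<and> t \<in> pverts G \<and> encodes n es G \<longrightarrow>
    (\<exists>T \<sigma>. exec (c * (m + n)) prog (input_state n es s t) T \<sigma> \<and> T \<le> c * (m + n) \<and>
       distinct (output_pairs \<sigma>) \<and>
       set (output_pairs \<sigma>) = pre_digraph.minimal_walk_breakers (with_proj G) s t)"
proof (rule exI[of _ program], rule exI[of _ "3001 :: nat"], intro allI impI)
  fix G :: "nat pair_pre_digraph" and n m es s t
  assume a: "pair_fin_digraph G \<and> n = card (pverts G) \<and> m = card (parcs G) \<and>
    s \<in> pverts G \<and> t \<in> pverts G \<and> encodes n es G"
  then have G: "pair_fin_digraph G" "s \<in> pverts G" "t \<in> pverts G" "encodes n es G"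
    and card: "m = card (parcs G)"
    by blast+
  interpret pair_fin_digraph G by (rule G(1))
  have es: "distinct es" "set es = parcs G" "pverts G = {..<n}"
    using G(4) by (simp_all add: encodes_def)
  have m: "m = length es" using card distinct_card[OF es(1)] es(2) by simp
  have "wp (3000 * (m + n)) program
    (\<lambda>\<tau>. distinct (output_pairs \<tau>) \<and> set (output_pairs \<tau>) = minimal_walk_breakers s t)
    (input_state n es s t)"
    by (rule program_correct[OF G m])
  then obtain W T \<sigma> where exec: "exec W program (input_state n es s t) T \<sigma>" "T \<le> 3000 * (m + n)"
    and out: "distinct (output_pairs \<sigma>)" "set (output_pairs \<sigma>) = minimal_walk_breakers s t"
    by (auto simp: wp_def)
  have "bounded (m + n) (input_state n es s t)"
    unfolding m using G(2,3) es arc_fst_in_verts arc_snd_in_verts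
    by (intro bounded_input_state) simp_all
  then have "exec (m + n + T) program (input_state n es s t) T \<sigma>"
    using exec_increments[OF exec(1) program_increments] by blast
  moreover have "m + n + T \<le> 3001 * (m + n)" using exec(2) by simp
  ultimately have "exec (3001 * (m + n)) program (input_state n es s t) T \<sigma>"
    by (rule exec_mono)
  moreover have "T \<le> 3001 * (m + n)" using exec(2) by simp
  ultimately show "\<exists>T \<sigma>. exec (3001 * (m + n)) program (input_state n es s t) T \<sigma> \<and>
      T \<le> 3001 * (m + n) \<and> distinct (output_pairs \<sigma>) \<and>
      set (output_pairs \<sigma>) = minimal_walk_breakers s t"
    using out by blast
qed

end
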